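(* Let $0<A<B<\infty$ and let $\{d_i\}_{i\in I}$ be a countable sequence in $[0,B]$ with $\sum_{i\in I} d_i=\sum_{i\in I}(B-d_i)=\infty$. Define $$C=\sum_{i\in I:\ d_i<A}d_i\qquad\text{and}\qquad D=\sum_{i\in I:\ d_i\ge A}(B-d_i),$$ each an element of $[0,\infty]$. There is a positive operator $E$ with diagonal $\{d_i\}_{i\in I}$ and $\sigma(E)=\{0,A,B\}$ if and only if one of the following holds: (i) $C=\infty$; (ii) $D=\infty$; (iii) $C,D<\infty$ and there exist $N\in\mathbb{N}$ and $k\in\mathbb{Z}$ such that $$C-D=NA+kB\qquad\text{and}\qquad C\ge (N+k)A.$$
   Context: $\mathbb{N}=\{1,2,3,\dots\}$. A positive operator $E$ is a bounded self-adjoint operator on a complex Hilbert space $\mathcal{H}$ with $\langle Ex,x\rangle\ge 0$ for all $x$; $\sigma(E)$ is its spectrum. "$E$ has diagonal $\{d_i\}_{i\in I}$" means that $\mathcal{H}$ has an orthonormal basis $\{e_i\}_{i\in I}$ with $\langle Ee_i,e_i\rangle=d_i$ for all $i\in I$. All Hilbert spaces are separable, so index sets are countable. *)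

theory Defs
  imports "HOL-Analysis.Analysis"
begin

section \<open>Complex Hilbert spaces\<close>

text \<open>
  A complex inner product space is a real inner product space (with inner product
  \<open>Re \<langle>x, y\<rangle>\<close>) carrying a compatible complex structure; it inherits norm, topology and
  completeness from the real one. The complex inner product is linear in its first argument.
\<close>

class complex_inner = real_inner +
  fixes scaleC :: "complex \<Rightarrow> 'a \<Rightarrow> 'a" (infixr "*\<^sub>C" 75)
    and cinner :: "'a \<Rightarrow> 'a \<Rightarrow> complex"
  assumes scaleC_add_right: "c *\<^sub>C (x + y) = c *\<^sub>C x + c *\<^sub>C y"
    and scaleC_add_left: "(b + c) *\<^sub>C x = b *\<^sub>C x + c *\<^sub>C x"
    and scaleC_scaleC: "b *\<^sub>C (c *\<^sub>C x) = (b * c) *\<^sub>C x"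
    and scaleR_eq_scaleC: "r *\<^sub>R x = complex_of_real r *\<^sub>C x"
    and cinner_commute: "cinner x y = cnj (cinner y x)"
    and cinner_add_left: "cinner (x + y) z = cinner x z + cinner y z"
    and cinner_scaleC_left: "cinner (c *\<^sub>C x) y = c * cinner x y"
    and inner_eq_Re_cinner: "inner x y = Re (cinner x y)"

class complex_hilbert_space = complex_inner + complete_space

lemma scaleC_one: "1 *\<^sub>C x = (x :: 'a :: complex_inner)"
  using scaleR_eq_scaleC[of 1 x] by simp

global_interpretation complex_vector: vector_space "scaleC :: complex \<Rightarrow> 'a \<Rightarrow> 'a :: complex_inner"
  defines cspan = complex_vector.span
  by unfold_locales (simp_all add: scaleC_add_right scaleC_add_left scaleC_scaleC scaleC_one)

definition bounded_clinear :: "('a :: complex_inner \<Rightarrow> 'b :: complex_inner) \<Rightarrow> bool" where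
  "bounded_clinear E \<longleftrightarrow> bounded_linear E \<and> (\<forall>c x. E (c *\<^sub>C x) = c *\<^sub>C E x)"

definition positive_operator :: "('a :: complex_inner \<Rightarrow> 'a) \<Rightarrow> bool" where
  "positive_operator E \<longleftrightarrow>
     bounded_clinear E \<and>
     (\<forall>x y. cinner (E x) y = cinner x (E y)) \<and>
     (\<forall>x. cinner (E x) x \<in> \<real>\<^sub>\<ge>\<^sub>0)"

definition op_spectrum :: "('a :: complex_inner \<Rightarrow> 'a) \<Rightarrow> complex set" where
  "op_spectrum E =
     {z. \<not> (\<exists>F. bounded_clinear F \<and>
              (\<forall>x. F (E x - z *\<^sub>C x) = x) \<and> (\<forall>x. E (F x) - z *\<^sub>C F x = x))}"

definition orthonormal_basis :: "'i set \<Rightarrow> ('i \<Rightarrow> 'a :: complex_inner) \<Rightarrow> bool" where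
  "orthonormal_basis I e \<longleftrightarrow>
     (\<forall>i\<in>I. \<forall>j\<in>I. cinner (e i) (e j) = (if i = j then 1 else 0)) \<and>
     closure (cspan (e ` I)) = UNIV"

definition has_diagonal :: "('a :: complex_inner \<Rightarrow> 'a) \<Rightarrow> 'i set \<Rightarrow> ('i \<Rightarrow> real) \<Rightarrow> bool" where
  "has_diagonal E I d \<longleftrightarrow>
     (\<exists>e. orthonormal_basis I e \<and> (\<forall>i\<in>I. cinner (E (e i)) (e i) = complex_of_real (d i)))"


section \<open>The space of square-summable sequences\<close>

text \<open>
  The sequence space shows that \<open>complex_hilbert_space\<close> has a member with an orthonormal basis
  indexed by any given countably infinite set. Such a member is unique up to unitary equivalence,
  so that an operator with prescribed diagonal and spectrum exists on some Hilbert space iff one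
  exists on each Hilbert space possessing an orthonormal basis with this index set.
\<close>

typedef ell2 = "{f :: nat \<Rightarrow> complex. summable (\<lambda>n. (cmod (f n))\<^sup>2)}"
  by (rule exI[of _ "\<lambda>_. 0"]) simp

setup_lifting type_definition_ell2

lemma ell2_summable_add:
  assumes "summable (\<lambda>n. (cmod (f n))\<^sup>2)" "summable (\<lambda>n. (cmod (g n))\<^sup>2)"
  shows "summable (\<lambda>n. (cmod (f n + g n))\<^sup>2)"
proof (rule summable_comparison_test')
  show "summable (\<lambda>n. 2 * (cmod (f n))\<^sup>2 + 2 * (cmod (g n))\<^sup>2)"
    by (intro summable_add summable_mult assms)
  fix n :: nat
  have "(cmod (f n + g n))\<^sup>2 \<le> (cmod (f n) + cmod (g n))\<^sup>2"
    by (intro power_mono norm_triangle_ineq) auto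
  also have "\<dots> \<le> 2 * (cmod (f n))\<^sup>2 + 2 * (cmod (g n))\<^sup>2"
    using zero_le_power2[of "cmod (f n) - cmod (g n)"]
    by (simp add: power2_eq_square algebra_simps)
  finally show "norm ((cmod (f n + g n))\<^sup>2) \<le> 2 * (cmod (f n))\<^sup>2 + 2 * (cmod (g n))\<^sup>2"
    by simp
qed

lemma ell2_summable_mult:
  assumes "summable (\<lambda>n. (cmod (f n))\<^sup>2)"
  shows "summable (\<lambda>n. (cmod (c * f n))\<^sup>2)"
  unfolding norm_mult power_mult_distrib by (rule summable_mult[OF assms])

lemma ell2_summable_cinner:
  assumes "summable (\<lambda>n. (cmod (f n))\<^sup>2)" "summable (\<lambda>n. (cmod (g n))\<^sup>2)"
  shows "summable (\<lambda>n. f n * cnj (g n))"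
proof (rule summable_comparison_test')
  show "summable (\<lambda>n. (cmod (f n))\<^sup>2 + (cmod (g n))\<^sup>2)"
    by (intro summable_add assms)
  fix n :: nat
  have "cmod (f n) * cmod (g n) \<le> (cmod (f n))\<^sup>2 + (cmod (g n))\<^sup>2"
    using zero_le_power2[of "cmod (f n) - cmod (g n)"]
      zero_le_power2[of "cmod (f n)"] zero_le_power2[of "cmod (g n)"]
    by (simp only: power2_eq_square algebra_simps)
  then show "norm (f n * cnj (g n)) \<le> (cmod (f n))\<^sup>2 + (cmod (g n))\<^sup>2"
    by (simp add: norm_mult)
qed

instantiation ell2 :: ab_group_add
begin
lift_definition zero_ell2 :: ell2 is "\<lambda>_. 0" by simp
lift_definition plus_ell2 :: "ell2 \<Rightarrow> ell2 \<Rightarrow> ell2" is "\<lambda>f g n. f n + g n"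
  by (rule ell2_summable_add)
lift_definition uminus_ell2 :: "ell2 \<Rightarrow> ell2" is "\<lambda>f n. - f n" by simp
definition minus_ell2 :: "ell2 \<Rightarrow> ell2 \<Rightarrow> ell2" where "minus_ell2 x y = x + - y"
instance
proof
  fix x y z :: ell2
  show "x + y + z = x + (y + z)" by transfer (simp add: algebra_simps)
  show "x + y = y + x" by transfer (simp add: algebra_simps)
  show "0 + x = x" by transfer simp
  show "- x + x = 0" by transfer simp
  show "x - y = x + - y" by (rule minus_ell2_def)
qed
end

instantiation ell2 :: complex_inner
begin
lift_definition scaleC_ell2 :: "complex \<Rightarrow> ell2 \<Rightarrow> ell2" is "\<lambda>c f n. c * f n"
  by (rule ell2_summable_mult)
lift_definition cinner_ell2 :: "ell2 \<Rightarrow> ell2 \<Rightarrow> complex" is "\<lambda>f g. \<Sum>n. f n * cnj (g n)" .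
definition scaleR_ell2 :: "real \<Rightarrow> ell2 \<Rightarrow> ell2" where
  "scaleR_ell2 r x = complex_of_real r *\<^sub>C x"
definition inner_ell2 :: "ell2 \<Rightarrow> ell2 \<Rightarrow> real" where
  "inner_ell2 x y = Re (cinner x y)"
definition norm_ell2 :: "ell2 \<Rightarrow> real" where
  "norm_ell2 x = sqrt (inner x x)"
definition dist_ell2 :: "ell2 \<Rightarrow> ell2 \<Rightarrow> real" where
  "dist_ell2 x y = norm (x - y)"
definition sgn_ell2 :: "ell2 \<Rightarrow> ell2" where
  "sgn_ell2 x = inverse (norm x) *\<^sub>R x"
definition uniformity_ell2 :: "(ell2 \<times> ell2) filter" where
  "uniformity_ell2 = (INF e\<in>{0<..}. principal {(x, y). dist x y < e})"
definition open_ell2 :: "ell2 set \<Rightarrow> bool" where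
  "open_ell2 U \<longleftrightarrow> (\<forall>x\<in>U. \<forall>\<^sub>F (x', y) in uniformity. x' = x \<longrightarrow> y \<in> U)"

instance
proof
  have C1: "c *\<^sub>C (x + y) = c *\<^sub>C x + c *\<^sub>C y" for c and x y :: ell2
    by transfer (simp add: algebra_simps)
  have C2: "(b + c) *\<^sub>C x = b *\<^sub>C x + c *\<^sub>C x" for b c and x :: ell2
    by transfer (simp add: algebra_simps)
  have C3: "b *\<^sub>C (c *\<^sub>C x) = (b * c) *\<^sub>C x" for b c and x :: ell2
    by transfer (simp add: algebra_simps)
  have C4: "1 *\<^sub>C x = x" for x :: ell2
    by transfer simp
  have I1: "cinner x y = cnj (cinner y x)" for x y :: ell2
  proof transfer
    fix f g :: "nat \<Rightarrow> complex"
    assume "summable (\<lambda>n. (cmod (f n))\<^sup>2)" "summable (\<lambda>n. (cmod (g n))\<^sup>2)"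
    then have "(\<lambda>n. g n * cnj (f n)) sums (\<Sum>n. g n * cnj (f n))"
      by (intro summable_sums ell2_summable_cinner)
    then have "(\<lambda>n. cnj (g n * cnj (f n))) sums cnj (\<Sum>n. g n * cnj (f n))"
      by (simp only: sums_cnj)
    then show "(\<Sum>n. f n * cnj (g n)) = cnj (\<Sum>n. g n * cnj (f n))"
      by (simp add: sums_iff mult.commute)
  qed
  have I2: "cinner (x + y) z = cinner x z + cinner y z" for x y z :: ell2
    by transfer (simp add: algebra_simps suminf_add ell2_summable_cinner)
  have I3: "cinner (c *\<^sub>C x) y = c * cinner x y" for c and x y :: ell2
    by transfer (simp add: mult.assoc suminf_mult ell2_summable_cinner)
  have I4: "inner x x = (\<Sum>n. (cmod (Rep_ell2 x n))\<^sup>2)"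
      "summable (\<lambda>n. (cmod (Rep_ell2 x n))\<^sup>2)" for x
  proof -
    show s: "summable (\<lambda>n. (cmod (Rep_ell2 x n))\<^sup>2)"
      using Rep_ell2[of x] by simp
    have "(\<lambda>n. complex_of_real ((cmod (Rep_ell2 x n))\<^sup>2)) sums
            complex_of_real (\<Sum>n. (cmod (Rep_ell2 x n))\<^sup>2)"
      by (intro sums_of_real summable_sums s)
    then have "cinner x x = complex_of_real (\<Sum>n. (cmod (Rep_ell2 x n))\<^sup>2)"
      unfolding cinner_ell2.rep_eq complex_norm_square by (simp add: sums_iff)
    then show "inner x x = (\<Sum>n. (cmod (Rep_ell2 x n))\<^sup>2)"
      by (simp add: inner_ell2_def)
  qed
  fix x y z :: ell2 and r s :: real and b c :: complex and U :: "ell2 set"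
  show "dist x y = norm (x - y)" by (rule dist_ell2_def)
  show "r *\<^sub>R (x + y) = r *\<^sub>R x + r *\<^sub>R y" by (simp add: scaleR_ell2_def C1)
  show "(r + s) *\<^sub>R x = r *\<^sub>R x + s *\<^sub>R x" by (simp add: scaleR_ell2_def C2)
  show "r *\<^sub>R s *\<^sub>R x = (r * s) *\<^sub>R x" by (simp add: scaleR_ell2_def C3)
  show "1 *\<^sub>R x = x" by (simp add: scaleR_ell2_def C4)
  show "sgn x = inverse (norm x) *\<^sub>R x" by (rule sgn_ell2_def)
  show "uniformity = (INF e\<in>{0<..}. principal {(x :: ell2, y). dist x y < e})"
    by (rule uniformity_ell2_def)
  show "open U \<longleftrightarrow> (\<forall>x\<in>U. \<forall>\<^sub>F (x', y) in uniformity. x' = x \<longrightarrow> y \<in> U)"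
    by (rule open_ell2_def)
  show "inner x y = inner y x"
    unfolding inner_ell2_def by (subst I1) simp
  show "inner (x + y) z = inner x z + inner y z" by (simp add: inner_ell2_def I2)
  show "inner (r *\<^sub>R x) y = r * inner x y" by (simp add: inner_ell2_def scaleR_ell2_def I3)
  show "0 \<le> inner x x" by (simp add: I4 suminf_nonneg)
  show "inner x x = 0 \<longleftrightarrow> x = 0"
  proof -
    have "inner x x = 0 \<longleftrightarrow> (\<forall>n. (cmod (Rep_ell2 x n))\<^sup>2 = 0)"
      unfolding I4(1) by (rule suminf_eq_zero_iff[OF I4(2)]) simp
    also have "\<dots> \<longleftrightarrow> x = 0"
      by transfer (auto simp: fun_eq_iff)
    finally show ?thesis .
  qed
  show "norm x = sqrt (inner x x)" by (rule norm_ell2_def)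
  show "c *\<^sub>C (x + y) = c *\<^sub>C x + c *\<^sub>C y" by (rule C1)
  show "(b + c) *\<^sub>C x = b *\<^sub>C x + c *\<^sub>C x" by (rule C2)
  show "b *\<^sub>C (c *\<^sub>C x) = (b * c) *\<^sub>C x" by (rule C3)
  show "r *\<^sub>R x = complex_of_real r *\<^sub>C x" by (rule scaleR_ell2_def)
  show "cinner x y = cnj (cinner y x)" by (rule I1)
  show "cinner (x + y) z = cinner x z + cinner y z" by (rule I2)
  show "cinner (c *\<^sub>C x) y = c * cinner x y" by (rule I3)
  show "inner x y = Re (cinner x y)" by (rule inner_ell2_def)
qed
end

lemma ell2_summable: "summable (\<lambda>n. (cmod (Rep_ell2 x n))\<^sup>2)"
  using Rep_ell2[of x] by simp

lemma norm_ell2_sq: "(norm x)\<^sup>2 = (\<Sum>n. (cmod (Rep_ell2 x n))\<^sup>2)"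
proof -
  have "(\<lambda>n. complex_of_real ((cmod (Rep_ell2 x n))\<^sup>2)) sums
          complex_of_real (\<Sum>n. (cmod (Rep_ell2 x n))\<^sup>2)"
    by (intro sums_of_real summable_sums ell2_summable)
  then have "cinner x x = complex_of_real (\<Sum>n. (cmod (Rep_ell2 x n))\<^sup>2)"
    unfolding cinner_ell2.rep_eq complex_norm_square by (simp add: sums_iff)
  then show ?thesis
    by (simp add: power2_norm_eq_inner inner_eq_Re_cinner)
qed

lemma Rep_ell2_minus: "Rep_ell2 (x - y) n = Rep_ell2 x n - Rep_ell2 y n"
  unfolding minus_ell2_def plus_ell2.rep_eq uminus_ell2.rep_eq by simp

lemma ell2_sum_le_norm: "(\<Sum>n<m. (cmod (Rep_ell2 x n))\<^sup>2) \<le> (norm x)\<^sup>2"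
  unfolding norm_ell2_sq by (rule sum_le_suminf[OF ell2_summable]) simp_all

lemma ell2_component_le_norm: "cmod (Rep_ell2 x n) \<le> norm x"
proof -
  have "(cmod (Rep_ell2 x n))\<^sup>2 \<le> (\<Sum>k<Suc n. (cmod (Rep_ell2 x k))\<^sup>2)"
    by (simp add: sum_nonneg)
  also have "\<dots> \<le> (norm x)\<^sup>2" by (rule ell2_sum_le_norm)
  finally show ?thesis by (simp add: power2_le_iff_abs_le)
qed

instance ell2 :: complex_hilbert_space
proof
  fix X :: "nat \<Rightarrow> ell2"
  assume X: "Cauchy X"
  have "Cauchy (\<lambda>k. Rep_ell2 (X k) n)" for n
  proof (rule CauchyI)
    fix e :: real assume "0 < e"
    with X obtain M where "\<forall>k\<ge>M. \<forall>l\<ge>M. norm (X k - X l) < e"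
      using CauchyD by blast
    then show "\<exists>M. \<forall>k\<ge>M. \<forall>l\<ge>M. norm (Rep_ell2 (X k) n - Rep_ell2 (X l) n) < e"
      by (metis Rep_ell2_minus ell2_component_le_norm le_less_trans)
  qed
  then have "\<forall>n. \<exists>l. (\<lambda>k. Rep_ell2 (X k) n) \<longlonglongrightarrow> l"
    by (simp add: Cauchy_convergent_iff convergent_def)
  then obtain f where f: "\<And>n. (\<lambda>k. Rep_ell2 (X k) n) \<longlonglongrightarrow> f n"
    by metis
  have bound: "(\<Sum>n<m. (cmod (Rep_ell2 (X k) n - f n))\<^sup>2) \<le> e\<^sup>2"
    if M: "\<And>l. l \<ge> M \<Longrightarrow> norm (X k - X l) < e" for k m M e
  proof (rule LIMSEQ_le_const2)
    show "(\<lambda>l. \<Sum>n<m. (cmod (Rep_ell2 (X k) n - Rep_ell2 (X l) n))\<^sup>2)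
            \<longlonglongrightarrow> (\<Sum>n<m. (cmod (Rep_ell2 (X k) n - f n))\<^sup>2)"
      by (intro tendsto_intros f)
    have "(\<Sum>n<m. (cmod (Rep_ell2 (X k) n - Rep_ell2 (X l) n))\<^sup>2) \<le> e\<^sup>2" if "l \<ge> M" for l
    proof -
      have "(\<Sum>n<m. (cmod (Rep_ell2 (X k) n - Rep_ell2 (X l) n))\<^sup>2) \<le> (norm (X k - X l))\<^sup>2"
        using ell2_sum_le_norm[of "X k - X l" m] by (simp add: Rep_ell2_minus)
      also have "\<dots> \<le> e\<^sup>2"
        using M[OF that] by (intro power_mono) auto
      finally show ?thesis .
    qed
    then show "\<exists>N. \<forall>l\<ge>N. (\<Sum>n<m. (cmod (Rep_ell2 (X k) n - Rep_ell2 (X l) n))\<^sup>2) \<le> e\<^sup>2"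
      by blast
  qed
  have summ: "summable (\<lambda>n. (cmod (Rep_ell2 (X k) n - f n))\<^sup>2)"
    if "\<And>l. l \<ge> M \<Longrightarrow> norm (X k - X l) < e" for k M e
    using bound[OF that] by (intro summableI_nonneg_bounded[where x = "e\<^sup>2"]) auto
  obtain M1 where "\<forall>k\<ge>M1. \<forall>l\<ge>M1. norm (X k - X l) < 1"
    using CauchyD[OF X zero_less_one] by blast
  then have "summable (\<lambda>n. (cmod (Rep_ell2 (X M1) n - f n))\<^sup>2)"
    by (intro summ[of M1 M1 1]) auto
  then have "summable (\<lambda>n. (cmod (Rep_ell2 (X M1) n + - 1 * (Rep_ell2 (X M1) n - f n)))\<^sup>2)"
    by (intro ell2_summable_add ell2_summable_mult ell2_summable)
  then have "summable (\<lambda>n. (cmod (f n))\<^sup>2)" by simp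
  then have L: "Rep_ell2 (Abs_ell2 f) = f" by (simp add: Abs_ell2_inverse)
  have "X \<longlonglongrightarrow> Abs_ell2 f"
  proof (rule LIMSEQ_I)
    fix r :: real assume r: "0 < r"
    then obtain M where M: "\<forall>k\<ge>M. \<forall>l\<ge>M. norm (X k - X l) < r / 2"
      using CauchyD[OF X, of "r / 2"] by auto
    have "norm (X k - Abs_ell2 f) < r" if "k \<ge> M" for k
    proof -
      have 1: "\<And>l. l \<ge> M \<Longrightarrow> norm (X k - X l) < r / 2" using M that by blast
      have "(norm (X k - Abs_ell2 f))\<^sup>2 \<le> (r / 2)\<^sup>2"
        unfolding norm_ell2_sq Rep_ell2_minus L
        by (rule suminf_le_const[OF summ[OF 1] bound[OF 1]])
      then have "norm (X k - Abs_ell2 f) \<le> r / 2"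
        using r by (simp add: power2_le_iff_abs_le)
      with r show ?thesis by simp
    qed
    then show "\<exists>no. \<forall>n\<ge>no. norm (X n - Abs_ell2 f) < r" by blast
  qed
  then show "convergent X" by (auto simp: convergent_def)
qed

lemma ell2_has_orthonormal_basis:
  assumes "countable I" "infinite I"
  shows "\<exists>e :: 'i \<Rightarrow> ell2. orthonormal_basis I e"
proof -
  define u where "u m = Abs_ell2 (\<lambda>n. if n = m then 1 else 0)" for m
  have u: "Rep_ell2 (u m) = (\<lambda>n. if n = m then 1 else 0)" for m
  proof -
    have "summable (\<lambda>n. (cmod (if n = m then 1 else 0))\<^sup>2)"
      by (rule summable_finite[of "{m}"]) simp_all
    then show ?thesis by (simp add: u_def Abs_ell2_inverse)
  qed
  have on: "cinner (u m) (u l) = (if m = l then 1 else 0)" for m l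
  proof -
    have "cinner (u m) (u l) = (\<Sum>n\<in>{m}. Rep_ell2 (u m) n * cnj (Rep_ell2 (u l) n))"
      unfolding cinner_ell2.rep_eq by (rule suminf_finite) (auto simp: u)
    then show ?thesis by (auto simp: u)
  qed
  have "x \<in> closure (cspan (range u))" for x
  proof -
    define p where "p m = (\<Sum>k<m. Rep_ell2 x k *\<^sub>C u k)" for m
    have p: "Rep_ell2 (p m) n = (if n < m then Rep_ell2 x n else 0)" for m n
      unfolding p_def
      by (induction m) (auto simp: zero_ell2.rep_eq plus_ell2.rep_eq scaleC_ell2.rep_eq u less_Suc_eq)
    have "p m \<in> cspan (range u)" for m
      unfolding p_def
      by (intro complex_vector.span_sum complex_vector.span_scale complex_vector.span_base) auto
    moreover have "p \<longlonglongrightarrow> x"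
    proof -
      have eq: "(norm (p m - x))\<^sup>2 = (\<Sum>n. (cmod (Rep_ell2 x (n + m)))\<^sup>2)" for m
      proof -
        have "(norm (p m - x))\<^sup>2 = (\<Sum>n. (cmod (Rep_ell2 (p m - x) (n + m)))\<^sup>2)
                + (\<Sum>n<m. (cmod (Rep_ell2 (p m - x) n))\<^sup>2)"
          unfolding norm_ell2_sq by (rule suminf_split_initial_segment[OF ell2_summable])
        then show ?thesis by (simp add: Rep_ell2_minus p)
      qed
      have "(\<lambda>m. (norm (p m - x))\<^sup>2) \<longlonglongrightarrow> 0"
        unfolding eq by (rule suminf_exist_split2[OF ell2_summable])
      then have "(\<lambda>m. sqrt ((norm (p m - x))\<^sup>2)) \<longlonglongrightarrow> sqrt 0"
        by (intro tendsto_intros)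
      then have "(\<lambda>m. norm (p m - x)) \<longlonglongrightarrow> 0" by simp
      then show ?thesis
        by (rule LIM_zero_cancel[OF tendsto_norm_zero_cancel])
    qed
    ultimately show ?thesis
      unfolding closure_sequential by (intro exI[of _ p] conjI allI)
  qed
  then have dense: "closure (cspan (range u)) = UNIV" by (intro UNIV_eq_I[symmetric])
  have b: "bij_betw (to_nat_on I) I UNIV"
    using assms by (rule to_nat_on_infinite)
  have "(\<lambda>i. u (to_nat_on I i)) ` I = u ` (to_nat_on I ` I)"
    by (rule image_image[symmetric])
  then have "(\<lambda>i. u (to_nat_on I i)) ` I = range u"
    by (simp only: bij_betw_imp_surj_on[OF b])
  moreover have "(to_nat_on I i = to_nat_on I j) = (i = j)" if "i \<in> I" "j \<in> I" for i j
    using b that by (meson bij_betw_imp_inj_on inj_on_eq_iff)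
  ultimately have "orthonormal_basis I (\<lambda>i. u (to_nat_on I i))"
    unfolding orthonormal_basis_def by (simp add: on dense)
  then show ?thesis by blast
qed

end

theory Submission
  imports Defs "Jordan_Normal_Form.Schur_Decomposition"
begin

text \<open>
  Necessity. If \<open>\<sigma>(E) = {0, A, B}\<close>, then \<open>E = A P + B Q\<close> with orthogonal projections \<open>P\<close>, \<open>Q\<close>,
  \<open>R = 1 - P - Q\<close>. If \<open>C\<close> and \<open>D\<close> are finite, then \<open>P\<close> has finite trace \<open>N\<close>, the diagonal of \<open>Q\<close> is
  summable over \<open>d i < A\<close>, and that of \<open>1 - Q\<close> over \<open>d i \<ge> A\<close>. The difference \<open>k\<close> of these two
  sums is an integer, and \<open>C - D = N A + k B\<close>, while \<open>C - (N + k) A\<close> is a nonnegative combination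
  of diagonal sums of \<open>Q\<close> and \<open>R\<close>.

  Sufficiency. Start from a diagonal operator and change the orthonormal basis by rotations in two
  coordinates. If \<open>C\<close> or \<open>D\<close> is infinite, then \<open>\<Sum> min (d i) (B - d i) = \<infinity>\<close>. One value is carried
  along the sequence, initially \<open>A\<close>; each rotation mixes it with an eigenvalue \<open>0\<close> or \<open>B\<close> so that
  one of the two diagonal values becomes the prescribed one. Divergence guarantees that the new
  orthonormal system is complete. If both are finite, then all but finitely many entries are
  moved to \<open>0\<close> or \<open>B\<close> by the same device, and the finite problem is of Schur-Horn type.
\<close>

section \<open>Inner products and orthonormal bases\<close>

text \<open>When both sums are finite, \<open>Q\<close> has neither finite rank nor finite corank,
  so \<open>k\<close> is not a difference of ranks. It is an index that compares \<open>Q\<close>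
  with the coordinate projection onto the indices with \<open>A \<le> d i\<close>, and its
  integrality has to be extracted from finite matrices. Given the equation
  \<open>C - D = N A + k B\<close>, the condition \<open>C \<ge> (N + k) A\<close> says the same as
  \<open>D \<ge> - k (B - A)\<close>. This is the one majorization inequality, at the threshold
  \<open>A\<close>, that separates a finite diagonal from eigenvalues \<open>0\<close>,
  \<open>A\<close>, \<open>B\<close>. The spectrum is prescribed only as a set, so the
  multiplicities of \<open>0\<close> and \<open>B\<close> are free and can be adapted to the
  diagonal. The danger of infinitely many rotations is that the new orthonormal system misses a
  direction; all limit arguments below serve to exclude this.\<close>

lemma cinner_add_right: "cinner x (y + z) = cinner x y + cinner x (z :: 'a :: complex_inner)"
  by (metis cinner_add_left cinner_commute complex_cnj_add)

lemma cinner_scaleC_right: "cinner x (c *\<^sub>C y) = cnj c * cinner x (y :: 'a :: complex_inner)"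
  by (metis cinner_scaleC_left cinner_commute complex_cnj_mult)

declare scaleC_one [simp]

lemma cinner_zero_left [simp]: "cinner 0 (x :: 'a :: complex_inner) = 0"
  using cinner_scaleC_left[of 0 0 x] by simp

lemma cinner_zero_right [simp]: "cinner (x :: 'a :: complex_inner) 0 = 0"
  using cinner_scaleC_right[of x 0 0] by simp

lemma cinner_minus_left: "cinner (- x) (y :: 'a :: complex_inner) = - cinner x y"
  using cinner_add_left[of x "- x" y] by (simp add: eq_neg_iff_add_eq_0 add.commute)

lemma cinner_minus_right: "cinner x (- y :: 'a :: complex_inner) = - cinner x y"
  by (metis cinner_minus_left cinner_commute complex_cnj_minus)

lemma cinner_diff_left: "cinner (x - y) (z :: 'a :: complex_inner) = cinner x z - cinner y z"
  using cinner_add_left[of x "- y" z] by (simp add: cinner_minus_left)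

lemma cinner_diff_right: "cinner x (y - z :: 'a :: complex_inner) = cinner x y - cinner x z"
  using cinner_add_right[of x y "- z"] by (simp add: cinner_minus_right)

lemma cinner_sum_left: "cinner (\<Sum>i\<in>F. f i) (y :: 'a :: complex_inner) = (\<Sum>i\<in>F. cinner (f i) y)"
  by (induction F rule: infinite_finite_induct) (simp_all add: cinner_add_left)

lemma cinner_sum_right: "cinner (y :: 'a :: complex_inner) (\<Sum>i\<in>F. f i) = (\<Sum>i\<in>F. cinner y (f i))"
  by (induction F rule: infinite_finite_induct) (simp_all add: cinner_add_right)

lemma cinner_self: "cinner x x = complex_of_real ((norm (x :: 'a :: complex_inner))\<^sup>2)"
proof -
  have "Im (cinner x x) = 0"
    using arg_cong[OF cinner_commute[of x x], of Im] by simp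
  moreover have "Re (cinner x x) = (norm x)\<^sup>2"
    by (simp add: inner_eq_Re_cinner[symmetric] power2_norm_eq_inner)
  ultimately show ?thesis by (simp add: complex_eq_iff)
qed

lemma norm_scaleC: "norm (c *\<^sub>C (x :: 'a :: complex_inner)) = cmod c * norm x"
proof -
  have "cinner (c *\<^sub>C x) (c *\<^sub>C x) = (c * cnj c) * cinner x x"
    by (simp add: cinner_scaleC_left cinner_scaleC_right)
  then have "complex_of_real ((norm (c *\<^sub>C x))\<^sup>2) = complex_of_real ((cmod c * norm x)\<^sup>2)"
    unfolding cinner_self complex_norm_square[symmetric] by (simp add: power_mult_distrib)
  then have "(norm (c *\<^sub>C x))\<^sup>2 = (cmod c * norm x)\<^sup>2"
    by (simp only: of_real_eq_iff)
  then show ?thesis by (simp add: power2_eq_iff_nonneg)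
qed

text \<open>A phase applied to \<open>x\<close> turns the complex product into its modulus, which
  reduces the claim to the real inequality.\<close>

lemma cinner_Cauchy_Schwarz: "cmod (cinner x y) \<le> norm x * norm (y :: 'a :: complex_inner)"
proof (cases "cinner x y = 0")
  case False
  define u where "u = cnj (cinner x y) / complex_of_real (cmod (cinner x y))"
  have u: "cmod u = 1" using False by (simp add: u_def norm_divide)
  have "u * cinner x y = complex_of_real (cmod (cinner x y))"
    using False unfolding u_def
    by (simp add: divide_simps mult.commute[of "cnj _"] complex_norm_square[symmetric] power2_eq_square)
  then have "cmod (cinner x y) = inner (u *\<^sub>C x) y"
    by (simp add: inner_eq_Re_cinner cinner_scaleC_left)
  also have "\<dots> \<le> norm (u *\<^sub>C x) * norm y" by (rule norm_cauchy_schwarz)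
  finally show ?thesis by (simp add: norm_scaleC u)
qed simp

lemma bounded_bilinear_cinner: "bounded_bilinear (cinner :: 'a :: complex_inner \<Rightarrow> 'a \<Rightarrow> complex)"
proof
  fix r :: real and x y z :: 'a
  show "cinner (x + y) z = cinner x z + cinner y z" by (rule cinner_add_left)
  show "cinner x (y + z) = cinner x y + cinner x z" by (rule cinner_add_right)
  show "cinner (r *\<^sub>R x) y = r *\<^sub>R cinner x y"
    by (simp add: scaleR_eq_scaleC cinner_scaleC_left scaleR_conv_of_real)
  show "cinner x (r *\<^sub>R y) = r *\<^sub>R cinner x y"
    by (simp add: scaleR_eq_scaleC cinner_scaleC_right scaleR_conv_of_real)
  show "\<exists>K. \<forall>x y :: 'a. norm (cinner x y) \<le> norm x * norm y * K"
    by (rule exI[of _ 1]) (simp add: cinner_Cauchy_Schwarz)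
qed

lemmas tendsto_cinner = bounded_bilinear.tendsto[OF bounded_bilinear_cinner]

lemma bounded_linear_scaleC: "bounded_linear (\<lambda>x :: 'a :: complex_inner. c *\<^sub>C x)"
proof (rule bounded_linear_intro[where K = "cmod c"])
  fix x y :: 'a and r :: real
  show "c *\<^sub>C (x + y) = c *\<^sub>C x + c *\<^sub>C y" by (rule scaleC_add_right)
  show "c *\<^sub>C (r *\<^sub>R x) = r *\<^sub>R (c *\<^sub>C x)"
    by (simp add: scaleR_eq_scaleC scaleC_scaleC mult.commute)
  show "norm (c *\<^sub>C x) \<le> norm x * cmod c" by (simp add: norm_scaleC)
qed

lemmas tendsto_scaleC = bounded_linear.tendsto[OF bounded_linear_scaleC]

lemma bounded_clinear_compose:
  "bounded_clinear f \<Longrightarrow> bounded_clinear g \<Longrightarrow> bounded_clinear (\<lambda>x. f (g x))"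
  unfolding bounded_clinear_def by (auto intro: bounded_linear_compose)

lemma bounded_clinear_diff:
  "bounded_clinear f \<Longrightarrow> bounded_clinear g \<Longrightarrow> bounded_clinear (\<lambda>x. f x - g x)"
  unfolding bounded_clinear_def
  by (auto intro: bounded_linear_sub simp: complex_vector.scale_right_diff_distrib)

lemma bounded_clinear_scaleC: "bounded_clinear (\<lambda>x :: 'a :: complex_inner. c *\<^sub>C x)"
  unfolding bounded_clinear_def by (auto intro: bounded_linear_scaleC simp: scaleC_scaleC mult.commute)

lemma bounded_clinear_ident: "bounded_clinear (\<lambda>x :: 'a :: complex_inner. x)"
  unfolding bounded_clinear_def by (auto intro: bounded_linear_ident)

lemma bounded_clinear_linear:
  assumes "bounded_clinear f"
  shows "f (x + y) = f x + f y" "f (x - y) = f x - f y" "f (c *\<^sub>C x) = c *\<^sub>C f x" "f 0 = 0"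
    "f (\<Sum>i\<in>F. h i) = (\<Sum>i\<in>F. f (h i))"
  using assms unfolding bounded_clinear_def
  by (auto simp: bounded_linear.linear linear_add linear_diff linear_0 linear_sum)

section \<open>Orthonormal systems and completeness\<close>

definition orthonormal_on :: "'i set \<Rightarrow> ('i \<Rightarrow> 'a :: complex_inner) \<Rightarrow> bool" where
  "orthonormal_on I e \<longleftrightarrow> (\<forall>i\<in>I. \<forall>j\<in>I. cinner (e i) (e j) = (if i = j then 1 else 0))"

lemma orthonormal_basis_iff:
  "orthonormal_basis I e \<longleftrightarrow> orthonormal_on I e \<and> closure (cspan (e ` I)) = UNIV"
  unfolding orthonormal_basis_def orthonormal_on_def ..

lemma orthonormal_onD:
  "orthonormal_on I e \<Longrightarrow> i \<in> I \<Longrightarrow> j \<in> I \<Longrightarrow> cinner (e i) (e j) = (if i = j then 1 else 0)"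
  by (simp add: orthonormal_on_def)

lemma orthonormal_on_mono: "orthonormal_on I e \<Longrightarrow> J \<subseteq> I \<Longrightarrow> orthonormal_on J e"
  unfolding orthonormal_on_def by blast

lemma orthonormal_on_norm: "orthonormal_on I e \<Longrightarrow> i \<in> I \<Longrightarrow> norm (e i) = 1"
  using cinner_self[of "e i"] norm_ge_zero[of "e i"]
  by (auto simp: orthonormal_onD power2_eq_1_iff simp del: norm_ge_zero simp flip: of_real_power)

lemma cinner_sum_orthonormal:
  assumes "orthonormal_on F e" "finite F" "j \<in> F"
  shows "cinner (\<Sum>i\<in>F. a i *\<^sub>C e i) (e j) = a j"
proof -
  have "cinner (\<Sum>i\<in>F. a i *\<^sub>C e i) (e j) = (\<Sum>i\<in>F. if i = j then a i else 0)"
    unfolding cinner_sum_left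
    by (rule sum.cong) (use assms in \<open>auto simp: cinner_scaleC_left orthonormal_onD\<close>)
  then show ?thesis using assms by simp
qed

lemma norm_sum_orthonormal:
  assumes "orthonormal_on F e" "finite F"
  shows "(norm (\<Sum>i\<in>F. a i *\<^sub>C e i))\<^sup>2 = (\<Sum>i\<in>F. (cmod (a i))\<^sup>2)"
proof -
  have "complex_of_real ((norm (\<Sum>i\<in>F. a i *\<^sub>C e i))\<^sup>2) = complex_of_real (\<Sum>i\<in>F. (cmod (a i))\<^sup>2)"
    unfolding cinner_self[symmetric] cinner_sum_right cinner_scaleC_right of_real_sum
    by (rule sum.cong) (use assms in \<open>simp_all add: cinner_sum_orthonormal complex_norm_square mult.commute del: of_real_power\<close>)
  then show ?thesis by (simp only: of_real_eq_iff)
qed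

lemma norm_diff_orthonormal_projection:
  assumes "orthonormal_on F e" "finite F"
  shows "(norm (x - (\<Sum>i\<in>F. cinner x (e i) *\<^sub>C e i)))\<^sup>2 = (norm x)\<^sup>2 - (\<Sum>i\<in>F. (cmod (cinner x (e i)))\<^sup>2)"
proof -
  let ?p = "\<Sum>i\<in>F. cinner x (e i) *\<^sub>C e i"
  have 1: "cinner x ?p = complex_of_real (\<Sum>i\<in>F. (cmod (cinner x (e i)))\<^sup>2)"
    unfolding cinner_sum_right cinner_scaleC_right of_real_sum
    by (simp add: complex_norm_square mult.commute del: of_real_power)
  have 2: "cinner ?p x = complex_of_real (\<Sum>i\<in>F. (cmod (cinner x (e i)))\<^sup>2)"
    by (subst cinner_commute) (simp add: 1)
  have 3: "cinner ?p ?p = complex_of_real (\<Sum>i\<in>F. (cmod (cinner x (e i)))\<^sup>2)"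
    unfolding cinner_self norm_sum_orthonormal[OF assms] ..
  have "complex_of_real ((norm (x - ?p))\<^sup>2)
      = complex_of_real ((norm x)\<^sup>2 - (\<Sum>i\<in>F. (cmod (cinner x (e i)))\<^sup>2))"
    unfolding cinner_self[symmetric] cinner_diff_left cinner_diff_right 1 2 3 of_real_diff
    by simp
  then show ?thesis by (simp only: of_real_eq_iff)
qed

lemma Bessel_inequality:
  assumes "orthonormal_on F e" "finite F"
  shows "(\<Sum>i\<in>F. (cmod (cinner x (e i)))\<^sup>2) \<le> (norm x)\<^sup>2"
  using norm_diff_orthonormal_projection[OF assms, of x]
  by (metis diff_ge_0_iff_ge zero_le_power2)

lemma subspace_closure_cspan: "complex_vector.subspace (closure (cspan (S :: 'a :: complex_inner set)))"
proof (rule complex_vector.subspaceI)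
  show "0 \<in> closure (cspan S)"
    by (rule subsetD[OF closure_subset]) (rule complex_vector.span_zero)
next
  fix x y assume "x \<in> closure (cspan S)" "y \<in> closure (cspan S)"
  then obtain f g where "\<And>n. f n \<in> cspan S" "f \<longlonglongrightarrow> x" "\<And>n. g n \<in> cspan S" "g \<longlonglongrightarrow> y"
    unfolding closure_sequential by blast
  then show "x + y \<in> closure (cspan S)"
    unfolding closure_sequential
    by (intro exI[of _ "\<lambda>n. f n + g n"]) (auto intro: complex_vector.span_add tendsto_add)
next
  fix c x assume "x \<in> closure (cspan S)"
  then obtain f where "\<And>n. f n \<in> cspan S" "f \<longlonglongrightarrow> x"
    unfolding closure_sequential by blast
  then show "c *\<^sub>C x \<in> closure (cspan S)"
    unfolding closure_sequential
    by (intro exI[of _ "\<lambda>n. c *\<^sub>C f n"]) (auto intro: complex_vector.span_scale tendsto_scaleC)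
qed

text \<open>The closed span of \<open>f\<close> is a closed subspace, so once it contains a basis it
  is everything. Each change of basis below proves its completeness in this way, by recovering the
  old basis vectors.\<close>

lemma orthonormal_basis_transfer:
  assumes "orthonormal_basis I e" "orthonormal_on J f"
    and "\<And>i. i \<in> I \<Longrightarrow> e i \<in> closure (cspan (f ` J))"
  shows "orthonormal_basis J f"
proof -
  have "cspan (e ` I) \<subseteq> closure (cspan (f ` J))"
    by (rule complex_vector.span_minimal) (use assms(3) subspace_closure_cspan in auto)
  then have "closure (cspan (e ` I)) \<subseteq> closure (cspan (f ` J))"
    by (simp add: closure_minimal)
  with assms(1,2) show ?thesis by (auto simp: orthonormal_basis_iff)
qed

lemma bounded_clinear_eqI:
  assumes "orthonormal_basis I e" "bounded_clinear f" "bounded_clinear g"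
    and "\<And>i. i \<in> I \<Longrightarrow> f (e i) = g (e i)"
  shows "f = g"
proof
  fix x
  have "cspan (e ` I) \<subseteq> {x. f x = g x}"
    by (rule complex_vector.span_minimal)
      (use assms in \<open>auto simp: complex_vector.subspace_def bounded_clinear_linear\<close>)
  moreover have "closed {x. f x = g x}"
    using assms(2,3) unfolding bounded_clinear_def
    by (intro closed_Collect_eq) (auto simp: linear_continuous_on)
  ultimately have "closure (cspan (e ` I)) \<subseteq> {x. f x = g x}"
    by (rule closure_minimal)
  then show "f x = g x" using assms(1) by (auto simp: orthonormal_basis_iff)
qed

lemma Parseval_identity:
  assumes "orthonormal_basis I e"
  shows "((\<lambda>i. (cmod (cinner x (e i)))\<^sup>2) has_sum (norm x)\<^sup>2) I"
proof -
  have on: "orthonormal_on I e" using assms by (simp add: orthonormal_basis_iff)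
  have bd: "(\<Sum>i\<in>F. (cmod (cinner x (e i)))\<^sup>2) \<le> (norm x)\<^sup>2" if "finite F" "F \<subseteq> I" for F
    using that by (intro Bessel_inequality orthonormal_on_mono[OF on])
  have summ: "(\<lambda>i. (cmod (cinner x (e i)))\<^sup>2) summable_on I"
    by (rule nonneg_bdd_above_summable_on) (use bd in \<open>auto intro!: bdd_aboveI\<close>)
  have le: "infsum (\<lambda>i. (cmod (cinner x (e i)))\<^sup>2) I \<le> (norm x)\<^sup>2"
    by (rule infsum_le_finite_sums[OF summ bd])
  have ge: "(norm x)\<^sup>2 \<le> infsum (\<lambda>i. (cmod (cinner x (e i)))\<^sup>2) I + \<epsilon>\<^sup>2" if "\<epsilon> > 0" for \<epsilon>
  proof -
    have "x \<in> closure (cspan (e ` I))" using assms by (simp add: orthonormal_basis_iff)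
    then obtain y where y: "y \<in> cspan (e ` I)" "dist y x < \<epsilon>"
      using \<open>\<epsilon> > 0\<close> unfolding closure_approachable by blast
    then obtain t r where t: "finite t" "t \<subseteq> e ` I" "y = (\<Sum>a\<in>t. r a *\<^sub>C a)"
      unfolding complex_vector.span_explicit by auto
    then obtain F where F: "F \<subseteq> I" "inj_on e F" "t = e ` F"
      unfolding subset_image_inj by blast
    have fF: "finite F" using F t(1) finite_image_iff by blast
    have onF: "orthonormal_on F e" by (rule orthonormal_on_mono[OF on F(1)])
    have yF: "y = (\<Sum>i\<in>F. r (e i) *\<^sub>C e i)" unfolding t(3) F(3) by (simp add: sum.reindex F(2))
    let ?p = "\<Sum>i\<in>F. cinner x (e i) *\<^sub>C e i"
    have pr: "cinner (x - y) (e i) = cinner x (e i) - r (e i)" if "i \<in> F" for i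
      using cinner_sum_orthonormal[OF onF fF that] by (simp add: cinner_diff_left yF)
    \<comment> \<open>Since \<open>y\<close> lies in the span of \<open>F\<close>, \<open>x\<close>
      and \<open>x - y\<close> have the same residual after projection onto that span. Hence the
      projection of \<open>x\<close> is at least as close to \<open>x\<close> as \<open>y\<close>
      is.\<close>
    have "(\<Sum>i\<in>F. cinner (x - y) (e i) *\<^sub>C e i) = (\<Sum>i\<in>F. (cinner x (e i) - r (e i)) *\<^sub>C e i)"
      by (rule sum.cong) (simp_all add: pr)
    also have "\<dots> = ?p - y"
      unfolding yF by (simp add: complex_vector.scale_left_diff_distrib sum_subtractf)
    finally have "(x - y) - (\<Sum>i\<in>F. cinner (x - y) (e i) *\<^sub>C e i) = x - ?p"
      by simp
    then have "(norm (x - ?p))\<^sup>2 = (norm (x - y))\<^sup>2 - (\<Sum>i\<in>F. (cmod (cinner (x - y) (e i)))\<^sup>2)"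
      using norm_diff_orthonormal_projection[OF onF fF, of "x - y"] by (simp only:)
    also have "\<dots> \<le> (norm (x - y))\<^sup>2" by (simp add: sum_nonneg)
    also have "\<dots> \<le> \<epsilon>\<^sup>2"
      using y(2) by (intro power_mono) (auto simp: dist_norm norm_minus_commute)
    finally have "(norm x)\<^sup>2 \<le> (\<Sum>i\<in>F. (cmod (cinner x (e i)))\<^sup>2) + \<epsilon>\<^sup>2"
      using norm_diff_orthonormal_projection[OF onF fF, of x] by simp
    moreover have "(\<Sum>i\<in>F. (cmod (cinner x (e i)))\<^sup>2) \<le> infsum (\<lambda>i. (cmod (cinner x (e i)))\<^sup>2) I"
      by (rule finite_sum_le_infsum[OF summ fF F(1)]) simp
    ultimately show ?thesis by linarith
  qed
  have "(norm x)\<^sup>2 \<le> infsum (\<lambda>i. (cmod (cinner x (e i)))\<^sup>2) I"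
  proof (rule field_le_epsilon)
    fix \<epsilon> :: real assume "\<epsilon> > 0"
    then show "(norm x)\<^sup>2 \<le> infsum (\<lambda>i. (cmod (cinner x (e i)))\<^sup>2) I + \<epsilon>"
      using ge[of "sqrt \<epsilon>"] by simp
  qed
  with le summ show ?thesis by (auto simp: has_sum_iff)
qed

section \<open>Diagonal operators\<close>

text \<open>The limit follows the enumeration by \<open>nat\<close>. Since \<open>lim\<close> is
  total, convergence is a separate fact, valid for orthonormal \<open>u\<close> and bounded
  \<open>\<mu>\<close>.\<close>

definition diag_op :: "(nat \<Rightarrow> 'h) \<Rightarrow> (nat \<Rightarrow> complex) \<Rightarrow> 'h \<Rightarrow> 'h :: complex_hilbert_space" where
  "diag_op u \<mu> x = lim (\<lambda>n. \<Sum>k<n. (\<mu> k * cinner x (u k)) *\<^sub>C u k)"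

context
  fixes u :: "nat \<Rightarrow> 'h :: complex_hilbert_space" and \<mu> :: "nat \<Rightarrow> complex" and M :: real
  assumes on: "orthonormal_on UNIV u" and M: "\<And>k. cmod (\<mu> k) \<le> M"
begin

lemma diag_op_partial_norm:
  "finite F \<Longrightarrow> (norm (\<Sum>k\<in>F. (\<mu> k * cinner x (u k)) *\<^sub>C u k))\<^sup>2 \<le> M\<^sup>2 * (\<Sum>k\<in>F. (cmod (cinner x (u k)))\<^sup>2)"
proof -
  assume F: "finite F"
  have "(norm (\<Sum>k\<in>F. (\<mu> k * cinner x (u k)) *\<^sub>C u k))\<^sup>2 = (\<Sum>k\<in>F. (cmod (\<mu> k))\<^sup>2 * (cmod (cinner x (u k)))\<^sup>2)"
    by (subst norm_sum_orthonormal) (use F in \<open>auto intro: orthonormal_on_mono[OF on] simp: norm_mult power_mult_distrib\<close>)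
  also have "\<dots> \<le> (\<Sum>k\<in>F. M\<^sup>2 * (cmod (cinner x (u k)))\<^sup>2)"
    by (intro sum_mono mult_right_mono power_mono M) auto
  finally show ?thesis by (simp add: sum_distrib_left)
qed

text \<open>By Pythagoras, the increments of the partial sums are bounded by \<open>M\<close>
  squared times increments of the Bessel sums, which converge.\<close>

lemma diag_op_tendsto: "(\<lambda>n. \<Sum>k<n. (\<mu> k * cinner x (u k)) *\<^sub>C u k) \<longlonglongrightarrow> diag_op u \<mu> x"
proof -
  have M0: "0 \<le> M" using M[of 0] norm_ge_zero order_trans by blast
  let ?s = "\<lambda>n. \<Sum>k<n. (\<mu> k * cinner x (u k)) *\<^sub>C u k"
  let ?t = "\<lambda>n. \<Sum>k<n. (cmod (cinner x (u k)))\<^sup>2"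
  have "summable (\<lambda>k. (cmod (cinner x (u k)))\<^sup>2)"
    by (rule summableI_nonneg_bounded[where x = "(norm x)\<^sup>2"])
      (auto intro!: Bessel_inequality intro: orthonormal_on_mono[OF on])
  then have "convergent ?t" by (simp add: summable_iff_convergent)
  then have t: "Cauchy ?t" by (rule convergent_Cauchy)
  have "Cauchy ?s"
  proof (rule CauchyI)
    fix e :: real assume e: "0 < e"
    \<comment> \<open>Dividing by \<open>M + 1\<close> instead of \<open>M\<close> keeps the
      quotient meaningful for \<open>M = 0\<close> and makes the final estimate strict.\<close>
    define e' where "e' = (e / (M + 1))\<^sup>2"
    have "0 < e'" using e M0 by (simp add: e'_def)
    then obtain N where N: "\<forall>m\<ge>N. \<forall>n\<ge>N. norm (?t m - ?t n) < e'"
      using CauchyD[OF t] by blast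
    have main: "norm (?s n - ?s m) < e" if "m \<ge> N" "n \<ge> m" for m n
    proof -
      have split: "(\<Sum>k<n. f k) = (\<Sum>k<m. f k) + (\<Sum>k\<in>{m..<n}. f k)" for f :: "nat \<Rightarrow> 'b :: comm_monoid_add"
        using sum.union_disjoint[of "{..<m}" "{m..<n}" f] that
        by (simp add: ivl_disj_un ivl_disj_int)
      have "(norm (?s n - ?s m))\<^sup>2 \<le> M\<^sup>2 * (?t n - ?t m)"
        using diag_op_partial_norm[of "{m..<n}" x] by (simp add: split)
      also have "\<dots> \<le> M\<^sup>2 * e'"
      proof (intro mult_left_mono)
        have "norm (?t n - ?t m) < e'" using N that by simp
        then show "?t n - ?t m \<le> e'" by simp
      qed simp
      also have "\<dots> < e\<^sup>2"
      proof -
        have "M * (e / (M + 1)) < e" using e M0 by (simp add: divide_simps)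
        then have "(M * (e / (M + 1)))\<^sup>2 < e\<^sup>2" using e M0 by (intro power_strict_mono) auto
        then show ?thesis unfolding e'_def power_mult_distrib[symmetric] .
      qed
      finally show ?thesis using e by (simp add: power2_less_imp_less)
    qed
    have "norm (?s m - ?s n) < e" if "m \<ge> N" "n \<ge> N" for m n
      using main[of m n] main[of n m] that by (cases "m \<le> n") (auto simp: norm_minus_commute)
    then show "\<exists>N. \<forall>m\<ge>N. \<forall>n\<ge>N. norm (?s m - ?s n) < e" by blast
  qed
  then have "convergent ?s" by (rule Cauchy_convergent)
  then show ?thesis unfolding diag_op_def by (simp add: convergent_LIMSEQ_iff)
qed

lemma bounded_clinear_diag_op: "bounded_clinear (diag_op u \<mu>)"
proof -
  have M0: "0 \<le> M" using M[of 0] norm_ge_zero order_trans by blast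
  have add: "diag_op u \<mu> (x + y) = diag_op u \<mu> x + diag_op u \<mu> y" for x y
  proof (rule LIMSEQ_unique[OF diag_op_tendsto])
    show "(\<lambda>n. \<Sum>k<n. (\<mu> k * cinner (x + y) (u k)) *\<^sub>C u k) \<longlonglongrightarrow> diag_op u \<mu> x + diag_op u \<mu> y"
      using tendsto_add[OF diag_op_tendsto[of x] diag_op_tendsto[of y]]
      by (simp add: cinner_add_left distrib_left scaleC_add_left sum.distrib)
  qed
  have scale: "diag_op u \<mu> (c *\<^sub>C x) = c *\<^sub>C diag_op u \<mu> x" for c x
  proof (rule LIMSEQ_unique[OF diag_op_tendsto])
    show "(\<lambda>n. \<Sum>k<n. (\<mu> k * cinner (c *\<^sub>C x) (u k)) *\<^sub>C u k) \<longlonglongrightarrow> c *\<^sub>C diag_op u \<mu> x"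
      using tendsto_scaleC[OF diag_op_tendsto[of x], of c]
      by (simp add: cinner_scaleC_left complex_vector.scale_sum_right scaleC_scaleC mult.left_commute)
  qed
  have bd: "norm (diag_op u \<mu> x) \<le> norm x * M" for x
  proof (rule LIMSEQ_le_const2[OF tendsto_norm[OF diag_op_tendsto]])
    have "norm (\<Sum>k<n. (\<mu> k * cinner x (u k)) *\<^sub>C u k) \<le> norm x * M" for n
    proof (rule power2_le_imp_le)
      have "(norm (\<Sum>k<n. (\<mu> k * cinner x (u k)) *\<^sub>C u k))\<^sup>2 \<le> M\<^sup>2 * (\<Sum>k<n. (cmod (cinner x (u k)))\<^sup>2)"
        by (rule diag_op_partial_norm) simp
      also have "\<dots> \<le> M\<^sup>2 * (norm x)\<^sup>2"
        by (intro mult_left_mono Bessel_inequality orthonormal_on_mono[OF on]) auto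
      finally show "(norm (\<Sum>k<n. (\<mu> k * cinner x (u k)) *\<^sub>C u k))\<^sup>2 \<le> (norm x * M)\<^sup>2"
        by (simp add: power_mult_distrib mult.commute)
    qed (use M0 in simp)
    then show "\<exists>N. \<forall>n\<ge>N. norm (\<Sum>k<n. (\<mu> k * cinner x (u k)) *\<^sub>C u k) \<le> norm x * M" by blast
  qed
  show ?thesis
    unfolding bounded_clinear_def
    by (intro conjI allI scale bounded_linear_intro[where K = M])
      (simp_all add: add bd scale scaleR_eq_scaleC)
qed

lemma diag_op_eigen: "diag_op u \<mu> (u j) = \<mu> j *\<^sub>C u j"
proof (rule LIMSEQ_unique[OF diag_op_tendsto tendsto_eventually])
  have "(\<Sum>k<n. (\<mu> k * cinner (u j) (u k)) *\<^sub>C u k) = \<mu> j *\<^sub>C u j" if "n > j" for n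
  proof -
    have "(\<Sum>k<n. (\<mu> k * cinner (u j) (u k)) *\<^sub>C u k) = (\<Sum>k<n. if k = j then \<mu> j *\<^sub>C u j else 0)"
      by (rule sum.cong) (use on in \<open>auto simp: orthonormal_onD\<close>)
    then show ?thesis using that by simp
  qed
  then show "\<forall>\<^sub>F n in sequentially. (\<Sum>k<n. (\<mu> k * cinner (u j) (u k)) *\<^sub>C u k) = \<mu> j *\<^sub>C u j"
    unfolding eventually_sequentially by (intro exI[of _ "Suc j"]) simp
qed

lemma positive_diag_op:
  assumes "\<And>k. \<mu> k \<in> \<real>\<^sub>\<ge>\<^sub>0"
  shows "positive_operator (diag_op u \<mu>)"
proof -
  have cnj: "cnj (\<mu> k) = \<mu> k" for k
    using assms[of k] by (auto elim!: nonneg_Reals_cases)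
  have sa: "cinner (diag_op u \<mu> x) y = cinner x (diag_op u \<mu> y)" for x y
  proof (rule LIMSEQ_unique)
    show "(\<lambda>n. cinner (\<Sum>k<n. (\<mu> k * cinner x (u k)) *\<^sub>C u k) y) \<longlonglongrightarrow> cinner (diag_op u \<mu> x) y"
      by (intro tendsto_cinner diag_op_tendsto tendsto_const)
    have "cinner (\<Sum>k<n. (\<mu> k * cinner x (u k)) *\<^sub>C u k) y = cinner x (\<Sum>k<n. (\<mu> k * cinner y (u k)) *\<^sub>C u k)" for n
      unfolding cinner_sum_left cinner_sum_right cinner_scaleC_left cinner_scaleC_right
      by (rule sum.cong) (simp_all add: cnj cinner_commute[of y] )
    then show "(\<lambda>n. cinner (\<Sum>k<n. (\<mu> k * cinner x (u k)) *\<^sub>C u k) y) \<longlonglongrightarrow> cinner x (diag_op u \<mu> y)"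
      by (simp only:) (intro tendsto_cinner diag_op_tendsto tendsto_const)
  qed
  have pos: "cinner (diag_op u \<mu> x) x \<in> \<real>\<^sub>\<ge>\<^sub>0" for x
  proof (rule closed_sequentially[OF closed_nonneg_Reals_complex])
    show "(\<lambda>n. cinner (\<Sum>k<n. (\<mu> k * cinner x (u k)) *\<^sub>C u k) x) \<longlonglongrightarrow> cinner (diag_op u \<mu> x) x"
      by (intro tendsto_cinner diag_op_tendsto tendsto_const)
    show "cinner (\<Sum>k<n. (\<mu> k * cinner x (u k)) *\<^sub>C u k) x \<in> \<real>\<^sub>\<ge>\<^sub>0" for n
      unfolding cinner_sum_left cinner_scaleC_left
    proof (induction n)
      case (Suc k)
      have eq: "\<mu> k * cinner x (u k) * cinner (u k) x = \<mu> k * complex_of_real ((cmod (cinner x (u k)))\<^sup>2)"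
        by (simp add: cinner_commute[of "u k"] complex_norm_square mult.assoc del: of_real_power)
      have "\<mu> k * cinner x (u k) * cinner (u k) x \<in> \<real>\<^sub>\<ge>\<^sub>0"
        unfolding eq by (rule nonneg_Reals_mult_I[OF assms]) simp
      with Suc show ?case by simp
    qed simp
  qed
  show ?thesis unfolding positive_operator_def using bounded_clinear_diag_op sa pos by blast
qed

end

lemma op_spectrum_eigenvalue:
  assumes "E x = z *\<^sub>C x" "x \<noteq> 0"
  shows "z \<in> op_spectrum E"
proof -
  have "x = 0" if "bounded_clinear F" "\<forall>x. F (E x - z *\<^sub>C x) = x" for F
    using that(2)[rule_format, of x] bounded_clinear_linear(4)[OF that(1)] by (simp add: assms)
  then show ?thesis using assms(2) unfolding op_spectrum_def by auto
qed

text \<open>Finiteness of the value set matters twice: it bounds the operator, and for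
  \<open>z\<close> outside that set it bounds the entries \<open>1 / (\<mu> i - z)\<close> of the
  inverse. So the spectrum consists of the eigenvalues alone, with no limit points to add.\<close>

lemma diagonal_operator_exists:
  fixes e :: "'i \<Rightarrow> 'h :: complex_hilbert_space" and \<mu> :: "'i \<Rightarrow> real"
  assumes e: "orthonormal_basis I e" and I: "countable I" "infinite I"
    and fin: "finite (\<mu> ` I)" and nn: "\<And>i. i \<in> I \<Longrightarrow> 0 \<le> \<mu> i"
  shows "\<exists>E. positive_operator E \<and> op_spectrum E = complex_of_real ` \<mu> ` I \<and>
           (\<forall>i\<in>I. E (e i) = complex_of_real (\<mu> i) *\<^sub>C e i)"
proof -
  define b where "b = from_nat_into I"
  have b: "bij_betw b UNIV I" unfolding b_def by (rule bij_betw_from_nat_into[OF I])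
  then have bI: "b k \<in> I" for k by (auto simp: bij_betw_def)
  have bs: "\<exists>k. i = b k" if "i \<in> I" for i using b that by (auto simp: bij_betw_def)
  define u where "u k = e (b k)" for k
  have u: "orthonormal_basis UNIV u"
    using e b bI unfolding orthonormal_basis_def u_def
    by (auto simp: bij_betw_def inj_eq image_image[symmetric])
  then have on: "orthonormal_on UNIV u" by (simp add: orthonormal_basis_iff)
  define m where "m k = complex_of_real (\<mu> (b k))" for k
  have finm: "finite (range m)"
    by (rule finite_subset[of _ "complex_of_real ` \<mu> ` I"]) (use fin bI in \<open>auto simp: m_def\<close>)
  obtain M where M: "cmod (m k) \<le> M" for k
    using finite_imp_bounded[OF finm] unfolding bounded_iff by auto
  define E where "E = diag_op u m"
  have eig: "E (u k) = m k *\<^sub>C u k" for k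
    unfolding E_def by (rule diag_op_eigen[OF on M])
  have pos: "positive_operator E" unfolding E_def
    by (rule positive_diag_op[OF on M]) (use nn bI in \<open>simp add: m_def\<close>)
  have "op_spectrum E = range m"
  proof (intro equalityI subsetI)
    fix z assume z: "z \<in> op_spectrum E"
    show "z \<in> range m"
    proof (rule ccontr)
      assume nz: "z \<notin> range m"
      define g where "g k = inverse (m k - z)" for k
      have fing: "finite (range g)"
        by (rule finite_subset[of _ "(\<lambda>w. inverse (w - z)) ` range m"]) (use finm in \<open>auto simp: g_def\<close>)
      obtain K where K: "cmod (g k) \<le> K" for k
        using finite_imp_bounded[OF fing] unfolding bounded_iff by auto
      define F where "F = diag_op u g"
      have F: "bounded_clinear F" unfolding F_def by (rule bounded_clinear_diag_op[OF on K])
      have Fe: "F (u k) = g k *\<^sub>C u k" for k unfolding F_def by (rule diag_op_eigen[OF on K])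
      have E: "bounded_clinear E" using pos by (simp add: positive_operator_def)
      have mz: "m k - z \<noteq> 0" for k using nz by auto
      have 1: "(\<lambda>x. F (E x - z *\<^sub>C x)) = (\<lambda>x. x)"
      proof (rule bounded_clinear_eqI[OF u])
        show "F (E (u k) - z *\<^sub>C u k) = u k" for k
          using mz[of k]
          by (simp add: eig bounded_clinear_linear[OF F] Fe scaleC_scaleC g_def
              flip: complex_vector.scale_left_diff_distrib left_diff_distrib)
      qed (intro bounded_clinear_compose[OF F] bounded_clinear_diff E bounded_clinear_scaleC bounded_clinear_ident)+
      have 2: "(\<lambda>x. E (F x) - z *\<^sub>C F x) = (\<lambda>x. x)"
      proof (rule bounded_clinear_eqI[OF u])
        show "E (F (u k)) - z *\<^sub>C F (u k) = u k" for k
          using mz[of k]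
          by (simp add: eig bounded_clinear_linear[OF E] Fe scaleC_scaleC g_def mult.commute
              flip: complex_vector.scale_left_diff_distrib left_diff_distrib)
      qed (intro bounded_clinear_diff bounded_clinear_compose[OF E] bounded_clinear_compose[OF bounded_clinear_scaleC] F bounded_clinear_ident)+
      have "z \<notin> op_spectrum E"
        unfolding op_spectrum_def using F 1 2 by (auto simp: fun_eq_iff)
      with z show False by simp
    qed
  next
    fix z assume "z \<in> range m"
    then obtain k where "z = m k" by auto
    moreover have "u k \<noteq> 0" using orthonormal_on_norm[OF on, of k] by auto
    ultimately show "z \<in> op_spectrum E" using eig op_spectrum_eigenvalue by blast
  qed
  also have "range m = complex_of_real ` \<mu> ` I"
    using b by (auto simp: m_def bij_betw_def)
  finally show ?thesis using pos eig bs unfolding u_def m_def by metis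
qed

section \<open>Rotations of an orthonormal basis\<close>

lemma positive_operatorD:
  assumes "positive_operator E"
  shows "bounded_clinear E" "cinner (E x) y = cinner x (E y)"
  using assms by (auto simp: positive_operator_def)

text \<open>This is the two-dimensional Schur-Horn step: every averaging of two diagonal entries is
  realised, whatever the off-diagonal entry is, because a free phase can make that entry's
  contribution purely imaginary.\<close>

lemma orthonormal_basis_rotate:
  fixes g :: "'i \<Rightarrow> 'h :: complex_inner"
  assumes g: "orthonormal_basis I g" and E: "positive_operator E"
    and ij: "i \<in> I" "j \<in> I" "i \<noteq> j" and t: "0 \<le> t" "t \<le> 1"
    and d: "cinner (E (g i)) (g i) = complex_of_real x" "cinner (E (g j)) (g j) = complex_of_real y"
  shows "\<exists>h. orthonormal_basis I h \<and> (\<forall>k. k \<noteq> i \<longrightarrow> k \<noteq> j \<longrightarrow> h k = g k) \<and>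
           cinner (E (h i)) (h i) = complex_of_real (t * x + (1 - t) * y) \<and>
           cinner (E (h j)) (h j) = complex_of_real ((1 - t) * x + t * y)"
proof -
  note lin = bounded_clinear_linear[OF positive_operatorD(1)[OF E]]
  define w where "w = cinner (E (g i)) (g j)"
  have w': "cinner (E (g j)) (g i) = cnj w"
    unfolding w_def positive_operatorD(2)[OF E, of "g j"] by (rule cinner_commute)
  \<comment> \<open>this phase makes the cross terms of the two rotated vectors vanish\<close>
  define u where "u = (if w = 0 then 1 else \<i> * w / complex_of_real (cmod w))"
  have uu: "u * cnj u = 1"
  proof (cases "w = 0")
    case False
    then have "cmod u = 1" by (simp add: u_def norm_divide norm_mult)
    then show ?thesis by (simp add: complex_norm_square[symmetric])
  qed (simp add: u_def)
  have cross: "cnj u * w + u * cnj w = 0"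
    by (auto simp: u_def)
  define c s where "c = complex_of_real (sqrt t)" and "s = complex_of_real (sqrt (1 - t))"
  have cc: "c * c = complex_of_real t" and ss: "s * s = complex_of_real (1 - t)"
    using t by (simp_all add: c_def s_def flip: of_real_mult)
  have cs1: "c * c + s * s = 1" by (simp add: cc ss)
  have cnj: "cnj c = c" "cnj s = s" by (simp_all add: c_def s_def)
  define h where "h = g(i := c *\<^sub>C g i + (s * u) *\<^sub>C g j, j := (- s) *\<^sub>C g i + (c * u) *\<^sub>C g j)"
  have hi: "h i = c *\<^sub>C g i + (s * u) *\<^sub>C g j" and hj: "h j = (- s) *\<^sub>C g i + (c * u) *\<^sub>C g j"
    and hk: "\<And>k. k \<noteq> i \<Longrightarrow> k \<noteq> j \<Longrightarrow> h k = g k"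
    using ij by (simp_all add: h_def)
  have on: "orthonormal_on I g" using g by (simp add: orthonormal_basis_iff)
  note gg = orthonormal_onD[OF on]
  note expand = cinner_add_left cinner_add_right cinner_diff_left cinner_diff_right cinner_scaleC_left cinner_scaleC_right
  have hii: "cinner (h i) (h i) = 1"
  proof -
    have "cinner (h i) (h i) = c * c + s * s * (u * cnj u)"
      unfolding hi using ij by (simp add: expand gg cnj mult_ac)
    then show ?thesis by (simp add: uu cs1)
  qed
  have hjj: "cinner (h j) (h j) = 1"
  proof -
    have "cinner (h j) (h j) = s * s + c * c * (u * cnj u)"
      unfolding hj using ij by (simp add: expand gg cnj mult_ac)
    then show ?thesis using cs1 by (simp add: uu add.commute)
  qed
  have hij: "cinner (h i) (h j) = 0"
  proof -
    have "cinner (h i) (h j) = - (c * s) + c * s * (u * cnj u)"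
      unfolding hi hj using ij by (simp add: expand gg cnj mult_ac)
    then show ?thesis by (simp add: uu)
  qed
  have hji: "cinner (h j) (h i) = 0" using hij by (subst cinner_commute) simp
  have hik: "cinner (h i) (h k) = 0" "cinner (h j) (h k) = 0"
    "cinner (h k) (h i) = 0" "cinner (h k) (h j) = 0" if "k \<in> I" "k \<noteq> i" "k \<noteq> j" for k
    using that ij by (simp_all add: hi hj hk expand gg)
  have onh: "orthonormal_on I h"
    unfolding orthonormal_on_def
  proof (intro ballI)
    fix k l assume "k \<in> I" "l \<in> I"
    then show "cinner (h k) (h l) = (if k = l then 1 else 0)"
      by (cases "k = i"; cases "k = j"; cases "l = i"; cases "l = j")
        (use ij hik[of k] hik[of l] in \<open>auto simp: hii hjj hij hji hk gg\<close>)
  qed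
  have span: "g k \<in> cspan (h ` I)" if "k \<in> I" for k
  proof -
    have b: "h l \<in> cspan (h ` I)" if "l \<in> I" for l
      using that by (intro complex_vector.span_base) auto
    have "c *\<^sub>C h i + (- s) *\<^sub>C h j = (c * c + s * s) *\<^sub>C g i"
      unfolding hi hj
      by (simp add: scaleC_add_right scaleC_add_left scaleC_scaleC complex_vector.scale_right_diff_distrib mult_ac)
    then have "g i = c *\<^sub>C h i + (- s) *\<^sub>C h j" by (simp add: cs1)
    then have gi: "g i \<in> cspan (h ` I)"
      using b ij by (metis complex_vector.span_add complex_vector.span_scale)
    have "cnj u *\<^sub>C (s *\<^sub>C h i + c *\<^sub>C h j) = ((c * c + s * s) * (u * cnj u)) *\<^sub>C g j"
      unfolding hi hj
      by (simp add: scaleC_add_right scaleC_add_left scaleC_scaleC algebra_simps)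
    then have "g j = cnj u *\<^sub>C (s *\<^sub>C h i + c *\<^sub>C h j)" by (simp add: cs1 uu)
    then have gj: "g j \<in> cspan (h ` I)"
      using b ij by (metis complex_vector.span_add complex_vector.span_scale)
    show ?thesis using gi gj b[OF that] hk[of k] by metis
  qed
  have onb: "orthonormal_basis I h"
    by (rule orthonormal_basis_transfer[OF g onh]) (use span closure_subset in blast)
  have "cinner (E (h i)) (h i) = c * c * complex_of_real x + s * s * (u * cnj u) * complex_of_real y
      + c * s * (cnj u * w + u * cnj w)"
    unfolding hi by (simp add: lin expand d cnj w_def[symmetric] w' algebra_simps)
  then have 1: "cinner (E (h i)) (h i) = complex_of_real (t * x + (1 - t) * y)"
    by (simp add: cross uu cc ss)
  have "cinner (E (h j)) (h j) = s * s * complex_of_real x + c * c * (u * cnj u) * complex_of_real y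
      - c * s * (cnj u * w + u * cnj w)"
    unfolding hj
    by (simp add: lin expand d cnj w_def[symmetric] w' algebra_simps)
  then have 2: "cinner (E (h j)) (h j) = complex_of_real ((1 - t) * x + t * y)"
    by (simp add: cross uu cc ss)
  show ?thesis using onb hk 1 2 by blast
qed

text \<open>
  The \<open>n\<close>-th rotation mixes the vector carried so far with the fresh vector \<open>G (Suc n)\<close>. One of
  the two resulting vectors is settled for good, the other one is carried on; \<open>\<tau> n\<close> is the squared
  modulus of the coefficient with which the old carried vector enters the new one.
\<close>

primrec carry_vec :: "(nat \<Rightarrow> real) \<Rightarrow> (nat \<Rightarrow> 'a) \<Rightarrow> nat \<Rightarrow> 'a :: complex_inner" where
  "carry_vec \<tau> G 0 = G 0"
| "carry_vec \<tau> G (Suc n) =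
     complex_of_real (- sqrt (\<tau> n)) *\<^sub>C carry_vec \<tau> G n + complex_of_real (sqrt (1 - \<tau> n)) *\<^sub>C G (Suc n)"

definition settled_vec :: "(nat \<Rightarrow> real) \<Rightarrow> (nat \<Rightarrow> 'a) \<Rightarrow> nat \<Rightarrow> 'a :: complex_inner" where
  "settled_vec \<tau> G n =
     complex_of_real (sqrt (1 - \<tau> n)) *\<^sub>C carry_vec \<tau> G n + complex_of_real (sqrt (\<tau> n)) *\<^sub>C G (Suc n)"

lemma carry_vec_orthogonal:
  assumes "\<And>k. k \<le> n \<Longrightarrow> cinner (G k) v = 0"
  shows "cinner (carry_vec \<tau> G n) v = 0"
  using assms
  by (induction n) (simp_all add: cinner_add_left cinner_diff_left cinner_scaleC_left)

lemma settled_vec_orthogonal: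
  assumes "\<And>k. k \<le> Suc n \<Longrightarrow> cinner (G k) v = 0"
  shows "cinner (settled_vec \<tau> G n) v = 0"
  using assms carry_vec_orthogonal[of n G v \<tau>]
  by (simp add: settled_vec_def cinner_add_left cinner_scaleC_left)

text \<open>
  The settled vectors alone span a dense subspace because the part of a given vector that is
  still carried after \<open>m\<close> further rotations has squared norm \<open>\<Prod>k<m. \<tau> (n + k)\<close>.
\<close>

lemma orthonormal_basis_carry:
  fixes g :: "'i \<Rightarrow> 'h :: complex_inner" and s :: "nat \<Rightarrow> 'i"
  assumes g: "orthonormal_basis I g" and E: "positive_operator E"
    and s: "inj s" "range s \<subseteq> I"
    and eig: "\<And>n. E (g (s (Suc n))) = complex_of_real (l n) *\<^sub>C g (s (Suc n))"
    and r0: "cinner (E (g (s 0))) (g (s 0)) = complex_of_real (r 0)"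
    and \<tau>: "\<And>n. 0 \<le> \<tau> n" "\<And>n. \<tau> n \<le> 1"
    and r: "\<And>n. r (Suc n) = \<tau> n * r n + (1 - \<tau> n) * l n"
    and lim: "\<And>n. (\<lambda>m. \<Prod>k<m. \<tau> (n + k)) \<longlonglongrightarrow> 0"
  shows "\<exists>h. orthonormal_basis I h \<and> (\<forall>i. i \<notin> range s \<longrightarrow> h i = g i) \<and>
     (\<forall>n. cinner (E (h (s n))) (h (s n)) = complex_of_real ((1 - \<tau> n) * r n + \<tau> n * l n))"
proof -
  note lin = bounded_clinear_linear[OF positive_operatorD(1)[OF E]]
  have on: "orthonormal_on I g" using g by (simp add: orthonormal_basis_iff)
  define G where "G n = g (s n)" for n
  have sI: "s n \<in> I" for n using s by auto
  have GG: "cinner (G m) (G n) = (if m = n then 1 else 0)" for m n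
    using orthonormal_onD[OF on sI sI] s(1) by (simp add: G_def inj_eq)
  define c where "c = carry_vec \<tau> G"
  define f where "f = settled_vec \<tau> G"
  define a b where "a n = complex_of_real (sqrt (\<tau> n))" and "b n = complex_of_real (sqrt (1 - \<tau> n))" for n
  have aa: "a n * a n = complex_of_real (\<tau> n)" and bb: "b n * b n = complex_of_real (1 - \<tau> n)" for n
    using \<tau>[of n] by (simp_all add: a_def b_def flip: of_real_mult)
  have ab1: "a n * a n + b n * b n = 1" for n by (simp add: aa bb)
  have cnj: "cnj (a n) = a n" "cnj (b n) = b n" for n by (simp_all add: a_def b_def)
  have cS: "c (Suc n) = (- a n) *\<^sub>C c n + b n *\<^sub>C G (Suc n)" for n
    by (simp add: c_def a_def b_def)
  have fn: "f n = b n *\<^sub>C c n + a n *\<^sub>C G (Suc n)" for n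
    by (simp add: c_def f_def a_def b_def settled_vec_def)
  note expand = cinner_add_left cinner_add_right cinner_diff_left cinner_diff_right cinner_scaleC_left cinner_scaleC_right
  have cG: "cinner (c n) (G m) = 0" if "n < m" for n m
    unfolding c_def by (rule carry_vec_orthogonal) (use that in \<open>simp add: GG\<close>)
  have Gc: "cinner (G m) (c n) = 0" if "n < m" for n m
    using cG[OF that] by (subst cinner_commute) simp
  have fG: "cinner (f n) (G m) = 0" if "Suc n < m" for n m
    unfolding f_def by (rule settled_vec_orthogonal) (use that in \<open>simp add: GG\<close>)
  have fg: "cinner (f n) (g i) = 0" if "i \<in> I" "i \<notin> range s" for n i
    unfolding f_def
    by (rule settled_vec_orthogonal) (use that in \<open>auto simp: G_def orthonormal_onD[OF on sI]\<close>)
  have cc: "cinner (c n) (c n) = 1" for n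
  proof (induction n)
    case (Suc n)
    have "cinner (c (Suc n)) (c (Suc n)) = a n * a n * cinner (c n) (c n) + b n * b n"
      unfolding cS by (simp add: expand cG Gc GG cnj)
    then show ?case using Suc ab1 by simp
  qed (simp add: c_def GG)
  have EG: "E (G (Suc n)) = complex_of_real (l n) *\<^sub>C G (Suc n)" for n
    using eig by (simp add: G_def)
  \<comment> \<open>Here the cross terms vanish without any phase: the fresh vector is an
    eigenvector orthogonal to all vectors mixed so far.\<close>
  have EcG: "cinner (E (c n)) (G (Suc n)) = 0" for n
    by (simp add: positive_operatorD(2)[OF E] EG cinner_scaleC_right cG)
  have Ec: "cinner (E (c n)) (c n) = complex_of_real (r n)" for n
  proof (induction n)
    case (Suc n)
    have "cinner (E (c (Suc n))) (c (Suc n)) = a n * a n * cinner (E (c n)) (c n) + b n * b n * complex_of_real (l n)"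
      unfolding cS by (simp add: expand lin cG Gc GG cnj EcG EG)
    then show ?case by (simp add: Suc aa bb r)
  qed (simp add: c_def G_def r0)
  have Ef: "cinner (E (f n)) (f n) = complex_of_real ((1 - \<tau> n) * r n + \<tau> n * l n)" for n
  proof -
    have "cinner (E (f n)) (f n) = b n * b n * cinner (E (c n)) (c n) + a n * a n * complex_of_real (l n)"
      unfolding fn by (simp add: expand lin cG Gc GG cnj EcG EG)
    then show ?thesis by (simp add: Ec aa bb)
  qed
  have ff: "cinner (f n) (f n) = 1" for n
  proof -
    have "cinner (f n) (f n) = b n * b n * cinner (c n) (c n) + a n * a n"
      unfolding fn by (simp add: expand cG Gc GG cnj)
    then show ?thesis using ab1[of n] by (simp add: cc add.commute)
  qed
  have fc: "cinner (f n) (c m) = 0" if "n < m" for n m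
    using that
  proof (induction m rule: nat_induct)
    case (Suc m)
    show ?case
    proof (cases "n = m")
      case True
      have "cinner (f n) (c (Suc n)) = - (a n * b n * cinner (c n) (c n)) + a n * b n"
        unfolding cS fn by (simp add: expand cG Gc GG cnj)
      then show ?thesis using True by (simp add: cc)
    next
      case False
      with Suc have "n < m" by simp
      with Suc.IH show ?thesis
        unfolding cS by (simp add: cinner_add_right cinner_diff_right cinner_scaleC_right fG)
    qed
  qed simp
  have ff0: "cinner (f n) (f m) = 0" if "n < m" for n m
    using that unfolding fn[of m] by (simp add: cinner_add_right cinner_scaleC_right fG fc)
  have ff': "cinner (f n) (f m) = (if n = m then 1 else 0)" for n m
    using ff0[of n m] ff0[of m n] ff[of n] cinner_commute[of "f n" "f m"]
    by (cases n m rule: linorder_cases) auto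
  define h where "h i = (if i \<in> range s then f (inv_into UNIV s i) else g i)" for i
  have hs: "h (s n) = f n" for n using s(1) by (simp add: h_def)
  have hg: "h i = g i" if "i \<notin> range s" for i using that by (simp add: h_def)
  have onh: "orthonormal_on I h"
    unfolding orthonormal_on_def
  proof (intro ballI)
    fix i j assume ij: "i \<in> I" "j \<in> I"
    have gf: "cinner (g i) (f n) = 0" if "i \<in> I" "i \<notin> range s" for n i
      using fg[OF that] by (subst cinner_commute) simp
    show "cinner (h i) (h j) = (if i = j then 1 else 0)"
    proof (cases "i \<in> range s"; cases "j \<in> range s")
      assume "i \<in> range s" "j \<in> range s"
      then show ?thesis using s(1) by (auto simp: hs ff' inj_eq)
    next
      assume "i \<in> range s" "j \<notin> range s"
      then show ?thesis using ij by (auto simp: hs hg fg)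
    next
      assume "i \<notin> range s" "j \<in> range s"
      then show ?thesis using ij by (auto simp: hs hg gf)
    next
      assume "i \<notin> range s" "j \<notin> range s"
      then show ?thesis using ij by (simp add: hg orthonormal_onD[OF on])
    qed
  qed
  let ?S = "cspan (h ` I)"
  have base: "h i \<in> ?S" if "i \<in> I" for i
    using that by (intro complex_vector.span_base) auto
  have fS: "f n \<in> ?S" for n using base[OF sI[of n]] by (simp add: hs)
  have cn: "c n = b n *\<^sub>C f n - a n *\<^sub>C c (Suc n)" for n
  proof -
    have "b n *\<^sub>C f n - a n *\<^sub>C c (Suc n) = (a n * a n + b n * b n) *\<^sub>C c n"
      unfolding cS fn
      by (simp add: scaleC_add_right scaleC_add_left scaleC_scaleC complex_vector.scale_right_diff_distrib mult_ac)
    then show ?thesis by (simp add: ab1)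
  qed
  \<comment> \<open>Undoing \<open>m\<close> rotations expresses \<open>c n\<close> by settled
    vectors, up to a multiple of \<open>c (n + m)\<close> whose squared norm is the product of the
    \<open>\<tau> (n + k)\<close> for \<open>k < m\<close>.\<close>
  have rest: "c n - ((-1) ^ m * (\<Prod>k<m. a (n + k))) *\<^sub>C c (n + m) \<in> ?S" for n m
  proof (induction m)
    case 0
    show ?case by (simp add: complex_vector.span_zero)
  next
    case (Suc m)
    let ?p = "(-1) ^ m * (\<Prod>k<m. a (n + k))"
    have "?p *\<^sub>C c (n + m) = (?p * b (n + m)) *\<^sub>C f (n + m) - (?p * a (n + m)) *\<^sub>C c (n + Suc m)"
      by (subst cn[of "n + m"]) (simp add: complex_vector.scale_right_diff_distrib scaleC_scaleC)
    then have "c n - ((-1) ^ Suc m * (\<Prod>k<Suc m. a (n + k))) *\<^sub>C c (n + Suc m)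
        = (c n - ?p *\<^sub>C c (n + m)) + (?p * b (n + m)) *\<^sub>C f (n + m)"
      by (simp add: mult_ac)
    then show ?case
      using Suc fS[of "n + m"] by (metis complex_vector.span_add complex_vector.span_scale)
  qed
  have ccl: "c n \<in> closure ?S" for n
  proof -
    let ?x = "\<lambda>m. c n - ((-1) ^ m * (\<Prod>k<m. a (n + k))) *\<^sub>C c (n + m)"
    have nc: "norm (c m) = 1" for m
      using cinner_self[of "c m"] norm_ge_zero[of "c m"] unfolding cc
      by (auto simp: power2_eq_1_iff simp del: norm_ge_zero simp flip: of_real_power)
    have "norm (?x m - c n) = sqrt (\<Prod>k<m. \<tau> (n + k))" for m
    proof -
      have "norm (?x m - c n) = (\<Prod>k<m. sqrt (\<tau> (n + k)))"
        using \<tau> by (simp add: norm_scaleC norm_mult norm_power nc a_def prod_norm[symmetric])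
      also have "\<dots> = sqrt (\<Prod>k<m. \<tau> (n + k))"
        by (induction m) (simp_all add: real_sqrt_mult)
      finally show ?thesis .
    qed
    moreover have "(\<lambda>m. sqrt (\<Prod>k<m. \<tau> (n + k))) \<longlonglongrightarrow> 0"
      using tendsto_real_sqrt[OF lim[of n]] by simp
    ultimately have "(\<lambda>m. norm (?x m - c n)) \<longlonglongrightarrow> 0" by simp
    then have "?x \<longlonglongrightarrow> c n" by (rule LIM_zero_cancel[OF tendsto_norm_zero_cancel])
    then show ?thesis
      unfolding closure_sequential using rest by (intro exI[of _ ?x] conjI allI)
  qed
  note sub = subspace_closure_cspan[of "h ` I"]
  have Gcl: "G n \<in> closure ?S" for n
  proof (cases n)
    case 0
    then show ?thesis using ccl[of 0] by (simp add: c_def)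
  next
    case (Suc m)
    have "a m *\<^sub>C f m + b m *\<^sub>C c (Suc m) = (a m * a m + b m * b m) *\<^sub>C G (Suc m)"
      unfolding cS fn
      by (simp add: scaleC_add_right scaleC_add_left scaleC_scaleC complex_vector.scale_right_diff_distrib mult_ac)
    then have "G n = a m *\<^sub>C f m + b m *\<^sub>C c (Suc m)" by (simp add: ab1 Suc)
    moreover have "f m \<in> closure ?S" using fS closure_subset by blast
    ultimately show ?thesis
      using ccl[of "Suc m"] complex_vector.subspace_add[OF sub] complex_vector.subspace_scale[OF sub] by simp
  qed
  have "g i \<in> closure ?S" if "i \<in> I" for i
  proof (cases "i \<in> range s")
    case True
    then show ?thesis using Gcl by (auto simp: G_def)
  next
    case False
    then show ?thesis using base[OF that] closure_subset by (auto simp: hg)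
  qed
  then have "orthonormal_basis I h" by (rule orthonormal_basis_transfer[OF g onh])
  then show ?thesis using hg hs Ef by auto
qed

section \<open>Spreading a finite sequence\<close>

text \<open>The inverse of an averaging step on the entries \<open>i\<close> and \<open>j\<close>, if \<open>d i \<le> d j\<close> and \<open>0 \<le> \<delta>\<close>.\<close>

definition spread :: "('i \<Rightarrow> real) \<Rightarrow> 'i \<Rightarrow> 'i \<Rightarrow> real \<Rightarrow> 'i \<Rightarrow> real" where
  "spread d i j \<delta> = d(i := d i - \<delta>, j := d j + \<delta>)"

lemma spread_simps [simp]:
  "i \<noteq> j \<Longrightarrow> spread d i j \<delta> i = d i - \<delta>"
  "spread d i j \<delta> j = d j + \<delta>"
  "k \<noteq> i \<Longrightarrow> k \<noteq> j \<Longrightarrow> spread d i j \<delta> k = d k"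
  by (simp_all add: spread_def)

lemma sum_spread:
  fixes \<phi> :: "real \<Rightarrow> real"
  assumes "finite F" "i \<in> F" "j \<in> F" "i \<noteq> j"
  shows "(\<Sum>k\<in>F. \<phi> (spread d i j \<delta> k)) =
           (\<Sum>k\<in>F. \<phi> (d k)) + (\<phi> (d i - \<delta>) + \<phi> (d j + \<delta>) - \<phi> (d i) - \<phi> (d j))"
proof -
  have split: "(\<Sum>k\<in>F. f k) = f i + f j + (\<Sum>k\<in>F - {i} - {j}. f k)" for f :: "'a \<Rightarrow> real"
    using assms by (subst sum.remove[of F i], simp, simp, subst sum.remove[of "F - {i}" j]) auto
  have "(\<Sum>k\<in>F - {i} - {j}. \<phi> (spread d i j \<delta> k)) = (\<Sum>k\<in>F - {i} - {j}. \<phi> (d k))"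
    by (rule sum.cong) auto
  then show ?thesis
    using split[of "\<lambda>k. \<phi> (spread d i j \<delta> k)"] split[of "\<lambda>k. \<phi> (d k)"] assms by simp
qed

text \<open>\<open>Q\<close> stands for an entry that is still unfinished. A spread touches only
  \<open>i\<close> and \<open>j\<close>, so finishing one of them makes this count a termination
  measure.\<close>

lemma card_spread_less:
  assumes "finite F" "i \<in> F" "j \<in> F" "Q (d i)" "Q (d j)"
    and "\<not> Q (spread d i j \<delta> i) \<or> \<not> Q (spread d i j \<delta> j)"
  shows "card {k \<in> F. Q (spread d i j \<delta> k)} < card {k \<in> F. Q (d k)}"
proof (rule psubset_card_mono)
  have "k \<in> {k \<in> F. Q (d k)}" if "k \<in> {k \<in> F. Q (spread d i j \<delta> k)}" for k
    using that assms by (cases "k = i"; cases "k = j") auto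
  moreover have "i \<in> {k \<in> F. Q (d k)}" "j \<in> {k \<in> F. Q (d k)}" using assms by auto
  ultimately show "{k \<in> F. Q (spread d i j \<delta> k)} \<subset> {k \<in> F. Q (d k)}"
    using assms(6) by blast
qed (use assms in simp)

lemma sum_two_valued:
  fixes \<phi> :: "'i \<Rightarrow> real"
  assumes "finite F" "\<And>k. k \<in> F \<Longrightarrow> \<phi> k = (if Q k then c else 0)"
  shows "(\<Sum>k\<in>F. \<phi> k) = real (card {k \<in> F. Q k}) * c"
proof -
  have "(\<Sum>k\<in>F. \<phi> k) = (\<Sum>k\<in>F. if Q k then c else 0)"
    using assms(2) by (rule sum.cong[OF refl])
  also have "\<dots> = (\<Sum>k\<in>{k \<in> F. Q k}. c)"
    using assms(1) by (rule sum.inter_filter[symmetric])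
  finally show ?thesis by simp
qed

text \<open>The integer \<open>b - int n\<close> would lie strictly between 0 and 1.\<close>

lemma no_strict_multiple:
  fixes c x :: real
  assumes "real n * c + x = of_int b * c" "0 < x" "x < c"
  shows False
proof -
  have x: "x = of_int (b - int n) * c" using assms(1) by (simp add: algebra_simps)
  have "0 < c" using assms by linarith
  have "0 < real_of_int (b - int n) * c" "real_of_int (b - int n) * c < 1 * c"
    using assms(2,3) x by simp_all
  then have "0 < real_of_int (b - int n)" "real_of_int (b - int n) < 1"
    using \<open>0 < c\<close> by (simp_all only: zero_less_mult_pos2 mult_less_cancel_right_pos)
  then have "0 < b - int n" "b - int n < 1"
    unfolding of_int_0_less_iff of_int_less_1_iff .
  then show False by simp
qed

text \<open>This isolates the combinatorics of Schur-Horn from the operators: \<open>P d\<close>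
  will mean that \<open>d\<close> is realised as a diagonal. As a rotation turns a spread sequence
  back into the original one, the induction runs backwards, spreading \<open>d\<close> until its
  entries on \<open>F\<close> are eigenvalues. The reference sequence \<open>d0\<close> records that
  nothing changes outside \<open>F\<close>.\<close>

context
  fixes A B :: real and F :: "'i set" and d0 :: "'i \<Rightarrow> real" and P :: "('i \<Rightarrow> real) \<Rightarrow> bool"
  assumes AB: "0 < A" "A < B" and fin: "finite F"
    and base: "\<And>d. \<lbrakk>\<And>i. i \<in> F \<Longrightarrow> d i \<in> {0, A, B}; \<exists>i\<in>F. d i = A; \<And>i. i \<notin> F \<Longrightarrow> d i = d0 i\<rbrakk> \<Longrightarrow> P d"
    and step: "\<And>d i j \<delta>. \<lbrakk>i \<in> F; j \<in> F; i \<noteq> j; d i \<le> d j; 0 \<le> \<delta>; P (spread d i j \<delta>)\<rbrakk> \<Longrightarrow> P d"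
begin

text \<open>
  The two sums split the problem at \<open>A\<close>: only spreads inside \<open>(0, A)\<close> or inside \<open>(A, B)\<close> are used,
  and divisibility excludes that a single entry is left over in one of these intervals.
\<close>

lemma spread_induct_tight:
  assumes "\<And>i. i \<in> F \<Longrightarrow> 0 \<le> d i \<and> d i \<le> B" "\<And>i. i \<notin> F \<Longrightarrow> d i = d0 i"
    and "(\<Sum>k\<in>F. max (d k - A) 0) = of_int b * (B - A)"
    and "(\<Sum>k\<in>F. max (A - d k) 0) = of_int a * A"
    and "a + b < int (card F)"
  shows "P d"
  using assms
proof (induction "card {i \<in> F. d i \<notin> {0, A, B}}" arbitrary: d rule: less_induct)
  \<comment> \<open>The measure counts entries that are not yet eigenvalues. The invariants fix the
    final multiplicities: \<open>b\<close> entries \<open>B\<close> and \<open>a\<close> entries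
    \<open>0\<close>; then \<open>a + b < int (card F)\<close> leaves room for at least one
    \<open>A\<close>.\<close>
  case less
  note rng = less.prems(1) and off = less.prems(2) and up = less.prems(3) and lo = less.prems(4)
  have spread_gap: "P d"
    if ij: "i \<in> F" "j \<in> F" "i \<noteq> j" "d i \<le> d j"
      and gap: "p < d i" "d j < q" and pq: "p = 0 \<and> q = A \<or> p = A \<and> q = B" for i j p q
  proof -
    define \<delta> where "\<delta> = min (d i - p) (q - d j)"
    define d' where "d' = spread d i j \<delta>"
    have \<delta>: "0 < \<delta>" "\<delta> \<le> d i - p" "\<delta> \<le> q - d j" using gap by (auto simp: \<delta>_def)
    have pqd: "{p, q} \<subseteq> {0, A, B}" "0 \<le> p" "q \<le> B" using pq AB by auto
    have bad: "i \<in> {i \<in> F. d i \<notin> {0, A, B}}" "j \<in> {i \<in> F. d i \<notin> {0, A, B}}"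
      using ij gap pq AB by auto
    have "d i - \<delta> = p \<or> d j + \<delta> = q" by (auto simp: \<delta>_def min_def)
    then have "d' i \<in> {0, A, B} \<or> d' j \<in> {0, A, B}"
      using pqd ij(3) by (auto simp: d'_def)
    then have card: "card {k \<in> F. d' k \<notin> {0, A, B}} < card {k \<in> F. d k \<notin> {0, A, B}}"
      unfolding d'_def using bad by (intro card_spread_less[OF fin ij(1,2)]) auto
    have "P d'"
    proof (rule less.hyps[OF card])
      show "0 \<le> d' k \<and> d' k \<le> B" if "k \<in> F" for k
        using rng[OF that] rng[OF ij(1)] rng[OF ij(2)] \<delta> pqd ij(3)
        by (cases "k = i"; cases "k = j") (auto simp: d'_def)
      show "d' k = d0 k" if "k \<notin> F" for k
        using off[OF that] that ij by (subst spread_simps(3)[of k i j d \<delta>, folded d'_def]) auto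
      show "(\<Sum>k\<in>F. max (d' k - A) 0) = of_int b * (B - A)"
        using sum_spread[OF fin ij(1,2,3), of "\<lambda>x. max (x - A) 0" d \<delta>] up pq \<delta> gap ij(4)
        unfolding d'_def by auto
      show "(\<Sum>k\<in>F. max (A - d' k) 0) = of_int a * A"
        using sum_spread[OF fin ij(1,2,3), of "\<lambda>x. max (A - x) 0" d \<delta>] lo pq \<delta> gap ij(4)
        unfolding d'_def by auto
    qed (rule less.prems(5))
    then show "P d" unfolding d'_def using \<delta> ij by (intro step[of i j d \<delta>]) auto
  qed
  show "P d"
  proof (cases "\<exists>i\<in>F. \<exists>j\<in>F. i \<noteq> j \<and> (0 < d i \<and> d i < A \<and> 0 < d j \<and> d j < A \<or>
                     A < d i \<and> d i < B \<and> A < d j \<and> d j < B)")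
    case True
    then obtain i j where ij: "i \<in> F" "j \<in> F" "i \<noteq> j"
      "0 < d i \<and> d i < A \<and> 0 < d j \<and> d j < A \<or> A < d i \<and> d i < B \<and> A < d j \<and> d j < B" by blast
    show ?thesis
      using spread_gap[of i j 0 A] spread_gap[of j i 0 A] spread_gap[of i j A B] spread_gap[of j i A B] ij
      by (cases "d i \<le> d j") auto
  next
    case False
    have good: "d i \<in> {0, A, B}" if i: "i \<in> F" for i
    proof (rule ccontr)
      assume "d i \<notin> {0, A, B}"
      then consider "0 < d i" "d i < A" | "A < d i" "d i < B"
        using rng[OF i] by force
      then show False
      proof cases
        case 1
        have "(\<Sum>k\<in>F - {i}. max (A - d k) 0) = real (card {k \<in> F - {i}. d k = 0}) * A"
        proof (rule sum_two_valued)
          fix k assume k: "k \<in> F - {i}"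
          then have "\<not> (0 < d k \<and> d k < A)" using False 1 i by blast
          then show "max (A - d k) 0 = (if d k = 0 then A else 0)"
            using rng[of k] k AB by force
        qed (use fin in simp)
        then have "real (card {k \<in> F - {i}. d k = 0}) * A + (A - d i) = of_int a * A"
          using lo 1 fin i by (simp add: sum.remove[of F i])
        then show False by (rule no_strict_multiple) (use 1 in auto)
      next
        case 2
        have "(\<Sum>k\<in>F - {i}. max (d k - A) 0) = real (card {k \<in> F - {i}. d k = B}) * (B - A)"
        proof (rule sum_two_valued)
          fix k assume k: "k \<in> F - {i}"
          then have "\<not> (A < d k \<and> d k < B)" using False 2 i by blast
          then show "max (d k - A) 0 = (if d k = B then B - A else 0)"
            using rng[of k] k AB by force
        qed (use fin in simp)
        then have "real (card {k \<in> F - {i}. d k = B}) * (B - A) + (d i - A) = of_int b * (B - A)"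
          using up 2 fin i by (simp add: sum.remove[of F i])
        then show False by (rule no_strict_multiple) (use 2 in auto)
      qed
    qed
    have "\<exists>i\<in>F. d i = A"
    proof (rule ccontr)
      assume no: "\<not> (\<exists>i\<in>F. d i = A)"
      have "(\<Sum>k\<in>F. max (d k - A) 0) = real (card {k \<in> F. d k = B}) * (B - A)"
        by (rule sum_two_valued[OF fin]) (use good no AB in force)
      then have b: "b = int (card {k \<in> F. d k = B})" using up AB by simp
      have "(\<Sum>k\<in>F. max (A - d k) 0) = real (card {k \<in> F. d k = 0}) * A"
        by (rule sum_two_valued[OF fin]) (use good no AB in force)
      then have a: "a = int (card {k \<in> F. d k = 0})" using lo AB by simp
      have "F = {k \<in> F. d k = B} \<union> {k \<in> F. d k = 0}" using good no by auto
      moreover have "{k \<in> F. d k = B} \<inter> {k \<in> F. d k = 0} = {}" using AB by auto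
      ultimately have "card F = card {k \<in> F. d k = B} + card {k \<in> F. d k = 0}"
        using fin by (metis card_Un_disjoint finite_Un)
      then show False using less.prems(5) a b by simp
    qed
    then show ?thesis using base good off by blast
  qed
qed

text \<open>
  As long as the inequality between the upper sums is strict, entries may be spread across \<open>A\<close>.
  The first time that equality is reached (by continuity), the tight case takes over.
\<close>

lemma spread_induct:
  assumes "\<And>i. i \<in> F \<Longrightarrow> 0 \<le> d i \<and> d i \<le> B" "\<And>i. i \<notin> F \<Longrightarrow> d i = d0 i"
    and "(\<Sum>k\<in>F. d k) = real N * A + of_int b * B" "N \<ge> 1"
    and "(\<Sum>k\<in>F. max (d k - A) 0) \<le> of_int b * (B - A)"
  shows "P d"
  using assms
proof (induction "card {i \<in> F. 0 < d i \<and> d i < B}" arbitrary: d rule: less_induct)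
  case less
  note rng = less.prems(1) and off = less.prems(2) and tot = less.prems(3) and up = less.prems(5)
  have tight: "P d" if rng: "\<And>i. i \<in> F \<Longrightarrow> 0 \<le> d i \<and> d i \<le> B" and off: "\<And>i. i \<notin> F \<Longrightarrow> d i = d0 i"
    and tot: "(\<Sum>k\<in>F. d k) = real N * A + of_int b * B"
    and eq: "(\<Sum>k\<in>F. max (d k - A) 0) = of_int b * (B - A)" for d
  proof (rule spread_induct_tight[where a = "int (card F) - int N - b", OF rng off eq])
    \<comment> \<open>The two positive parts differ by \<open>A - d k\<close>, so total and upper
      sum determine the lower sum: it is \<open>A\<close> times \<open>card F - N - b\<close>. The
      strict inequality of the tight case then amounts to \<open>N \<ge> 1\<close>.\<close>
    have "(\<Sum>k\<in>F. max (A - d k) 0) = (\<Sum>k\<in>F. max (d k - A) 0) - (\<Sum>k\<in>F. d k) + real (card F) * A"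
    proof -
      have "(\<Sum>k\<in>F. max (A - d k) 0) = (\<Sum>k\<in>F. max (d k - A) 0 - d k + A)"
        by (rule sum.cong) auto
      then show ?thesis by (simp add: sum.distrib sum_subtractf)
    qed
    then show "(\<Sum>k\<in>F. max (A - d k) 0) = of_int (int (card F) - int N - b) * A"
      by (simp add: eq tot algebra_simps)
  qed (use less.prems(4) in auto)
  show "P d"
  proof (cases "(\<Sum>k\<in>F. max (d k - A) 0) = of_int b * (B - A)")
    case True
    show ?thesis by (rule tight[OF rng off tot True])
  next
    case False
    with up have strict: "(\<Sum>k\<in>F. max (d k - A) 0) < of_int b * (B - A)" by simp
    \<comment> \<open>Suppose at most one entry \<open>x\<close> is strictly inside
      \<open>(0, B)\<close>, and \<open>n\<close> of the others equal \<open>B\<close>. The strict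
      upper inequality gives \<open>n + 1 \<le> b\<close>, so the total is below
      \<open>(n + 1) B \<le> b B\<close>, contradicting its value \<open>N A + b B\<close>.\<close>
    have "\<exists>i\<in>F. \<exists>j\<in>F. i \<noteq> j \<and> 0 < d i \<and> d i < B \<and> 0 < d j \<and> d j < B"
    proof (rule ccontr)
      assume no: "\<not> ?thesis"
      have count: "(\<Sum>k\<in>F - X. d k) = real (card {k \<in> F - X. d k = B}) * B"
        "(\<Sum>k\<in>F - X. max (d k - A) 0) = real (card {k \<in> F - X. d k = B}) * (B - A)"
        if "\<And>k. k \<in> F - X \<Longrightarrow> \<not> (0 < d k \<and> d k < B)" for X
      proof -
        have "d k = 0 \<or> d k = B" if "k \<in> F - X" for k
          using rng[of k] that \<open>\<And>k. k \<in> F - X \<Longrightarrow> \<not> (0 < d k \<and> d k < B)\<close>[OF that] by force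
        then show "(\<Sum>k\<in>F - X. d k) = real (card {k \<in> F - X. d k = B}) * B"
          "(\<Sum>k\<in>F - X. max (d k - A) 0) = real (card {k \<in> F - X. d k = B}) * (B - A)"
          using fin AB by (intro sum_two_valued; force)+
      qed
      have contra: False if "x < B" "n * B + x = real N * A + of_int b * B" "real n * (B - A) < of_int b * (B - A)"
        for x and n :: nat
      proof -
        have "real_of_int (int n) < of_int b" using that(3) AB by simp
        then have "int n + 1 \<le> b" by (simp only: of_int_less_iff)
        then have "real_of_int (int n + 1) \<le> of_int b" by (simp only: of_int_le_iff)
        then have "real n + 1 \<le> of_int b" by simp
        then have "(real n + 1) * B \<le> of_int b * B" using AB by (intro mult_right_mono) auto
        moreover have "0 \<le> real N * A" using AB by simp
        ultimately show False using that(1,2) by (simp add: algebra_simps)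
      qed
      show False
      proof (cases "\<exists>i\<in>F. 0 < d i \<and> d i < B")
        case True
        then obtain i where i: "i \<in> F" "0 < d i" "d i < B" by blast
        have "\<not> (0 < d k \<and> d k < B)" if "k \<in> F - {i}" for k using no i that by blast
        note c = count[of "{i}", OF this]
        show False
        proof (rule contra[OF i(3)])
          show "real (card {k \<in> F - {i}. d k = B}) * B + d i = real N * A + of_int b * B"
            using tot c(1) fin i by (simp add: sum.remove[of F i])
          have "0 \<le> max (d i - A) 0" by simp
          then show "real (card {k \<in> F - {i}. d k = B}) * (B - A) < of_int b * (B - A)"
            using strict c(2) fin i by (simp add: sum.remove[of F i])
        qed
      next
        case False
        then have "\<not> (0 < d k \<and> d k < B)" if "k \<in> F - {}" for k using that by blast
        note c = count[of "{}", OF this]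
        show False
          by (rule contra[of 0 "card {k \<in> F. d k = B}"]) (use c strict tot AB in auto)
      qed
    qed
    then obtain i j where ij: "i \<in> F" "j \<in> F" "i \<noteq> j" "d i \<le> d j" "0 < d i" "d j < B"
      by (metis linorder_le_cases)
    define \<delta>m where "\<delta>m = min (d i) (B - d j)"
    have \<delta>m: "0 < \<delta>m" using ij by (simp add: \<delta>m_def)
    have rng': "0 \<le> spread d i j \<delta> k \<and> spread d i j \<delta> k \<le> B" if "k \<in> F" "0 \<le> \<delta>" "\<delta> \<le> \<delta>m" for k \<delta>
      using rng[OF that(1)] rng[OF ij(1)] rng[OF ij(2)] that ij(3,4)
      by (cases "k = i"; cases "k = j") (auto simp: \<delta>m_def)
    have off': "spread d i j \<delta> k = d0 k" if "k \<notin> F" for k \<delta>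
      using off[OF that] that ij by (subst spread_simps(3)) auto
    have tot': "(\<Sum>k\<in>F. spread d i j \<delta> k) = real N * A + of_int b * B" for \<delta>
      using sum_spread[OF fin ij(1,2,3), of "\<lambda>x. x" d \<delta>] tot by simp
    define \<psi> where "\<psi> \<delta> = (\<Sum>k\<in>F. max (spread d i j \<delta> k - A) 0)" for \<delta>
    have \<psi>: "\<psi> = (\<lambda>\<delta>. (\<Sum>k\<in>F. max (d k - A) 0) + (max (d i - \<delta> - A) 0 + max (d j + \<delta> - A) 0 - max (d i - A) 0 - max (d j - A) 0))"
      unfolding \<psi>_def using sum_spread[OF fin ij(1,2,3), of "\<lambda>x. max (x - A) 0" d] by simp
    \<comment> \<open>If the full shift \<open>\<delta>m\<close> respects the bound on the upper sum
      \<open>\<psi>\<close>, an entry reaches \<open>0\<close> or \<open>B\<close> and the measure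
      drops. Otherwise \<open>\<psi>\<close> meets the bound at some intermediate shift, where the
      tight case finishes without recourse to the induction hypothesis.\<close>
    have "\<exists>\<delta>. 0 \<le> \<delta> \<and> P (spread d i j \<delta>)"
    proof (cases "\<psi> \<delta>m \<le> of_int b * (B - A)")
      case True
      let ?d = "spread d i j \<delta>m"
      have "?d i = 0 \<or> ?d j = B" using ij(3) by (auto simp: \<delta>m_def min_def)
      then have "card {k \<in> F. 0 < ?d k \<and> ?d k < B} < card {k \<in> F. 0 < d k \<and> d k < B}"
        using ij by (intro card_spread_less[OF fin ij(1,2)]) auto
      then have "P ?d"
        by (rule less.hyps) (use rng' off' tot' \<delta>m less.prems(4) True in \<open>auto simp: \<psi>_def\<close>)
      with \<delta>m show ?thesis by (intro exI[of _ \<delta>m]) auto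
    next
      case False
      have "\<exists>\<delta>\<ge>0. \<delta> \<le> \<delta>m \<and> \<psi> \<delta> = of_int b * (B - A)"
      proof (rule IVT')
        show "\<psi> 0 \<le> of_int b * (B - A)" using strict by (simp add: \<psi>)
        show "continuous_on {0..\<delta>m} \<psi>" unfolding \<psi> by (intro continuous_intros)
      qed (use False \<delta>m in auto)
      then obtain \<delta> where \<delta>: "0 \<le> \<delta>" "\<delta> \<le> \<delta>m" "\<psi> \<delta> = of_int b * (B - A)" by blast
      have "P (spread d i j \<delta>)"
        by (rule tight) (use rng' off' tot' \<delta> in \<open>auto simp: \<psi>_def\<close>)
      with \<delta> show ?thesis by blast
    qed
    then obtain \<delta> where "0 \<le> \<delta>" "P (spread d i j \<delta>)" by blast
    then show ?thesis using ij by (intro step[of i j d \<delta>]) auto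
  qed
qed

end

section \<open>Spectral decomposition\<close>

lemma bounded_below_if_not_in_spectrum:
  assumes "z \<notin> op_spectrum E"
  shows "\<exists>c>0. \<forall>x. c * norm x \<le> norm (E x - z *\<^sub>C x)"
proof -
  obtain F where F: "bounded_clinear F" "\<And>x. F (E x - z *\<^sub>C x) = x"
    using assms unfolding op_spectrum_def by auto
  then obtain K where K: "K > 0" "\<And>x. norm (F x) \<le> norm x * K"
    using bounded_linear.pos_bounded unfolding bounded_clinear_def by blast
  have "1 / K * norm x \<le> norm (E x - z *\<^sub>C x)" for x
    using K(2)[of "E x - z *\<^sub>C x"] K(1) by (simp add: F(2) divide_simps)
  then show ?thesis using K(1) by (intro exI[of _ "1 / K"]) simp
qed

text \<open>One root comes from the fundamental theorem of algebra, the other two from the quadratic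
  formula. In Vieta form the result can be substituted directly into a polynomial in an
  operator.\<close>

lemma cubic_factorization:
  fixes s p m :: complex
  shows "\<exists>a b c. a + b + c = s \<and> a * b + b * c + c * a = p \<and> a * b * c = m"
proof -
  obtain a where "poly [:- m, p, - s, 1:] a = 0"
    using fundamental_theorem_of_algebra_alt[of "[:- m, p, - s, 1:]"] by auto
  then have a: "a * (p - a * (s - a)) = m" by (simp add: algebra_simps)
  define q where "q = p - a * (s - a)"
  define w where "w = csqrt ((s - a)\<^sup>2 - 4 * q)"
  define b c where "b = ((s - a) + w) / 2" and "c = ((s - a) - w) / 2"
  have bc: "b + c = s - a" by (simp add: b_def c_def field_simps)
  have "4 * (b * c) = (s - a)\<^sup>2 - w\<^sup>2"
    by (simp add: b_def c_def power2_eq_square field_simps)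
  then have bc': "b * c = q" by (simp add: w_def)
  have "a + b + c = s" using bc by (simp add: algebra_simps)
  moreover have "a * b + b * c + c * a = p"
  proof -
    have "a * b + b * c + c * a = a * (b + c) + b * c" by (simp add: algebra_simps)
    then show ?thesis unfolding bc bc' q_def by simp
  qed
  moreover have "a * b * c = m" using a by (simp add: mult.assoc bc' q_def)
  ultimately show ?thesis by blast
qed

text \<open>This is the part of the spectral mapping theorem that the cubic
  \<open>z (z - \<alpha>) (z - \<beta>)\<close> requires. Its value at a root of the cubic minus
  \<open>m\<close> is \<open>m \<noteq> 0\<close>, so no such root is in the spectrum, and the lower
  bounds of the three linear factors multiply.\<close>

lemma spectral_cubic_bounded_below:
  fixes E :: "'h :: complex_inner \<Rightarrow> 'h"
  assumes E: "bounded_clinear E" and spec: "op_spectrum E = {0, \<alpha>, \<beta>}" and m: "m \<noteq> 0"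
  shows "\<exists>c>0. \<forall>x. c * norm x \<le>
    norm (E (E (E x)) - (\<alpha> + \<beta>) *\<^sub>C E (E x) + (\<alpha> * \<beta>) *\<^sub>C E x - m *\<^sub>C x)"
proof -
  note lin = bounded_clinear_linear[OF E]
  obtain a b c where abc: "a + b + c = \<alpha> + \<beta>" "a * b + b * c + c * a = \<alpha> * \<beta>" "a * b * c = m"
    using cubic_factorization by blast
  have root: "z \<notin> op_spectrum E" if "z = a \<or> z = b \<or> z = c" for z
  proof -
    have "z * (z - \<alpha>) * (z - \<beta>) = z * z * z - (\<alpha> + \<beta>) * (z * z) + (\<alpha> * \<beta>) * z"
      by (simp add: algebra_simps)
    also have "\<dots> = (z - a) * (z - b) * (z - c) + m"
      unfolding abc[symmetric] by (simp add: algebra_simps)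
    finally have "z * (z - \<alpha>) * (z - \<beta>) = m" using that by auto
    then show ?thesis using m unfolding spec by auto
  qed
  obtain ka kb kc where k: "ka > 0" "\<And>x. ka * norm x \<le> norm (E x - a *\<^sub>C x)"
    "kb > 0" "\<And>x. kb * norm x \<le> norm (E x - b *\<^sub>C x)"
    "kc > 0" "\<And>x. kc * norm x \<le> norm (E x - c *\<^sub>C x)"
    using bounded_below_if_not_in_spectrum[OF root] by metis
  have "ka * kb * kc * norm x \<le> norm (E (E (E x)) - (\<alpha> + \<beta>) *\<^sub>C E (E x) + (\<alpha> * \<beta>) *\<^sub>C E x - m *\<^sub>C x)" for x
  proof -
    define y where "y = E x - c *\<^sub>C x"
    define z where "z = E y - b *\<^sub>C y"
    have "ka * kb * kc * norm x \<le> ka * kb * norm y"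
      using k(1,3,5) k(6)[of x] by (simp add: y_def mult.assoc)
    also have "\<dots> \<le> ka * norm z" using k(1,3) k(4)[of y] by (simp add: z_def mult.assoc)
    also have "\<dots> \<le> norm (E z - a *\<^sub>C z)" by (rule k(2))
    also have "E z - a *\<^sub>C z = E (E (E x)) - (a + b + c) *\<^sub>C E (E x)
        + (a * b + b * c + c * a) *\<^sub>C E x - (a * b * c) *\<^sub>C x"
      unfolding z_def y_def
      by (simp add: lin scaleC_add_left scaleC_add_right complex_vector.scale_right_diff_distrib scaleC_scaleC algebra_simps)
    finally show ?thesis unfolding abc .
  qed
  then show ?thesis using k by (intro exI[of _ "ka * kb * kc"]) simp
qed

text \<open>
  With \<open>M = \<parallel>T\<parallel>\<close>, the vectors on which \<open>T\<close> almost attains its norm show that \<open>T\<^sup>2 - M\<^sup>2\<close> is not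
  bounded below, although it is the product of \<open>T - M\<close> and \<open>T + M\<close>.
\<close>

lemma self_adjoint_eq_0_if_bounded_below:
  fixes T :: "'h :: complex_inner \<Rightarrow> 'h"
  assumes T: "bounded_clinear T" and sa: "\<And>x y. cinner (T x) y = cinner x (T y)"
    and bb: "\<And>m :: complex. m \<noteq> 0 \<Longrightarrow> \<exists>c>0. \<forall>x. c * norm x \<le> norm (T x - m *\<^sub>C x)"
  shows "T x = 0"
proof (rule ccontr)
  assume x: "T x \<noteq> 0"
  have bl: "bounded_linear T" using T by (simp add: bounded_clinear_def)
  note lin = bounded_clinear_linear[OF T]
  define M where "M = onorm T"
  have M: "M > 0" using x onorm_pos_lt[OF bl] by (auto simp: M_def)
  obtain c1 c2 where c: "c1 > 0" "\<And>x. c1 * norm x \<le> norm (T x - complex_of_real M *\<^sub>C x)"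
    "c2 > 0" "\<And>x. c2 * norm x \<le> norm (T x - complex_of_real (- M) *\<^sub>C x)"
    using bb[of "complex_of_real M"] bb[of "complex_of_real (- M)"] M by auto
  \<comment> \<open>Normalised so that \<open>M * k\<close> is a lower bound for
    \<open>T T - M M\<close>; the common factor \<open>M\<close> squared then cancels in
    \<open>key\<close>.\<close>
  define k where "k = (c1 * c2) / M"
  have k: "k > 0" using c M by (simp add: k_def)
  \<comment> \<open>Expanding the squared norm of \<open>T (T y) - M M y\<close> and using
    \<open>norm (T (T y)) \<le> M * norm (T y)\<close> leaves a bound on \<open>norm (T y)\<close>
    with a constant smaller than \<open>M\<close>, impossible for the operator norm.\<close>
  have key: "(norm (T y))\<^sup>2 \<le> (M\<^sup>2 - k\<^sup>2) * (norm y)\<^sup>2" for y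
  proof -
    define z where "z = T y - complex_of_real (- M) *\<^sub>C y"
    have "c1 * c2 * norm y \<le> c1 * norm z" using c(1) c(4)[of y] by (simp add: z_def mult.assoc)
    also have "\<dots> \<le> norm (T z - complex_of_real M *\<^sub>C z)" by (rule c(2))
    also have "T z - complex_of_real M *\<^sub>C z = T (T y) - M\<^sup>2 *\<^sub>R y"
      unfolding z_def
      by (simp add: lin scaleR_eq_scaleC complex_vector.scale_right_diff_distrib scaleC_add_right scaleC_scaleC power2_eq_square)
    finally have "M * k * norm y \<le> norm (T (T y) - M\<^sup>2 *\<^sub>R y)" using M by (simp add: k_def)
    then have "(M * k * norm y)\<^sup>2 \<le> (norm (T (T y) - M\<^sup>2 *\<^sub>R y))\<^sup>2"
      using M k by (intro power_mono) auto
    also have "\<dots> = (norm (T (T y)))\<^sup>2 - 2 * M\<^sup>2 * inner (T (T y)) y + (M\<^sup>2)\<^sup>2 * (norm y)\<^sup>2"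
      unfolding power2_norm_eq_inner
      by (simp add: inner_diff_left inner_diff_right inner_commute power2_eq_square algebra_simps)
    also have "inner (T (T y)) y = (norm (T y))\<^sup>2"
      by (simp add: inner_eq_Re_cinner sa[of "T y"] cinner_self)
    also have "(norm (T (T y)))\<^sup>2 \<le> (M * norm (T y))\<^sup>2"
      using onorm[OF bl, of "T y"] by (intro power_mono) (simp_all add: M_def)
    finally have "M\<^sup>2 * (k\<^sup>2 * (norm y)\<^sup>2) \<le> M\<^sup>2 * (M\<^sup>2 * (norm y)\<^sup>2 - (norm (T y))\<^sup>2)"
      by (simp add: power_mult_distrib algebra_simps power2_eq_square)
    then have "k\<^sup>2 * (norm y)\<^sup>2 \<le> M\<^sup>2 * (norm y)\<^sup>2 - (norm (T y))\<^sup>2"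
      using M by (simp add: mult_le_cancel_left_pos)
    then show ?thesis by (simp add: algebra_simps)
  qed
  have "0 < (norm (T x))\<^sup>2" using x by simp
  then have "0 < (M\<^sup>2 - k\<^sup>2) * (norm x)\<^sup>2" using key[of x] by linarith
  then have L: "0 \<le> M\<^sup>2 - k\<^sup>2" by (metis zero_less_mult_pos2 less_imp_le mult_zero_right order_less_irrefl zero_le_power2 order_le_less)
  have "norm (T y) \<le> sqrt (M\<^sup>2 - k\<^sup>2) * norm y" for y
    using real_sqrt_le_mono[OF key[of y]] by (simp add: real_sqrt_mult)
  then have "M \<le> sqrt (M\<^sup>2 - k\<^sup>2)" unfolding M_def[symmetric]
    using onorm_bound[of "sqrt (M\<^sup>2 - k\<^sup>2)" T] L by (simp add: M_def)
  then have "M\<^sup>2 \<le> (sqrt (M\<^sup>2 - k\<^sup>2))\<^sup>2" using M by (intro power_mono) auto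
  then show False using L k by simp
qed

definition orth_projection :: "('h :: complex_inner \<Rightarrow> 'h) \<Rightarrow> bool" where
  "orth_projection T \<longleftrightarrow> bounded_clinear T \<and> (\<forall>x y. cinner (T x) y = cinner x (T y)) \<and> (\<forall>x. T (T x) = T x)"

lemma orth_projection_cinner:
  assumes "orth_projection T"
  shows "cinner (T x) x = complex_of_real ((norm (T x))\<^sup>2)"
proof -
  have "cinner (T x) x = cinner (T (T x)) x" using assms by (simp add: orth_projection_def)
  also have "\<dots> = cinner (T x) (T x)" using assms unfolding orth_projection_def by blast
  finally show ?thesis by (simp only: cinner_self)
qed

lemma orth_projection_complement:
  assumes "orth_projection T"
  shows "orth_projection (\<lambda>x. x - T x)"
  using assms unfolding orth_projection_def
  by (auto simp: bounded_clinear_diff bounded_clinear_ident cinner_diff_left cinner_diff_right bounded_clinear_linear)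

lemma orth_projection_norm_le: "orth_projection T \<Longrightarrow> norm (T x) \<le> norm x"
proof -
  assume T: "orth_projection T"
  have "(norm (T x))\<^sup>2 \<le> norm (T x) * norm x"
    using cinner_Cauchy_Schwarz[of "T x" x] unfolding orth_projection_cinner[OF T] by (simp add: norm_power)
  then show ?thesis by (cases "T x = 0") (simp_all add: power2_eq_square)
qed

text \<open>The self-adjoint operator \<open>E (E - A) (E - B)\<close> vanishes, since subtracting
  any nonzero scalar leaves it bounded below. After that everything is algebra with polynomials in
  \<open>E\<close> modulo this cubic.\<close>

lemma three_point_spectral_decomposition:
  fixes E :: "'h :: complex_inner \<Rightarrow> 'h" and A B :: real
  assumes pos: "positive_operator E" and spec: "op_spectrum E = {0, complex_of_real A, complex_of_real B}"
    and AB: "0 < A" "A < B"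
  shows "\<exists>P Q. orth_projection P \<and> orth_projection Q \<and> orth_projection (\<lambda>x. x - P x - Q x) \<and>
     (\<forall>x. E x = complex_of_real A *\<^sub>C P x + complex_of_real B *\<^sub>C Q x) \<and> (\<exists>x. P x \<noteq> 0)"
proof -
  have E: "bounded_clinear E" and saE: "\<And>x y. cinner (E x) y = cinner x (E y)"
    using pos by (simp_all add: positive_operator_def)
  note lin = bounded_clinear_linear[OF E]
  define a b where "a = complex_of_real A" and "b = complex_of_real B"
  have cnj: "cnj a = a" "cnj b = b" by (simp_all add: a_def b_def)
  have ab: "a \<noteq> 0" "b \<noteq> 0" "b - a \<noteq> 0" using AB by (simp_all add: a_def b_def)
  define T where "T x = E (E (E x)) - (a + b) *\<^sub>C E (E x) + (a * b) *\<^sub>C E x" for x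
  have T: "bounded_clinear T"
  proof -
    have "T = (\<lambda>x. E (E (E x)) - (a + b) *\<^sub>C E (E x) - (- (a * b)) *\<^sub>C E x)"
      by (simp add: T_def fun_eq_iff complex_vector.scale_minus_left)
    moreover have "bounded_clinear \<dots>"
      by (intro bounded_clinear_diff bounded_clinear_compose[OF bounded_clinear_scaleC] bounded_clinear_compose[OF E] E)
    ultimately show ?thesis by simp
  qed
  have "T x = 0" for x
  proof (rule self_adjoint_eq_0_if_bounded_below[OF T])
    show "cinner (T x) y = cinner x (T y)" for x y
      by (simp add: T_def cinner_add_left cinner_add_right cinner_diff_left cinner_diff_right
          cinner_scaleC_left cinner_scaleC_right saE cnj)
    show "\<exists>c>0. \<forall>x. c * norm x \<le> norm (T x - m *\<^sub>C x)" if "m \<noteq> 0" for m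
      using spectral_cubic_bounded_below[OF E _ that, of a b] spec by (simp add: T_def a_def b_def)
  qed
  then have cub: "E (E (E x)) = (a + b) *\<^sub>C E (E x) - (a * b) *\<^sub>C E x" for x
    by (simp add: T_def algebra_simps)
  \<comment> \<open>\<open>P\<close> and \<open>Q\<close> are the Lagrange interpolation polynomials
    in \<open>E\<close> for the nodes \<open>0\<close>, \<open>a\<close>, \<open>b\<close>, with
    value 1 at \<open>a\<close> and at \<open>b\<close> respectively; \<open>p\<close> and
    \<open>q\<close> normalise them.\<close>
  define p q where "p = 1 / (a * (b - a))" and "q = 1 / (b * (b - a))"
  have pq: "cnj p = p" "cnj q = q" by (simp_all add: p_def q_def cnj)
  define P where "P x = p *\<^sub>C (b *\<^sub>C E x - E (E x))" for x
  define Q where "Q x = q *\<^sub>C (E (E x) - a *\<^sub>C E x)" for x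
  have bcP: "bounded_clinear P" unfolding P_def
    by (intro bounded_clinear_compose[OF bounded_clinear_scaleC] bounded_clinear_diff bounded_clinear_compose[OF E] E)
  have bcQ: "bounded_clinear Q" unfolding Q_def
    by (intro bounded_clinear_compose[OF bounded_clinear_scaleC] bounded_clinear_diff bounded_clinear_compose[OF E] E)
  have saP: "cinner (P x) y = cinner x (P y)" and saQ: "cinner (Q x) y = cinner x (Q y)" for x y
    by (simp_all add: P_def Q_def cinner_diff_left cinner_diff_right cinner_scaleC_left cinner_scaleC_right saE cnj pq)
  note expand = scaleC_add_left scaleC_add_right complex_vector.scale_right_diff_distrib
    complex_vector.scale_left_diff_distrib scaleC_scaleC
  have EP: "E (P x) = a *\<^sub>C P x" for x
    unfolding P_def by (simp add: lin cub expand algebra_simps)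
  have EQ: "E (Q x) = b *\<^sub>C Q x" for x
    unfolding Q_def by (simp add: lin cub expand algebra_simps)
  have PP: "P (P x) = P x" for x
  proof -
    have "P (P x) = (p * (a * (b - a))) *\<^sub>C P x"
      by (subst P_def) (simp add: EP lin expand algebra_simps)
    then show ?thesis using ab by (simp add: p_def)
  qed
  have QQ: "Q (Q x) = Q x" for x
  proof -
    have "Q (Q x) = (q * (b * (b - a))) *\<^sub>C Q x"
      by (subst Q_def) (simp add: EQ lin expand algebra_simps)
    then show ?thesis using ab by (simp add: q_def)
  qed
  have EPQ: "E x = a *\<^sub>C P x + b *\<^sub>C Q x" for x
  proof -
    have "a *\<^sub>C P x + b *\<^sub>C Q x = (a * p * b - b * q * a) *\<^sub>C E x + (b * q - a * p) *\<^sub>C E (E x)"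
      unfolding P_def Q_def by (simp add: expand algebra_simps)
    moreover have "a * p * b - b * q * a = 1" "b * q - a * p = 0"
      using ab by (simp_all add: p_def q_def divide_simps)
    ultimately show ?thesis by simp
  qed
  define R where "R x = x - P x - Q x" for x
  have ER: "E (R x) = 0" for x
    by (simp add: R_def lin EP EQ EPQ[symmetric] diff_diff_eq)
  have PR: "P (R x) = 0" "Q (R x) = 0" for x
    by (simp_all add: P_def Q_def ER lin)
  have bcR: "bounded_clinear R" unfolding R_def
    by (intro bounded_clinear_diff bounded_clinear_ident bcP bcQ)
  have RR: "R (R x) = R x" for x
    by (subst R_def) (simp add: PR)
  have saR: "cinner (R x) y = cinner x (R y)" for x y
    by (simp add: R_def cinner_diff_left cinner_diff_right saP saQ)
  have "\<exists>x. P x \<noteq> 0"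
  proof (rule ccontr)
    assume "\<not> ?thesis"
    then have P0: "P x = 0" for x by simp
    then have EE: "E (E x) = b *\<^sub>C E x" for x
      using ab by (auto simp: P_def p_def)
    \<comment> \<open>If \<open>P\<close> vanished, \<open>E\<close> would have only the values
      \<open>0\<close> and \<open>b\<close>. The affine function \<open>p z - 1 / a\<close> agrees
      there with \<open>1 / (z - a)\<close>, so \<open>F\<close> inverts \<open>E - a\<close>
      although \<open>a\<close> is in the spectrum.\<close>
    define F where "F x = p *\<^sub>C E x - (1 / a) *\<^sub>C x" for x
    have F: "bounded_clinear F" unfolding F_def
      by (intro bounded_clinear_compose[OF bounded_clinear_scaleC] bounded_clinear_diff bounded_clinear_ident E)
    have co: "p * b - 1 / a - a * p = 0" using ab by (simp add: p_def divide_simps)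
    have "E (F x) - a *\<^sub>C F x = (p * b - 1 / a - a * p) *\<^sub>C E x + (a * (1 / a)) *\<^sub>C x" for x
      unfolding F_def by (simp add: lin EE expand algebra_simps)
    then have 1: "E (F x) - a *\<^sub>C F x = x" for x using ab unfolding co by simp
    have "F (E x - a *\<^sub>C x) = (p * b - 1 / a - a * p) *\<^sub>C E x + (a * (1 / a)) *\<^sub>C x" for x
      unfolding F_def by (simp add: lin EE expand algebra_simps)
    then have 2: "F (E x - a *\<^sub>C x) = x" for x using ab unfolding co by simp
    have "a \<notin> op_spectrum E" unfolding op_spectrum_def using F 1 2 by blast
    then show False using spec by (simp add: a_def)
  qed
  then show ?thesis
    using bcP bcQ bcR saP saQ saR PP QQ RR EPQ
    unfolding orth_projection_def R_def a_def b_def by (intro exI[of _ P] exI[of _ Q] conjI allI) simp_all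
qed

section \<open>Diagonals of projections\<close>

lemma sum_diag_mult_commute:
  fixes M N :: "'a :: comm_ring_1 mat"
  assumes "M \<in> carrier_mat n n" "N \<in> carrier_mat n n"
  shows "(\<Sum>i<n. (M * N) $$ (i, i)) = (\<Sum>i<n. (N * M) $$ (i, i))"
proof -
  have eq: "(\<Sum>i<n. (M * N) $$ (i, i)) = (\<Sum>i<n. \<Sum>k<n. M $$ (i, k) * N $$ (k, i))"
    if "M \<in> carrier_mat n n" "N \<in> carrier_mat n n" for M N :: "'a mat"
    using that by (intro sum.cong) (auto simp: scalar_prod_def lessThan_atLeast0)
  show ?thesis
    unfolding eq[OF assms] eq[OF assms(2,1)] by (subst sum.swap) (simp add: mult.commute)
qed

text \<open>Schur triangularisation serves both traces at once: similarity preserves them, and the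
  diagonal of the square of a triangular matrix consists of the squared diagonal entries.\<close>

lemma trace_eigenvalues:
  fixes M :: "complex mat"
  assumes M: "M \<in> carrier_mat n n"
  shows "\<exists>ev. (\<forall>i<n. eigenvalue M (ev i)) \<and> (\<Sum>i<n. M $$ (i, i)) = (\<Sum>i<n. ev i) \<and>
           (\<Sum>i<n. (M * M) $$ (i, i)) = (\<Sum>i<n. ev i * ev i)"
proof -
  obtain es where es: "char_poly M = (\<Prod>a\<leftarrow>es. [:- a, 1:])"
    using char_poly_factorized[OF M] by blast
  obtain B P Q where "schur_decomposition M es = (B, P, Q)" by (cases "schur_decomposition M es") auto
  from schur_decomposition[OF M es this]
  have sim: "similar_mat_wit M B P Q" and ut: "upper_triangular B" and dg: "diag_mat B = es" by auto
  from similar_mat_witD2[OF M sim]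
  have QP: "Q * P = 1\<^sub>m n" and MB: "M = P * B * Q" and c: "B \<in> carrier_mat n n" "P \<in> carrier_mat n n" "Q \<in> carrier_mat n n"
    by auto
  have tr: "(\<Sum>i<n. (P * X * Q) $$ (i, i)) = (\<Sum>i<n. X $$ (i, i))" if X: "X \<in> carrier_mat n n" for X
  proof -
    have "(\<Sum>i<n. (P * X * Q) $$ (i, i)) = (\<Sum>i<n. (Q * (P * X)) $$ (i, i))"
      using c X by (intro sum_diag_mult_commute) auto
    also have "Q * (P * X) = Q * P * X" using c X by (intro assoc_mult_mat[symmetric]) auto
    also have "\<dots> = X" using X by (simp add: QP)
    finally show ?thesis .
  qed
  have MM: "M * M = P * (B * B) * Q"
  proof -
    have "M * M = P * B * (Q * (P * B * Q))"
      unfolding MB using c by (intro assoc_mult_mat) auto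
    also have "Q * (P * B * Q) = Q * (P * B) * Q" using c by (intro assoc_mult_mat[symmetric]) auto
    also have "Q * (P * B) = Q * P * B" using c by (intro assoc_mult_mat[symmetric]) auto
    also have "\<dots> = B" using c by (simp add: QP)
    also have "P * B * (B * Q) = P * B * B * Q" using c by (intro assoc_mult_mat[symmetric]) auto
    also have "P * B * B = P * (B * B)" using c by (intro assoc_mult_mat) auto
    finally show ?thesis .
  qed
  have BB: "(B * B) $$ (i, i) = B $$ (i, i) * B $$ (i, i)" if i: "i < n" for i
  proof -
    have "(B * B) $$ (i, i) = (\<Sum>k<n. B $$ (i, k) * B $$ (k, i))"
      using c i by (simp add: scalar_prod_def lessThan_atLeast0)
    also have "\<dots> = (\<Sum>k<n. if k = i then B $$ (i, i) * B $$ (i, i) else 0)"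
    proof (rule sum.cong[OF refl])
      fix k assume "k \<in> {..<n}"
      then show "B $$ (i, k) * B $$ (k, i) = (if k = i then B $$ (i, i) * B $$ (i, i) else 0)"
        using ut c i unfolding upper_triangular_def by (cases k i rule: linorder_cases) auto
    qed
    finally show ?thesis using i by simp
  qed
  have "eigenvalue M (B $$ (i, i))" if "i < n" for i
  proof -
    have "B $$ (i, i) \<in> set es" using that c unfolding dg[symmetric] diag_mat_def by auto
    then show ?thesis unfolding eigenvalue_root_char_poly[OF M] es by (rule linear_poly_root)
  qed
  moreover have "(\<Sum>i<n. M $$ (i, i)) = (\<Sum>i<n. B $$ (i, i))" unfolding MB by (rule tr[OF c(1)])
  moreover have "(\<Sum>i<n. (M * M) $$ (i, i)) = (\<Sum>i<n. B $$ (i, i) * B $$ (i, i))"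
  proof -
    have "(\<Sum>i<n. (M * M) $$ (i, i)) = (\<Sum>i<n. (B * B) $$ (i, i))"
      unfolding MM by (rule tr) (use c in auto)
    then show ?thesis using BB by simp
  qed
  ultimately show ?thesis by (intro exI[of _ "\<lambda>i. B $$ (i, i)"]) auto
qed

text \<open>Round each \<open>x i\<close> to the nearer of 0 and 1. The error is
  \<open>min x (1 - x)\<close>, and it is at most \<open>2 x (1 - x)\<close> because the larger of
  the two factors is at least 1/2.\<close>

lemma near_integer_sum:
  fixes x :: "nat \<Rightarrow> real"
  assumes "\<And>i. i < n \<Longrightarrow> 0 \<le> x i \<and> x i \<le> 1"
  shows "\<exists>m :: int. \<bar>(\<Sum>i<n. x i) - of_int m\<bar> \<le> 2 * (\<Sum>i<n. x i - x i * x i)"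
proof -
  define r where "r i = (if x i > 1 / 2 then 1 else 0 :: int)" for i
  have "\<bar>x i - of_int (r i)\<bar> \<le> 2 * (x i - x i * x i)" if "i < n" for i
  proof (cases "x i > 1 / 2")
    case True
    have "(1 - x i) * 1 \<le> (1 - x i) * (2 * x i)"
      using assms[OF that] True by (intro mult_left_mono) auto
    then show ?thesis using True assms[OF that] by (simp add: r_def algebra_simps)
  next
    case False
    have "x i * 1 \<le> x i * (2 * (1 - x i))"
      using assms[OF that] False by (intro mult_left_mono) auto
    then show ?thesis using False assms[OF that] by (simp add: r_def algebra_simps)
  qed
  then have "(\<Sum>i<n. \<bar>x i - of_int (r i)\<bar>) \<le> (\<Sum>i<n. 2 * (x i - x i * x i))"
    by (intro sum_mono) auto
  moreover have "\<bar>(\<Sum>i<n. x i) - of_int (\<Sum>i<n. r i)\<bar> \<le> (\<Sum>i<n. \<bar>x i - of_int (r i)\<bar>)"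
    unfolding of_int_sum sum_subtractf[symmetric] by (rule sum_abs)
  ultimately have "\<bar>(\<Sum>i<n. x i) - of_int (\<Sum>i<n. r i)\<bar> \<le> 2 * (\<Sum>i<n. x i - x i * x i)"
    by (simp add: sum_distrib_left)
  then show ?thesis by blast
qed

text \<open>For the compression \<open>M\<close> of \<open>T\<close> to the span of \<open>e\<close>
  over \<open>F\<close>, the right-hand side is twice the trace of \<open>M - M * M\<close>. It
  bounds the cost of rounding all eigenvalues of \<open>M\<close> to 0 or 1.\<close>

lemma compression_trace_near_integer:
  fixes T :: "'h :: complex_inner \<Rightarrow> 'h"
  assumes T: "orth_projection T" and on: "orthonormal_on F e" and F: "finite F"
  shows "\<exists>m :: int. \<bar>(\<Sum>i\<in>F. (norm (T (e i)))\<^sup>2) - of_int m\<bar> \<le>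
     2 * (\<Sum>i\<in>F. (norm (T (e i)))\<^sup>2 - (\<Sum>j\<in>F. (cmod (cinner (T (e i)) (e j)))\<^sup>2))"
proof -
  have lin: "bounded_clinear T" and sa: "\<And>x y. cinner (T x) y = cinner x (T y)"
    using T by (auto simp: orth_projection_def)
  define n where "n = card F"
  obtain f where f: "bij_betw f {..<n} F"
    using ex_bij_betw_nat_finite[OF F] by (auto simp: n_def lessThan_atLeast0)
  have fF: "f a \<in> F" if "a < n" for a using f that by (auto simp: bij_betw_def)
  have reindex: "(\<Sum>i\<in>F. g i) = (\<Sum>a<n. g (f a))" for g :: "_ \<Rightarrow> 'x :: comm_monoid_add"
    by (rule sum.reindex_bij_betw[OF f, symmetric])
  have onf: "orthonormal_on {..<n} (\<lambda>a. e (f a))"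
    using on f fF unfolding orthonormal_on_def by (auto simp: bij_betw_def inj_on_eq_iff)
  define M where "M = mat n n (\<lambda>(a, b). cinner (T (e (f b))) (e (f a)))"
  have M: "M \<in> carrier_mat n n" by (simp add: M_def)
  \<comment> \<open>An eigenvector of \<open>M\<close>, read as coordinates of a vector
    \<open>w\<close>, has as eigenvalue the Rayleigh quotient of \<open>T\<close> at
    \<open>w\<close>, which lies in \<open>[0, 1]\<close>.\<close>
  have ev: "\<exists>x. 0 \<le> x \<and> x \<le> 1 \<and> k = complex_of_real x" if k: "eigenvalue M k" for k
  proof -
    obtain v where v: "v \<in> carrier_vec n" "v \<noteq> 0\<^sub>v n" "M *\<^sub>v v = k \<cdot>\<^sub>v v"
      using k unfolding eigenvalue_def eigenvector_def carrier_matD[OF M] by blast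
    define w where "w = (\<Sum>b<n. vec_index v b *\<^sub>C e (f b))"
    have Mv: "cinner (T w) (e (f a)) = k * vec_index v a" if a: "a < n" for a
    proof -
      have "cinner (T w) (e (f a)) = (\<Sum>b<n. cinner (T (e (f b))) (e (f a)) * vec_index v b)"
        unfolding w_def bounded_clinear_linear[OF lin] cinner_sum_left cinner_scaleC_left
        by (simp add: mult.commute)
      also have "\<dots> = vec_index (M *\<^sub>v v) a"
        using a v(1) by (simp add: M_def scalar_prod_def lessThan_atLeast0)
      finally show ?thesis using a v by simp
    qed
    have nw: "(norm w)\<^sup>2 = (\<Sum>a<n. (cmod (vec_index v a))\<^sup>2)"
      unfolding w_def by (rule norm_sum_orthonormal[OF onf]) simp
    have "cinner (T w) w = (\<Sum>a<n. cnj (vec_index v a) * (k * vec_index v a))"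
    proof -
      have "cinner (T w) w = (\<Sum>a<n. cnj (vec_index v a) * cinner (T w) (e (f a)))"
        by (subst (2) w_def) (simp add: cinner_sum_right cinner_scaleC_right)
      then show ?thesis using Mv by simp
    qed
    also have "\<dots> = (\<Sum>a<n. k * complex_of_real ((cmod (vec_index v a))\<^sup>2))"
      unfolding complex_norm_square by (simp add: mult_ac)
    also have "\<dots> = k * complex_of_real ((norm w)\<^sup>2)"
      unfolding nw by (simp add: sum_distrib_left)
    finally have k: "complex_of_real ((norm (T w))\<^sup>2) = k * complex_of_real ((norm w)\<^sup>2)"
      unfolding orth_projection_cinner[OF T] .
    have "\<exists>a<n. vec_index v a \<noteq> 0" using v(1,2) by (metis carrier_vecD eq_vecI index_zero_vec)
    then obtain a where "a < n" "vec_index v a \<noteq> 0" by blast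
    then have "0 < (norm w)\<^sup>2" unfolding nw by (intro sum_pos2[of _ a]) auto
    then have "k = complex_of_real ((norm (T w))\<^sup>2 / (norm w)\<^sup>2)"
      using k by (simp add: field_simps)
    moreover have "(norm (T w))\<^sup>2 \<le> (norm w)\<^sup>2"
      using orth_projection_norm_le[OF T] by (intro power_mono) auto
    ultimately show ?thesis using \<open>0 < (norm w)\<^sup>2\<close>
      by (intro exI[of _ "(norm (T w))\<^sup>2 / (norm w)\<^sup>2"]) (simp add: divide_simps)
  qed
  obtain ew where ew: "\<And>i. i < n \<Longrightarrow> eigenvalue M (ew i)" "(\<Sum>i<n. M $$ (i, i)) = (\<Sum>i<n. ew i)"
    "(\<Sum>i<n. (M * M) $$ (i, i)) = (\<Sum>i<n. ew i * ew i)"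
    using trace_eigenvalues[OF M] by blast
  have "\<forall>i. \<exists>x. i < n \<longrightarrow> 0 \<le> x \<and> x \<le> 1 \<and> ew i = complex_of_real x" using ew(1) ev by blast
  then obtain x where x: "\<And>i. i < n \<Longrightarrow> 0 \<le> x i \<and> x i \<le> 1 \<and> ew i = complex_of_real (x i)" by metis
  have "complex_of_real (\<Sum>i\<in>F. (norm (T (e i)))\<^sup>2) = (\<Sum>i<n. M $$ (i, i))"
    unfolding reindex of_real_sum
    by (rule sum.cong) (simp_all add: M_def orth_projection_cinner[OF T])
  also have "\<dots> = complex_of_real (\<Sum>i<n. x i)" unfolding ew(2) using x by simp
  finally have tr1: "(\<Sum>i\<in>F. (norm (T (e i)))\<^sup>2) = (\<Sum>i<n. x i)" by (simp only: of_real_eq_iff)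
  have "complex_of_real (\<Sum>i\<in>F. \<Sum>j\<in>F. (cmod (cinner (T (e i)) (e j)))\<^sup>2) = (\<Sum>i<n. (M * M) $$ (i, i))"
    unfolding reindex of_real_sum
  proof (rule sum.cong[OF refl])
    fix a assume "a \<in> {..<n}"
    then have a: "a < n" by simp
    have "(M * M) $$ (a, a) = (\<Sum>b<n. cinner (T (e (f b))) (e (f a)) * cinner (T (e (f a))) (e (f b)))"
      using a by (simp add: M_def scalar_prod_def lessThan_atLeast0)
    also have "\<dots> = (\<Sum>b<n. complex_of_real ((cmod (cinner (T (e (f a))) (e (f b))))\<^sup>2))"
    proof (rule sum.cong[OF refl])
      fix b
      have "cinner (T (e (f b))) (e (f a)) = cnj (cinner (T (e (f a))) (e (f b)))"
        unfolding sa[of "e (f b)"] by (rule cinner_commute)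
      then show "cinner (T (e (f b))) (e (f a)) * cinner (T (e (f a))) (e (f b))
          = complex_of_real ((cmod (cinner (T (e (f a))) (e (f b))))\<^sup>2)"
        unfolding complex_norm_square by (simp add: mult.commute)
    qed
    finally show "(\<Sum>b<n. complex_of_real ((cmod (cinner (T (e (f a))) (e (f b))))\<^sup>2)) = (M * M) $$ (a, a)" ..
  qed
  also have "\<dots> = complex_of_real (\<Sum>i<n. x i * x i)" unfolding ew(3) using x by simp
  finally have tr2: "(\<Sum>i\<in>F. \<Sum>j\<in>F. (cmod (cinner (T (e i)) (e j)))\<^sup>2) = (\<Sum>i<n. x i * x i)"
    by (simp only: of_real_eq_iff)
  show ?thesis
    using near_integer_sum[of n x] x unfolding sum_subtractf tr1 tr2 by blast
qed

lemma has_sum_finite_sum: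
  fixes f :: "'i \<Rightarrow> 'j \<Rightarrow> 'a :: topological_comm_monoid_add"
  assumes "finite F" "\<And>i. i \<in> F \<Longrightarrow> (f i has_sum s i) A"
  shows "((\<lambda>j. \<Sum>i\<in>F. f i j) has_sum (\<Sum>i\<in>F. s i)) A"
  using assms by (induction F rule: finite_induct) (auto intro: has_sum_add)

text \<open>
  The finite compressions of \<open>T\<close> are almost idempotent: their trace exceeds that of their square
  by at most the tail of the summable family, so that all their eigenvalues are close to 0 or 1.
\<close>

lemma projection_diagonal_defect_integer:
  fixes T :: "'h :: complex_inner \<Rightarrow> 'h" and K :: "'i set"
  assumes T: "orth_projection T" and e: "orthonormal_basis I e"
    and summ: "(\<lambda>i. if i \<in> K then 1 - (norm (T (e i)))\<^sup>2 else (norm (T (e i)))\<^sup>2) summable_on I"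
  shows "(\<Sum>\<^sub>\<infinity>i\<in>I. if i \<in> K then (norm (T (e i)))\<^sup>2 - 1 else (norm (T (e i)))\<^sup>2) \<in> \<int>"
proof -
  have on: "orthonormal_on I e" using e by (simp add: orthonormal_basis_iff)
  have sa: "\<And>x y. cinner (T x) y = cinner x (T y)" using T by (auto simp: orth_projection_def)
  define t where "t i = (norm (T (e i)))\<^sup>2" for i
  define h where "h i = (if i \<in> K then 1 - t i else t i)" for i
  \<comment> \<open>\<open>g\<close> is the diagonal of the difference between \<open>T\<close> and
    the coordinate projection onto \<open>K\<close>; \<open>h\<close> is its absolute value.\<close>
  define g where "g i = (if i \<in> K then t i - 1 else t i)" for i
  have t1: "t i \<le> 1" if "i \<in> I" for i
  proof -
    have "norm (T (e i)) \<le> 1"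
      using orth_projection_norm_le[OF T, of "e i"] orthonormal_on_norm[OF on that] by simp
    then show ?thesis unfolding t_def by (simp add: power_le_one)
  qed
  have hg: "norm (g i) = h i" if "i \<in> I" for i
    using t1[OF that] by (auto simp: h_def g_def t_def)
  have sh: "h summable_on I" using summ unfolding h_def[abs_def] t_def .
  have sng: "(\<lambda>i. norm (g i)) summable_on I"
    using sh hg by (simp cong: summable_on_cong)
  then have sg: "g summable_on I" by (rule abs_summable_summable)
  define X where "X = infsum g I"
  have near: "\<exists>m :: int. \<bar>X - of_int m\<bar> \<le> 3 * \<epsilon>" if \<epsilon>: "\<epsilon> > 0" for \<epsilon>
  proof -
    obtain F where F: "finite F" "F \<subseteq> I" "dist (sum h F) (infsum h I) \<le> \<epsilon>"
      using infsum_finite_approximation[OF sh \<epsilon>] by blast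
    have shF: "h summable_on (I - F)" by (rule summable_on_subset_banach[OF sh]) blast
    have sgF: "(\<lambda>i. norm (g i)) summable_on (I - F)"
      by (rule summable_on_subset_banach[OF sng]) blast
    have ih: "infsum h (I - F) = infsum h I - sum h F"
      using infsum_Diff[OF sh _ F(2)] F(1) by simp
    then have tail: "infsum h (I - F) \<le> \<epsilon>" using F(3) by (simp add: dist_real_def)
    have "norm (infsum g (I - F)) \<le> infsum (\<lambda>i. norm (g i)) (I - F)"
      by (rule norm_infsum_bound[OF sgF])
    also have "\<dots> = infsum h (I - F)" by (rule infsum_cong) (use hg in auto)
    finally have gt: "\<bar>X - sum g F\<bar> \<le> \<epsilon>"
      using tail infsum_Diff[OF sg _ F(2)] F(1) by (simp add: X_def)
    have onF: "orthonormal_on F e" by (rule orthonormal_on_mono[OF on F(2)])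
    obtain m :: int where m: "\<bar>(\<Sum>i\<in>F. t i) - of_int m\<bar> \<le>
        2 * (\<Sum>i\<in>F. t i - (\<Sum>j\<in>F. (cmod (cinner (T (e i)) (e j)))\<^sup>2))"
      using compression_trace_near_integer[OF T onF F(1)] unfolding t_def by blast
    \<comment> \<open>Parseval turns the trace defect of the compression into the sum of squared
      matrix entries with row in \<open>F\<close> and column outside \<open>F\<close>.\<close>
    have pars: "((\<lambda>j. (cmod (cinner (T (e i)) (e j)))\<^sup>2) has_sum (t i - (\<Sum>j\<in>F. (cmod (cinner (T (e i)) (e j)))\<^sup>2))) (I - F)" for i
      unfolding t_def using F by (intro has_sum_Diff Parseval_identity[OF e]) auto
    have "((\<lambda>j. \<Sum>i\<in>F. (cmod (cinner (T (e i)) (e j)))\<^sup>2) has_sum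
        (\<Sum>i\<in>F. t i - (\<Sum>j\<in>F. (cmod (cinner (T (e i)) (e j)))\<^sup>2))) (I - F)"
      by (rule has_sum_finite_sum[OF F(1) pars])
    moreover have "(h has_sum infsum h (I - F)) (I - F)"
      using shF by simp
    \<comment> \<open>Off the diagonal, \<open>T\<close> and \<open>1 - T\<close> have entries of
      equal modulus. Bessel therefore bounds each column by the diagonal entry of either projection,
      in particular by the one that \<open>h\<close> selects.\<close>
    moreover have "(\<Sum>i\<in>F. (cmod (cinner (T (e i)) (e j)))\<^sup>2) \<le> h j" if j: "j \<in> I - F" for j
    proof -
      have sw: "cmod (cinner (T (e i)) (e j)) = cmod (cinner (T (e j)) (e i))" for i
        unfolding sa[of "e i"] by (subst cinner_commute) simp
      have 1: "(\<Sum>i\<in>F. (cmod (cinner (T (e i)) (e j)))\<^sup>2) \<le> t j"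
        unfolding sw t_def by (rule Bessel_inequality[OF onF F(1)])
      have orth: "cinner (e j) (e i) = 0" if "i \<in> F" for i
        using orthonormal_onD[OF on, of j i] that j F(2) by auto
      have "(\<Sum>i\<in>F. (cmod (cinner (T (e i)) (e j)))\<^sup>2) = (\<Sum>i\<in>F. (cmod (cinner (e j - T (e j)) (e i)))\<^sup>2)"
        unfolding sw by (rule sum.cong) (simp_all add: cinner_diff_left orth)
      also have "\<dots> \<le> (norm (e j - T (e j)))\<^sup>2" by (rule Bessel_inequality[OF onF F(1)])
      also have "\<dots> = 1 - t j"
      proof -
        have "complex_of_real ((norm (e j - T (e j)))\<^sup>2) = cinner (e j) (e j) - cinner (T (e j)) (e j)"
          using orth_projection_cinner[OF orth_projection_complement[OF T], of "e j"]
          by (simp add: cinner_diff_left)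
        also have "\<dots> = complex_of_real (1 - t j)"
          using j orthonormal_onD[OF on, of j j] by (simp add: orth_projection_cinner[OF T] t_def)
        finally show ?thesis by (simp only: of_real_eq_iff)
      qed
      finally show ?thesis using 1 by (simp add: h_def)
    qed
    ultimately have "(\<Sum>i\<in>F. t i - (\<Sum>j\<in>F. (cmod (cinner (T (e i)) (e j)))\<^sup>2)) \<le> infsum h (I - F)"
      by (rule has_sum_mono)
    with m tail have m': "\<bar>(\<Sum>i\<in>F. t i) - of_int m\<bar> \<le> 2 * \<epsilon>" by linarith
    \<comment> \<open>Passing from \<open>t\<close> to \<open>g\<close> subtracts the number of
      indices of \<open>F\<close> in \<open>K\<close>, an integer. The distance
      \<open>3 * \<epsilon>\<close> consists of \<open>2 * \<epsilon>\<close> from rounding and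
      \<open>\<epsilon>\<close> from the tail of \<open>g\<close>.\<close>
    have "sum g F = (\<Sum>i\<in>F. t i) - (\<Sum>i\<in>F. if i \<in> K then 1 else 0)"
      unfolding sum_subtractf[symmetric] by (rule sum.cong) (auto simp: g_def)
    also have "(\<Sum>i\<in>F. if i \<in> K then 1 else 0 :: real) = of_int (\<Sum>i\<in>F. if i \<in> K then 1 else 0)"
      unfolding of_int_sum by (rule sum.cong) auto
    finally have "\<bar>X - of_int (m - (\<Sum>i\<in>F. if i \<in> K then 1 else 0))\<bar> \<le> 3 * \<epsilon>"
      using m' gt by (simp add: abs_le_iff)
    then show ?thesis by blast
  qed
  have "X \<in> closure \<int>"
    unfolding closure_approachable
  proof (intro allI impI)
    fix e :: real assume "0 < e"
    then obtain m :: int where "\<bar>X - of_int m\<bar> \<le> 3 * (e / 4)" using near[of "e / 4"] by auto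
    then have "dist (of_int m) X < e" using \<open>0 < e\<close> unfolding dist_real_def by linarith
    then show "\<exists>y\<in>\<int>. dist y X < e" by (auto intro: Ints_of_int)
  qed
  then have "X \<in> \<int>" by (simp add: closure_closed)
  then show ?thesis unfolding X_def g_def[abs_def] t_def .
qed

section \<open>Necessity\<close>

lemma three_point_diagonal_necessary:
  fixes E :: "'h :: complex_inner \<Rightarrow> 'h" and I :: "'i set" and d :: "'i \<Rightarrow> real" and A B :: real
  defines "J \<equiv> {i \<in> I. d i < A}" and "K \<equiv> {i \<in> I. A \<le> d i}"
  assumes pos: "positive_operator E" and spec: "op_spectrum E = {0, complex_of_real A, complex_of_real B}"
    and AB: "0 < A" "A < B" and diag: "has_diagonal E I d"
    and sJ: "d summable_on J" and sK: "(\<lambda>i. B - d i) summable_on K"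
  shows "\<exists>(N :: nat) (k :: int). N \<ge> 1 \<and>
     infsum d (J) - (\<Sum>\<^sub>\<infinity>i\<in>K. B - d i) = real N * A + of_int k * B \<and>
     infsum d (J) \<ge> (real N + of_int k) * A"
proof -
  have I: "I = J \<union> K" and JK: "J \<inter> K = {}" by (auto simp: J_def K_def)
  obtain e where e: "orthonormal_basis I e" and de: "\<And>i. i \<in> I \<Longrightarrow> cinner (E (e i)) (e i) = complex_of_real (d i)"
    using diag unfolding has_diagonal_def by blast
  have on: "orthonormal_on I e" using e by (simp add: orthonormal_basis_iff)
  obtain P Q where P: "orth_projection P" and Q: "orth_projection Q" and R: "orth_projection (\<lambda>x. x - P x - Q x)"
    and EPQ: "\<And>x. E x = complex_of_real A *\<^sub>C P x + complex_of_real B *\<^sub>C Q x" and P0: "\<exists>x. P x \<noteq> 0"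
    using three_point_spectral_decomposition[OF pos spec AB] by blast
  \<comment> \<open>For each basis vector these are the convex weights on the eigenvalues
    \<open>A\<close>, \<open>B\<close> and \<open>0\<close>, with mean \<open>d i\<close>.\<close>
  define p q r where "p i = (norm (P (e i)))\<^sup>2" and "q i = (norm (Q (e i)))\<^sup>2"
    and "r i = (norm (e i - P (e i) - Q (e i)))\<^sup>2" for i
  have nn: "0 \<le> p i" "0 \<le> q i" "0 \<le> r i" for i by (simp_all add: p_def q_def r_def)
  have pqr: "p i + q i + r i = 1" if "i \<in> I" for i
  proof -
    have "complex_of_real (p i + q i + r i) = cinner (e i) (e i)"
      unfolding p_def q_def r_def of_real_add
        orth_projection_cinner[OF P, symmetric] orth_projection_cinner[OF Q, symmetric]
        orth_projection_cinner[OF R, symmetric] cinner_add_left[symmetric] by simp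
    also have "\<dots> = complex_of_real 1" using orthonormal_onD[OF on that that] by simp
    finally show ?thesis by (simp only: of_real_eq_iff)
  qed
  have dpq: "d i = A * p i + B * q i" if "i \<in> I" for i
  proof -
    have "complex_of_real (d i) = complex_of_real (A * p i + B * q i)"
      unfolding de[OF that, symmetric] EPQ cinner_add_left cinner_scaleC_left
        orth_projection_cinner[OF P] orth_projection_cinner[OF Q]
      by (simp add: p_def q_def)
    then show ?thesis by (simp only: of_real_eq_iff)
  qed
  \<comment> \<open>This form controls \<open>p\<close> and \<open>r\<close> where
    \<open>B - d i\<close> is summable, just as \<open>dpq\<close> controls \<open>p\<close> and
    \<open>q\<close> where \<open>d\<close> is.\<close>
  have Bd: "B - d i = (B - A) * p i + B * r i" if "i \<in> I" for i
  proof -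
    have "B - d i = B * (p i + q i + r i) - (A * p i + B * q i)" using pqr dpq that by simp
    then show ?thesis by (simp add: algebra_simps)
  qed
  have pJ: "p summable_on J" and qJ: "q summable_on J"
  proof -
    have "p i \<le> inverse A * d i \<and> q i \<le> inverse B * d i" if "i \<in> J" for i
      using dpq[of i] that I nn[of i] AB by (simp add: field_simps)
    then show "p summable_on J" "q summable_on J"
      using nn
      by (auto intro: summable_on_comparison_test[OF summable_on_cmult_right[OF sJ, of "inverse A"]]
          summable_on_comparison_test[OF summable_on_cmult_right[OF sJ, of "inverse B"]])
  qed
  have pK: "p summable_on K" and rK: "r summable_on K"
  proof -
    have "p i \<le> inverse (B - A) * (B - d i) \<and> r i \<le> inverse B * (B - d i)" if "i \<in> K" for i
      using Bd[of i] that I nn[of i] AB mult_right_mono[of A B "p i"] by (simp add: field_simps)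
    then show "p summable_on K" "r summable_on K"
      using nn
      by (auto intro: summable_on_comparison_test[OF summable_on_cmult_right[OF sK, of "inverse (B - A)"]]
          summable_on_comparison_test[OF summable_on_cmult_right[OF sK, of "inverse B"]])
  qed
  define Pj Qj Pk Rk where "Pj = infsum p J" and "Qj = infsum q J"
    and "Pk = infsum p K" and "Rk = infsum r K"
  have hs: "(p has_sum Pj) J" "(q has_sum Qj) J" "(p has_sum Pk) K" "(r has_sum Rk) K"
    using pJ qJ pK rK by (simp_all add: Pj_def Qj_def Pk_def Rk_def)
  have nn': "0 \<le> Qj" "0 \<le> Rk" using nn by (simp_all add: Qj_def Rk_def infsum_nonneg)
  have pI: "(p has_sum (Pj + Pk)) I" unfolding I by (rule has_sum_Un_disjoint[OF hs(1,3) JK])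
  have C: "infsum d J = A * Pj + B * Qj"
  proof (rule infsumI)
    have "((\<lambda>i. A * p i + B * q i) has_sum (A * Pj + B * Qj)) J"
      by (intro has_sum_add has_sum_cmult_right hs)
    then show "(d has_sum (A * Pj + B * Qj)) J"
      using dpq I by (subst has_sum_cong[where g = "\<lambda>i. A * p i + B * q i"]) auto
  qed
  have D: "(\<Sum>\<^sub>\<infinity>i\<in>K. B - d i) = (B - A) * Pk + B * Rk"
  proof (rule infsumI)
    have "((\<lambda>i. (B - A) * p i + B * r i) has_sum ((B - A) * Pk + B * Rk)) K"
      by (intro has_sum_add has_sum_cmult_right hs)
    then show "((\<lambda>i. B - d i) has_sum ((B - A) * Pk + B * Rk)) K"
      using Bd I by (subst has_sum_cong[where g = "\<lambda>i. (B - A) * p i + B * r i"]) auto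
  qed
  have "(\<Sum>\<^sub>\<infinity>i\<in>I. if i \<in> {} then p i - 1 else p i) \<in> \<int>"
    unfolding p_def
    by (rule projection_diagonal_defect_integer[OF P e]) (use pI in \<open>simp add: has_sum_iff p_def[abs_def]\<close>)
  then have "infsum p I \<in> \<int>" by simp
  \<comment> \<open>Integrality was applied with the empty set in place of \<open>K\<close>: the
    defect is then the full trace of \<open>P\<close>.\<close>
  then obtain n :: int where n: "Pj + Pk = of_int n" using infsumI[OF pI] by (auto elim: Ints_cases)
  have "0 < Pj + Pk"
  proof -
    have "\<exists>i\<in>I. P (e i) \<noteq> 0"
    proof (rule ccontr)
      assume "\<not> ?thesis"
      then have "P = (\<lambda>x. 0 *\<^sub>C x)"
        using P by (intro bounded_clinear_eqI[OF e _ bounded_clinear_scaleC]) (auto simp: orth_projection_def)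
      then show False using P0 by simp
    qed
    then obtain i where i: "i \<in> I" "0 < p i" by (auto simp: p_def)
    have "sum p {i} \<le> Pj + Pk"
      by (rule finite_sum_le_has_sum[OF pI]) (use i nn in auto)
    with i show ?thesis by simp
  qed
  then have n1: "n \<ge> 1" unfolding n by simp
  \<comment> \<open>On \<open>K\<close> the weights sum to 1, so \<open>q i - 1\<close> equals
    \<open>- p i - r i\<close>; the index is \<open>Qj - Pk - Rk\<close>.\<close>
  have "((\<lambda>i. if i \<in> K then q i - 1 else q i) has_sum (Qj + (- Pk - Rk))) I"
    unfolding I
  proof (rule has_sum_Un_disjoint[OF _ _ JK])
    show "((\<lambda>i. if i \<in> K then q i - 1 else q i) has_sum Qj) J"
      using hs(2) JK by (subst has_sum_cong[where g = q]) auto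
    have "((\<lambda>i. - p i + - r i) has_sum (- Pk + - Rk)) K"
      using hs(3,4) by (intro has_sum_add) (simp_all add: has_sum_uminus)
    then show "((\<lambda>i. if i \<in> K then q i - 1 else q i) has_sum (- Pk - Rk)) K"
      using pqr I by (subst has_sum_cong[where g = "\<lambda>i. - p i + - r i"]) (force simp: algebra_simps)+
  qed
  note qI = this
  have "((\<lambda>i. if i \<in> K then 1 - q i else q i) summable_on I)"
    unfolding I
  proof (rule summable_on_Un_disjoint[OF _ _ JK])
    show "(\<lambda>i. if i \<in> K then 1 - q i else q i) summable_on J"
      using qJ JK by (subst summable_on_cong[where g = q]) auto
    have "(\<lambda>i. p i + r i) summable_on K" by (rule summable_on_add[OF pK rK])
    then show "(\<lambda>i. if i \<in> K then 1 - q i else q i) summable_on K"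
      using pqr I by (subst summable_on_cong[where g = "\<lambda>i. p i + r i"]) (force simp: algebra_simps)+
  qed
  then have "(\<Sum>\<^sub>\<infinity>i\<in>I. if i \<in> K then q i - 1 else q i) \<in> \<int>"
    unfolding q_def by (rule projection_diagonal_defect_integer[OF Q e])
  then obtain k :: int where k: "Qj - Pk - Rk = of_int k"
    using infsumI[OF qI] by (auto elim!: Ints_cases simp: algebra_simps)
  have N: "real (nat n) = Pj + Pk" using n n1 by simp
  show ?thesis
  proof (intro exI conjI)
    show "1 \<le> nat n" using n1 by simp
    show "infsum d (J) - (\<Sum>\<^sub>\<infinity>i\<in>K. B - d i) = real (nat n) * A + of_int k * B"
      unfolding N C D k[symmetric] by (simp add: algebra_simps)
    \<comment> \<open>The slack in the inequality counts the weight on \<open>B\<close> over small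
      entries and the weight on \<open>0\<close> over large ones.\<close>
    have "(A * Pj + B * Qj) - (Pj + Pk + (Qj - Pk - Rk)) * A = (B - A) * Qj + A * Rk"
      by (simp add: algebra_simps)
    moreover have "0 \<le> (B - A) * Qj + A * Rk" using AB nn' by simp
    ultimately show "(real (nat n) + of_int k) * A \<le> infsum d (J)"
      unfolding N C k[symmetric] by linarith
  qed
qed

section \<open>Sufficiency\<close>

lemma infsum_ennreal_summable:
  assumes "f summable_on S" "\<And>i. i \<in> S \<Longrightarrow> 0 \<le> f i"
  shows "(\<Sum>\<^sub>\<infinity>i\<in>S. ennreal (f i)) = ennreal (infsum f S)"
proof -
  have "(\<Sum>\<^sub>\<infinity>i\<in>S. ennreal (f i)) = (SUP F\<in>{F. finite F \<and> F \<subseteq> S}. (\<Sum>i\<in>F. ennreal (f i)))"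
    by (rule nonneg_infsum_complete) simp
  also have "\<dots> = (SUP F\<in>{F. finite F \<and> F \<subseteq> S}. ennreal (sum f F))"
    using assms(2) by (intro SUP_cong refl sum_ennreal) auto
  finally show ?thesis using infsum_nonneg_is_SUPREMUM_ennreal[OF assms] by simp
qed

lemma infsum_ennreal_eq_top_iff:
  assumes "\<And>i. i \<in> S \<Longrightarrow> 0 \<le> f i"
  shows "(\<Sum>\<^sub>\<infinity>i\<in>S. ennreal (f i)) = \<infinity> \<longleftrightarrow> \<not> f summable_on S"
proof
  show "\<not> f summable_on S" if "(\<Sum>\<^sub>\<infinity>i\<in>S. ennreal (f i)) = \<infinity>"
    using infsum_ennreal_summable[of f S] assms that by auto
next
  assume ns: "\<not> f summable_on S"
  show "(\<Sum>\<^sub>\<infinity>i\<in>S. ennreal (f i)) = \<infinity>"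
  proof (rule ccontr)
    assume "(\<Sum>\<^sub>\<infinity>i\<in>S. ennreal (f i)) \<noteq> \<infinity>"
    then obtain c where c: "(\<Sum>\<^sub>\<infinity>i\<in>S. ennreal (f i)) = ennreal c" "0 \<le> c"
      by (metis ennreal_cases infinity_ennreal_def)
    have "sum f F \<le> c" if F: "finite F" "F \<subseteq> S" for F
    proof -
      have "ennreal (sum f F) = (\<Sum>i\<in>F. ennreal (f i))"
        using F assms by (intro sum_ennreal[symmetric]) auto
      also have "\<dots> \<le> (SUP F\<in>{F. finite F \<and> F \<subseteq> S}. (\<Sum>i\<in>F. ennreal (f i)))"
        using F by (intro SUP_upper) auto
      also have "\<dots> = ennreal c"
        unfolding c(1)[symmetric] by (rule nonneg_infsum_complete[symmetric]) simp
      finally show ?thesis using c(2) by (simp add: ennreal_le_iff)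
    qed
    then have "f summable_on S"
      using assms by (intro nonneg_bdd_above_summable_on) (auto intro!: bdd_aboveI)
    with ns show False by simp
  qed
qed

text \<open>From \<open>1 - x \<le> exp (- x)\<close>, the product is at most the exponential of
  minus a divergent sum.\<close>

lemma prod_tendsto_0_if_not_summable:
  fixes \<tau> x :: "nat \<Rightarrow> real"
  assumes \<tau>: "\<And>k. 0 \<le> \<tau> k" "\<And>k. \<tau> k \<le> 1 - x k" and x: "\<And>k. 0 \<le> x k" and ns: "\<not> summable x"
  shows "(\<lambda>m. \<Prod>k<m. \<tau> k) \<longlonglongrightarrow> 0"
proof (rule LIMSEQ_I)
  fix \<epsilon> :: real assume \<epsilon>: "0 < \<epsilon>"
  have le: "(\<Prod>k<m. \<tau> k) \<le> exp (- (\<Sum>k<m. x k))" for m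
  proof -
    have "(\<Prod>k<m. \<tau> k) \<le> (\<Prod>k<m. exp (- x k))"
    proof (rule prod_mono)
      fix k
      show "0 \<le> \<tau> k \<and> \<tau> k \<le> exp (- x k)"
        using \<tau>[of k] exp_ge_add_one_self[of "- x k"] by simp
    qed
    then show ?thesis by (simp add: exp_sum sum_negf[symmetric])
  qed
  have "\<exists>m. (\<Sum>k<m. x k) > - ln \<epsilon>"
  proof (rule ccontr)
    assume "\<not> ?thesis"
    then have "(\<Sum>k<m. x k) \<le> - ln \<epsilon>" for m by (simp add: not_less)
    then have "summable x" by (rule summableI_nonneg_bounded[OF x])
    with ns show False by simp
  qed
  then obtain m where m: "(\<Sum>k<m. x k) > - ln \<epsilon>" by blast
  have "norm ((\<Prod>k<n. \<tau> k) - 0) < \<epsilon>" if "n \<ge> m" for n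
  proof -
    have "(\<Sum>k<m. x k) \<le> (\<Sum>k<n. x k)"
      using that x by (intro sum_mono2) auto
    then have "exp (- (\<Sum>k<n. x k)) < exp (ln \<epsilon>)" using m by simp
    with le[of n] have "(\<Prod>k<n. \<tau> k) < \<epsilon>" using \<epsilon> by simp
    moreover have "0 \<le> (\<Prod>k<n. \<tau> k)" by (rule prod_nonneg) (use \<tau> in auto)
    ultimately show ?thesis by simp
  qed
  then show "\<exists>no. \<forall>n\<ge>no. norm ((\<Prod>k<n. \<tau> k) - 0) < \<epsilon>" by blast
qed

text \<open>
  The carried diagonal value stays in \<open>[0, B]\<close> if the next eigenvalue to be mixed in is chosen
  greedily, on the far side of the prescribed diagonal entry.
\<close>

primrec carry_value :: "real \<Rightarrow> real \<Rightarrow> (nat \<Rightarrow> real) \<Rightarrow> nat \<Rightarrow> real" where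
  "carry_value A B c 0 = A"
| "carry_value A B c (Suc n) =
     carry_value A B c n + (if carry_value A B c n \<le> c n then B else 0) - c n"

text \<open>The eigenvalue \<open>A\<close> is used exactly once, as the first carried value; all
  others are chosen from \<open>0\<close> and \<open>B\<close>. Divergence acts twice: it makes the
  rotated system complete, and it forces both \<open>0\<close> and \<open>B\<close> to be chosen, so
  that the spectrum is the full set.\<close>

lemma three_point_operator_exists_divergent:
  fixes I :: "'i set" and e :: "'i \<Rightarrow> 'h :: complex_hilbert_space"
  assumes AB: "0 < A" "A < B" and count: "countable I" and e: "orthonormal_basis I e"
    and range: "\<And>i. i \<in> I \<Longrightarrow> 0 \<le> d i \<and> d i \<le> B"
    and ns: "\<not> (\<lambda>i. min (d i) (B - d i)) summable_on I"
  shows "\<exists>E :: 'h \<Rightarrow> 'h. positive_operator E \<and> has_diagonal E I d \<and>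
           op_spectrum E = {0, complex_of_real A, complex_of_real B}"
proof -
  have inf: "infinite I" using ns by auto
  define s where "s = from_nat_into I"
  have s: "bij_betw s UNIV I" unfolding s_def by (rule bij_betw_from_nat_into[OF count inf])
  have injs: "inj s" and sI: "\<And>n. s n \<in> I" and rs: "range s = I" using s by (auto simp: bij_betw_def)
  define c where "c n = d (s n)" for n
  have c: "0 \<le> c n" "c n \<le> B" for n using range[OF sI] by (simp_all add: c_def)
  have nsc: "\<not> summable (\<lambda>n. min (c n) (B - c n))"
  proof
    assume "summable (\<lambda>n. min (c n) (B - c n))"
    then have "(\<lambda>n. min (c n) (B - c n)) summable_on UNIV"
      by (rule summable_nonneg_imp_summable_on) (use c in \<open>simp add: min_def\<close>)
    then show False
      using ns summable_on_reindex_bij_betw[OF s, of "\<lambda>i. min (d i) (B - d i)"] by (simp add: c_def)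
  qed
  define r where "r = carry_value A B c"
  define l where "l n = (if r n \<le> c n then B else 0)" for n
  have rS: "r (Suc n) = r n + l n - c n" for n by (simp add: r_def l_def)
  have r: "0 \<le> r n \<and> r n \<le> B" for n
  proof (induction n)
    case 0
    then show ?case using AB by (simp add: r_def)
  next
    case (Suc n)
    then show ?case using c[of n] by (auto simp: rS l_def)
  qed
  \<comment> \<open>If only \<open>0\<close> were mixed in, the carried value would pay for all
    entries: the partial sums of \<open>c\<close> would be at most \<open>A\<close>. The next fact
    treats the defects \<open>B - c n\<close> in the same way.\<close>
  have lB: "\<exists>n. l n = B"
  proof (rule ccontr)
    assume no: "\<not> ?thesis"
    have "l n = B \<or> l n = 0" for n by (simp add: l_def)
    with no have l0: "l n = 0" for n by blast
    have "(\<Sum>k<n. c k) = A - r n" for n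
      by (induction n) (simp_all add: rS l0, simp add: r_def)
    then have "summable c"
      using r c by (intro summableI_nonneg_bounded[where x = A]) auto
    then have "summable (\<lambda>n. min (c n) (B - c n))"
      by (rule summable_comparison_test'[where N = 0]) (use c in \<open>simp add: min_def\<close>)
    with nsc show False by simp
  qed
  have l0: "\<exists>n. l n = 0"
  proof (rule ccontr)
    assume no: "\<not> ?thesis"
    have "l n = B \<or> l n = 0" for n by (simp add: l_def)
    with no have lB: "l n = B" for n by blast
    have "(\<Sum>k<n. B - c k) = r n - A" for n
      by (induction n) (simp_all add: rS lB, simp add: r_def)
    moreover have "r n - A \<le> B" for n using r[of n] AB by simp
    ultimately have "summable (\<lambda>n. B - c n)"
      using c by (intro summableI_nonneg_bounded[where x = B]) auto
    then have "summable (\<lambda>n. min (c n) (B - c n))"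
      by (rule summable_comparison_test'[where N = 0]) (use c in \<open>simp add: min_def\<close>)
    with nsc show False by simp
  qed
  \<comment> \<open>The shift by one reflects that the \<open>n\<close>-th rotation takes its fresh
    eigenvector at \<open>s (Suc n)\<close>, while \<open>s 0\<close> starts the chain.\<close>
  define \<mu> where "\<mu> i = (case inv_into UNIV s i of 0 \<Rightarrow> A | Suc n \<Rightarrow> l n)" for i
  have \<mu>0: "\<mu> (s 0) = A" and \<mu>S: "\<mu> (s (Suc n)) = l n" for n
    using injs by (simp_all add: \<mu>_def)
  have "\<mu> ` I = range (\<lambda>n. \<mu> (s n))" unfolding rs[symmetric] by (rule image_image)
  also have "\<dots> = insert A (range l)"
  proof (intro equalityI subsetI)
    fix x assume "x \<in> range (\<lambda>n. \<mu> (s n))"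
    then obtain n where "x = \<mu> (s n)" by blast
    then show "x \<in> insert A (range l)" by (cases n) (simp_all add: \<mu>0 \<mu>S)
  next
    fix x assume "x \<in> insert A (range l)"
    then consider "x = \<mu> (s 0)" | n where "x = \<mu> (s (Suc n))" by (auto simp: \<mu>0 \<mu>S)
    then show "x \<in> range (\<lambda>n. \<mu> (s n))" by cases auto
  qed
  also have "\<dots> = {0, A, B}"
  proof -
    have "range l = {0, B}"
    proof (intro equalityI subsetI)
      show "x \<in> {0, B}" if "x \<in> range l" for x using that by (auto simp: l_def)
      show "x \<in> range l" if "x \<in> {0, B}" for x using that lB l0 by (auto intro: range_eqI[OF sym])
    qed
    then show ?thesis by auto
  qed
  finally have \<mu>I: "\<mu> ` I = {0, A, B}" .
  obtain E :: "'h \<Rightarrow> 'h" where E: "positive_operator E" "op_spectrum E = complex_of_real ` \<mu> ` I"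
    "\<And>i. i \<in> I \<Longrightarrow> E (e i) = complex_of_real (\<mu> i) *\<^sub>C e i"
  proof -
    have "finite (\<mu> ` I)" by (simp add: \<mu>I)
    moreover have "0 \<le> \<mu> i" if "i \<in> I" for i
    proof -
      have "\<mu> i \<in> {0, A, B}" using that unfolding \<mu>I[symmetric] by (rule imageI)
      then show ?thesis using AB by auto
    qed
    ultimately show ?thesis using diagonal_operator_exists[OF e count inf, of \<mu>] that by blast
  qed
  \<comment> \<open>Solves \<open>c n = (1 - \<tau> n) * r n + \<tau> n * l n\<close>. The
    denominator vanishes only if \<open>r n = c n = l n = B\<close>, where the default quotient 0 is
    also a solution.\<close>
  define \<tau> where "\<tau> n = (c n - r n) / (l n - r n)" for n
  have cr: "c n - r n = \<tau> n * (l n - r n)" for n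
  proof (cases "l n = r n")
    case True
    then have "c n = r n" using c[of n] r[of n] AB by (auto simp: l_def split: if_splits)
    then show ?thesis by (simp add: True)
  qed (simp add: \<tau>_def)
  have \<tau>0: "0 \<le> \<tau> n" for n
  proof (cases "r n \<le> c n")
    case True
    then show ?thesis using r[of n] by (simp add: \<tau>_def l_def)
  next
    case False
    then have "(c n - r n) / r n \<le> 0" using r[of n] by (intro divide_nonpos_nonneg) auto
    then show ?thesis using False by (simp add: \<tau>_def l_def)
  qed
  \<comment> \<open>Away from \<open>r n = B\<close>, where \<open>\<tau> n = 0\<close>, the number
    \<open>1 - \<tau> n\<close> is \<open>(B - c n) / (B - r n)\<close> or \<open>c n / r n\<close>,
    and both denominators are at most \<open>B\<close>.\<close>
  have \<tau>x: "\<tau> n \<le> 1 - min (c n) (B - c n) / B" for n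
  proof (cases "r n \<le> c n")
    case True
    show ?thesis
    proof (cases "r n = B")
      case True
      with \<open>r n \<le> c n\<close> have "\<tau> n = 0" by (simp add: \<tau>_def l_def)
      moreover have "min (c n) (B - c n) / B \<le> 1" using c[of n] AB by (simp add: divide_simps min_def)
      ultimately show ?thesis by simp
    next
      case False
      then have rB: "0 < B - r n" using r[of n] by simp
      have "min (c n) (B - c n) / B \<le> (B - c n) / B" using AB by (intro divide_right_mono) auto
      also have "\<dots> \<le> (B - c n) / (B - r n)" using rB r[of n] c[of n] AB by (intro divide_left_mono) auto
      also have "\<dots> = 1 - \<tau> n" using True rB by (simp add: \<tau>_def l_def field_simps)
      finally show ?thesis by simp
    qed
  next
    case False
    have r0: "0 < r n" using False c[of n] by simp
    have "min (c n) (B - c n) / B \<le> c n / B" using AB by (intro divide_right_mono) auto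
    also have "\<dots> \<le> c n / r n" using r0 r[of n] c[of n] AB by (intro divide_left_mono) auto
    also have "\<dots> = 1 - \<tau> n" using False r0 by (simp add: \<tau>_def l_def field_simps)
    finally show ?thesis by simp
  qed
  have x0: "0 \<le> min (c n) (B - c n) / B" for n using c[of n] AB by simp
  have "\<exists>h. orthonormal_basis I h \<and> (\<forall>i. i \<notin> range s \<longrightarrow> h i = e i) \<and>
     (\<forall>n. cinner (E (h (s n))) (h (s n)) = complex_of_real ((1 - \<tau> n) * r n + \<tau> n * l n))"
  proof (rule orthonormal_basis_carry[OF e E(1) injs])
    show "range s \<subseteq> I" using rs by simp
    show "E (e (s (Suc n))) = complex_of_real (l n) *\<^sub>C e (s (Suc n))" for n
      using E(3)[OF sI] by (simp add: \<mu>S)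
    show "cinner (E (e (s 0))) (e (s 0)) = complex_of_real (r 0)"
      using e E(3)[OF sI] sI by (simp add: \<mu>0 r_def cinner_scaleC_left orthonormal_basis_def)
    show "0 \<le> \<tau> n" for n by (rule \<tau>0)
    show "\<tau> n \<le> 1" for n using \<tau>x[of n] x0[of n] by linarith
    show "r (Suc n) = \<tau> n * r n + (1 - \<tau> n) * l n" for n
      using cr[of n] by (simp add: rS algebra_simps)
    show "(\<lambda>m. \<Prod>k<m. \<tau> (n + k)) \<longlonglongrightarrow> 0" for n
    proof (rule prod_tendsto_0_if_not_summable[where x = "\<lambda>k. min (c (n + k)) (B - c (n + k)) / B"])
      show "\<not> summable (\<lambda>k. min (c (n + k)) (B - c (n + k)) / B)"
      proof
        assume "summable (\<lambda>k. min (c (n + k)) (B - c (n + k)) / B)"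
        then have "summable (\<lambda>k. min (c (n + k)) (B - c (n + k)))"
          using AB summable_divide_iff[of "\<lambda>k. min (c (n + k)) (B - c (n + k))" B] by simp
        then show False
          using nsc summable_iff_shift[of "\<lambda>k. min (c k) (B - c k)" n] by (simp add: add.commute)
      qed
    qed (use \<tau>0 \<tau>x x0 in auto)
  qed
  then obtain h where h: "orthonormal_basis I h"
    "\<And>n. cinner (E (h (s n))) (h (s n)) = complex_of_real ((1 - \<tau> n) * r n + \<tau> n * l n)" by blast
  have "cinner (E (h i)) (h i) = complex_of_real (d i)" if iI: "i \<in> I" for i
  proof -
    obtain n where i: "i = s n" using iI unfolding rs[symmetric] by blast
    have "(1 - \<tau> n) * r n + \<tau> n * l n = c n" using cr[of n] by (simp add: algebra_simps)
    then show ?thesis using h(2)[of n] by (simp add: i c_def)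
  qed
  with h(1) have "has_diagonal E I d" unfolding has_diagonal_def by blast
  with E \<mu>I show ?thesis by (intro exI[of _ E]) simp
qed

text \<open>The carried value is \<open>\<kappa>\<close> plus \<open>\<sigma>\<close> times the tail
  sum still to be distributed, and each rotation settles one term. With ratios of consecutive tails
  as weights, the products telescope to a quotient of tails and tend to 0. The sign
  \<open>\<sigma>\<close> lets one lemma treat small entries around \<open>0\<close> and defects
  below \<open>B\<close>.\<close>

lemma orthonormal_basis_tail_spread:
  fixes h :: "'i \<Rightarrow> 'h :: complex_inner"
  assumes h: "orthonormal_basis I h" and E: "positive_operator E"
    and S: "S \<subseteq> I" "countable S" "infinite S" and j: "j \<in> I" "j \<notin> S"
    and eig: "\<And>i. i \<in> S \<Longrightarrow> E (h i) = complex_of_real \<kappa> *\<^sub>C h i"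
    and f: "\<And>i. i \<in> insert j S \<Longrightarrow> 0 \<le> f i" "f summable_on insert j S"
    and dj: "cinner (E (h j)) (h j) = complex_of_real (\<kappa> + \<sigma> * infsum f (insert j S))"
  shows "\<exists>h'. orthonormal_basis I h' \<and> (\<forall>i. i \<notin> insert j S \<longrightarrow> h' i = h i) \<and>
     (\<forall>i\<in>insert j S. cinner (E (h' i)) (h' i) = complex_of_real (\<kappa> + \<sigma> * f i))"
proof -
  define s where "s n = (case n of 0 \<Rightarrow> j | Suc m \<Rightarrow> from_nat_into S m)" for n
  have b: "bij_betw (from_nat_into S) UNIV S" by (rule bij_betw_from_nat_into[OF S(2,3)])
  have fS: "from_nat_into S m \<in> S" for m using b by (auto simp: bij_betw_def)
  have s0: "s 0 = j" and sS: "s (Suc m) = from_nat_into S m" for m by (simp_all add: s_def)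
  have inj: "inj s"
  proof (rule injI)
    fix m n assume "s m = s n"
    then show "m = n"
      using fS j(2) b by (cases m; cases n) (auto simp: s0 sS bij_betw_def inj_eq)
  qed
  have rng: "range s = insert j S"
  proof (intro equalityI subsetI)
    fix i assume "i \<in> range s"
    then obtain n where "i = s n" by blast
    then show "i \<in> insert j S" using fS by (cases n) (auto simp: s0 sS)
  next
    fix i assume "i \<in> insert j S"
    then consider "i = s 0" | m where "i = s (Suc m)" using b by (auto simp: s0 sS bij_betw_def)
    then show "i \<in> range s" by cases auto
  qed
  then have bs: "bij_betw s UNIV (insert j S)" using inj by (simp add: bij_betw_def)
  have sin: "s n \<in> insert j S" for n using rng by blast
  define g where "g n = f (s n)" for n
  have g0: "0 \<le> g n" for n using f(1)[OF sin] by (simp add: g_def)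
  have gU: "g summable_on UNIV"
    unfolding g_def using summable_on_reindex_bij_betw[OF bs, of f] f(2) by simp
  have g: "summable g" by (rule summable_on_imp_summable[OF gU])
  define R where "R n = (\<Sum>k. g (k + n))" for n
  have R0: "R 0 = infsum f (insert j S)"
  proof -
    have "g sums infsum g UNIV" using gU by (intro has_sum_imp_sums) simp
    then have "R 0 = infsum g UNIV" by (simp add: R_def sums_iff)
    also have "\<dots> = infsum f (insert j S)" unfolding g_def by (rule infsum_reindex_bij_betw[OF bs])
    finally show ?thesis .
  qed
  have sg: "summable (\<lambda>k. g (k + n))" for n using g by (simp add: summable_iff_shift)
  have Rnn: "0 \<le> R n" for n unfolding R_def by (rule suminf_nonneg[OF sg]) (rule g0)
  have RS: "R n = g n + R (Suc n)" for n
    using suminf_split_head[OF sg[of n]] by (simp add: R_def)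
  have Rlim: "R \<longlonglongrightarrow> 0" unfolding R_def by (rule suminf_exist_split2[OF g])
  \<comment> \<open>If \<open>R n = 0\<close>, all later tails vanish too, so the default quotient 0
    still satisfies the recursion and makes the products vanish.\<close>
  define \<tau> where "\<tau> n = R (Suc n) / R n" for n
  have \<tau>R: "R (Suc n) = \<tau> n * R n" for n
    using RS[of n] g0[of n] Rnn[of "Suc n"] by (cases "R n = 0") (auto simp: \<tau>_def)
  have \<tau>: "0 \<le> \<tau> n" "\<tau> n \<le> 1" for n
  proof -
    show "0 \<le> \<tau> n" using Rnn by (simp add: \<tau>_def)
    show "\<tau> n \<le> 1"
      using RS[of n] g0[of n] Rnn[of n] by (cases "R n = 0") (auto simp: \<tau>_def divide_simps)
  qed
  have "\<exists>h'. orthonormal_basis I h' \<and> (\<forall>i. i \<notin> range s \<longrightarrow> h' i = h i) \<and>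
     (\<forall>n. cinner (E (h' (s n))) (h' (s n)) = complex_of_real ((1 - \<tau> n) * (\<kappa> + \<sigma> * R n) + \<tau> n * \<kappa>))"
  proof (rule orthonormal_basis_carry[OF h E inj])
    show "range s \<subseteq> I" unfolding rng using S j by auto
    show "E (h (s (Suc n))) = complex_of_real \<kappa> *\<^sub>C h (s (Suc n))" for n
      unfolding sS by (rule eig[OF fS])
    show "cinner (E (h (s 0))) (h (s 0)) = complex_of_real (\<kappa> + \<sigma> * R 0)"
      unfolding s0 R0 by (rule dj)
    show "\<kappa> + \<sigma> * R (Suc n) = \<tau> n * (\<kappa> + \<sigma> * R n) + (1 - \<tau> n) * \<kappa>" for n
      unfolding \<tau>R by (simp add: algebra_simps)
    show "(\<lambda>m. \<Prod>k<m. \<tau> (n + k)) \<longlonglongrightarrow> 0" for n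
    proof (cases "R n = 0")
      case True
      then have "\<tau> n = 0" by (simp add: \<tau>_def)
      then have "(\<Prod>k<m. \<tau> (n + k)) = 0" if "m \<ge> 1" for m
        using that by (intro prod_zero) (auto intro!: bexI[of _ 0])
      then show ?thesis
        by (intro tendsto_eventually) (auto simp: eventually_sequentially intro!: exI[of _ 1])
    next
      case False
      have "(\<Prod>k<m. \<tau> (n + k)) * R n = R (m + n)" for m
        by (induction m) (use \<tau>R in \<open>simp_all add: mult_ac add.commute\<close>)
      then have "(\<Prod>k<m. \<tau> (n + k)) = R (m + n) / R n" for m
        using False by (simp add: field_simps)
      moreover have "(\<lambda>m. R (m + n) / R n) \<longlonglongrightarrow> 0 / R n"
        by (rule tendsto_divide[OF LIMSEQ_ignore_initial_segment[OF Rlim] tendsto_const False])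
      ultimately show ?thesis by simp
    qed
  qed (use \<tau> in auto)
  then obtain h' where h': "orthonormal_basis I h'" "\<forall>i. i \<notin> range s \<longrightarrow> h' i = h i"
    "\<And>n. cinner (E (h' (s n))) (h' (s n)) = complex_of_real ((1 - \<tau> n) * (\<kappa> + \<sigma> * R n) + \<tau> n * \<kappa>)"
    by blast
  have "cinner (E (h' i)) (h' i) = complex_of_real (\<kappa> + \<sigma> * f i)" if iS: "i \<in> insert j S" for i
  proof -
    obtain n where i: "i = s n" using iS unfolding rng[symmetric] by blast
    have "(1 - \<tau> n) * (\<kappa> + \<sigma> * R n) + \<tau> n * \<kappa> = \<kappa> + \<sigma> * (R n - R (Suc n))"
      unfolding \<tau>R by (simp add: algebra_simps)
    also have "R n - R (Suc n) = f i" using RS[of n] by (simp add: g_def i)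
    finally show ?thesis using h'(3)[of n] by (simp add: i)
  qed
  then show ?thesis using h'(1,2) rng by (intro exI[of _ h']) simp
qed

text \<open>The index \<open>j\<close>, available because \<open>S\<close> is infinite, is the place
  where the whole tail over \<open>S - F\<close> will be collected.\<close>

lemma small_tail:
  fixes f :: "'i \<Rightarrow> real"
  assumes "f summable_on S" "infinite S" "\<epsilon> > 0"
  shows "\<exists>F j. finite F \<and> F \<subseteq> S \<and> j \<in> S - F \<and> infsum f (S - F) \<le> \<epsilon>"
proof -
  obtain F where F: "finite F" "F \<subseteq> S" "dist (sum f F) (infsum f S) \<le> \<epsilon>"
    using infsum_finite_approximation[OF assms(1,3)] by blast
  have "infsum f (S - F) = infsum f S - sum f F"
    using infsum_Diff[OF assms(1) _ F(2)] F(1) by simp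
  then have "infsum f (S - F) \<le> \<epsilon>" using F(3) by (simp add: dist_real_def)
  moreover have "S - F \<noteq> {}"
    using Diff_infinite_finite[OF F(1) assms(2)] by (metis finite.emptyI)
  then obtain j where "j \<in> S - F" by blast
  ultimately show ?thesis using F by blast
qed

text \<open>The operator stays fixed while basis vectors over \<open>F\<close> are rotated; those
  outside remain eigenvectors, as the later spreading of the tails demands. The values
  \<open>0\<close> and \<open>B\<close> already occur outside \<open>F\<close>, so the finite
  problem has to supply only the eigenvalue \<open>A\<close>.\<close>

lemma three_point_finite_rearrangement:
  fixes I :: "'i set" and e :: "'i \<Rightarrow> 'h :: complex_hilbert_space"
  assumes AB: "0 < A" "A < B" and count: "countable I" and e: "orthonormal_basis I e"
    and F: "finite F" "F \<subseteq> I"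
    and off: "\<And>i. i \<in> I - F \<Longrightarrow> d i \<in> {0, B}" "\<exists>i\<in>I - F. d i = 0" "\<exists>i\<in>I - F. d i = B" "infinite I"
    and range: "\<And>i. i \<in> F \<Longrightarrow> 0 \<le> d i \<and> d i \<le> B"
    and tot: "(\<Sum>k\<in>F. d k) = real N * A + of_int b * B" "N \<ge> 1"
    and up: "(\<Sum>k\<in>F. max (d k - A) 0) \<le> of_int b * (B - A)"
  shows "\<exists>(E :: 'h \<Rightarrow> 'h) h. positive_operator E \<and> op_spectrum E = {0, complex_of_real A, complex_of_real B} \<and>
     orthonormal_basis I h \<and> (\<forall>i\<in>I - F. E (h i) = complex_of_real (d i) *\<^sub>C h i) \<and>
     (\<forall>i\<in>I. cinner (E (h i)) (h i) = complex_of_real (d i))"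
proof -
  define P where "P d \<longleftrightarrow> (\<exists>(E :: 'h \<Rightarrow> 'h) h. positive_operator E \<and>
     op_spectrum E = {0, complex_of_real A, complex_of_real B} \<and>
     orthonormal_basis I h \<and> (\<forall>i\<in>I - F. E (h i) = complex_of_real (d i) *\<^sub>C h i) \<and>
     (\<forall>i\<in>I. cinner (E (h i)) (h i) = complex_of_real (d i)))" for d
  have base: "P d'" if d': "\<And>i. i \<in> F \<Longrightarrow> d' i \<in> {0, A, B}" "\<exists>i\<in>F. d' i = A" "\<And>i. i \<notin> F \<Longrightarrow> d' i = d i" for d'
  proof -
    have im: "d' ` I = {0, A, B}"
    proof (intro equalityI subsetI)
      fix x assume "x \<in> d' ` I"
      then obtain i where "i \<in> I" "x = d' i" by blast
      then show "x \<in> {0, A, B}" using d'(1)[of i] d'(3)[of i] off(1)[of i] by (cases "i \<in> F") auto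
    next
      fix x assume "x \<in> {0, A, B}"
      then consider "x = 0" | "x = A" | "x = B" by blast
      then show "x \<in> d' ` I"
      proof cases
        case 1
        then show ?thesis using off(2) d'(3) by (metis DiffE image_eqI)
      next
        case 2
        then show ?thesis using d'(2) F(2) by auto
      next
        case 3
        then show ?thesis using off(3) d'(3) by (metis DiffE image_eqI)
      qed
    qed
    have nn: "0 \<le> d' i" if "i \<in> I" for i
    proof -
      have "d' i \<in> {0, A, B}" using im that by blast
      then show ?thesis using AB by auto
    qed
    have "finite (d' ` I)" by (simp add: im)
    from diagonal_operator_exists[OF e count off(4) this nn]
    obtain E :: "'h \<Rightarrow> 'h" where E: "positive_operator E" "op_spectrum E = complex_of_real ` d' ` I"
      "\<And>i. i \<in> I \<Longrightarrow> E (e i) = complex_of_real (d' i) *\<^sub>C e i"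
      by blast
    have "cinner (E (e i)) (e i) = complex_of_real (d' i)" if "i \<in> I" for i
      using E(3)[OF that] e that by (simp add: cinner_scaleC_left orthonormal_basis_def)
    then show ?thesis unfolding P_def using E e im by (intro exI[of _ E] exI[of _ e]) auto
  qed
  have step: "P d'" if ij: "i \<in> F" "j \<in> F" "i \<noteq> j" "d' i \<le> d' j" "0 \<le> \<delta>" and Ps: "P (spread d' i j \<delta>)"
    for d' i j \<delta>
  proof -
    let ?x = "d' i - \<delta>" and ?y = "d' j + \<delta>"
    obtain E :: "'h \<Rightarrow> 'h" and h where E: "positive_operator E"
      "op_spectrum E = {0, complex_of_real A, complex_of_real B}" "orthonormal_basis I h"
      "\<And>k. k \<in> I - F \<Longrightarrow> E (h k) = complex_of_real (spread d' i j \<delta> k) *\<^sub>C h k"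
      "\<And>k. k \<in> I \<Longrightarrow> cinner (E (h k)) (h k) = complex_of_real (spread d' i j \<delta> k)"
      using Ps unfolding P_def by blast
    have ijI: "i \<in> I" "j \<in> I" using ij F by auto
    \<comment> \<open>The weight that averages \<open>?x\<close> and \<open>?y\<close> back to
      \<open>d' i\<close>; the other entry follows because the sum is preserved. Equality of
      \<open>?x\<close> and \<open>?y\<close> forces \<open>\<delta> = 0\<close>, and then the
      weight 1 is correct.\<close>
    define t where "t = (if ?y = ?x then 1 else (?y - d' i) / (?y - ?x))"
    have t: "0 \<le> t" "t \<le> 1" using ij by (auto simp: t_def divide_simps)
    have ti: "t * ?x + (1 - t) * ?y = d' i"
    proof (cases "?y = ?x")
      case True
      then show ?thesis using ij by (simp add: t_def)
    next
      case False
      then have "t * (?y - ?x) = ?y - d' i" unfolding t_def by simp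
      then show ?thesis by (simp add: algebra_simps)
    qed
    then have tj: "(1 - t) * ?x + t * ?y = d' j" by (simp add: algebra_simps)
    have "cinner (E (h i)) (h i) = complex_of_real ?x" "cinner (E (h j)) (h j) = complex_of_real ?y"
      using E(5)[OF ijI(1)] E(5)[OF ijI(2)] ij(3) by simp_all
    from orthonormal_basis_rotate[OF E(3,1) ijI ij(3) t this]
    obtain h' where h': "orthonormal_basis I h'" "\<And>k. k \<noteq> i \<Longrightarrow> k \<noteq> j \<Longrightarrow> h' k = h k"
      "cinner (E (h' i)) (h' i) = complex_of_real (d' i)"
      "cinner (E (h' j)) (h' j) = complex_of_real (d' j)"
      unfolding ti tj by blast
    have "E (h' k) = complex_of_real (d' k) *\<^sub>C h' k" if "k \<in> I - F" for k
    proof -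
      have "k \<noteq> i" "k \<noteq> j" using that ij by auto
      then show ?thesis using E(4)[OF that] h'(2) by simp
    qed
    moreover have "cinner (E (h' k)) (h' k) = complex_of_real (d' k)" if "k \<in> I" for k
      using E(5)[OF that] h' by (cases "k = i"; cases "k = j") auto
    ultimately show ?thesis unfolding P_def using E h'(1) by (intro exI[of _ E] exI[of _ h']) auto
  qed
  have "P d"
    by (rule spread_induct[where P = P and d0 = d, OF AB F(1) base step range refl tot up]; assumption)
  then show ?thesis unfolding P_def .
qed

text \<open>
  The tail of the small entries is collected in one of them, the others being replaced by 0, and
  likewise for the defects \<open>B - d i\<close> of the large ones. The resulting finite problem is solved by
  averaging steps, and the two tails are then spread out again.
\<close>

lemma three_point_operator_exists_convergent:
  fixes I :: "'i set" and e :: "'i \<Rightarrow> 'h :: complex_hilbert_space" and d :: "'i \<Rightarrow> real" and A B :: real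
  defines "J \<equiv> {i \<in> I. d i < A}" and "K \<equiv> {i \<in> I. A \<le> d i}"
  assumes AB: "0 < A" "A < B" and count: "countable I" and e: "orthonormal_basis I e"
    and range: "\<And>i. i \<in> I \<Longrightarrow> 0 \<le> d i \<and> d i \<le> B"
    and inf: "infinite J" "infinite K"
    and summ: "d summable_on J" "(\<lambda>i. B - d i) summable_on K"
    and N: "N \<ge> 1" and CD: "infsum d J - (\<Sum>\<^sub>\<infinity>i\<in>K. B - d i) = real N * A + of_int k * B"
    and C: "infsum d J \<ge> (real N + of_int k) * A"
  shows "\<exists>E :: 'h \<Rightarrow> 'h. positive_operator E \<and> has_diagonal E I d \<and>
           op_spectrum E = {0, complex_of_real A, complex_of_real B}"
proof -
  let ?f = "\<lambda>i. B - d i"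
  have JI: "J \<subseteq> I" and KI: "K \<subseteq> I" and JK: "J \<inter> K = {}" and I: "I = J \<union> K" by (auto simp: J_def K_def)
  \<comment> \<open>The bounds \<open>A / 2\<close> and \<open>B - A\<close> keep the collected
    entries on their sides of the threshold: \<open>c\<close> stays below \<open>A\<close>, and
    \<open>B - D\<close> is at least \<open>A\<close>.\<close>
  obtain F1 j where F1: "finite F1" "F1 \<subseteq> J" "j \<in> J - F1" "infsum d (J - F1) \<le> A / 2"
    using small_tail[OF summ(1) inf(1), of "A / 2"] AB by auto
  obtain F2 k0 where F2: "finite F2" "F2 \<subseteq> K" "k0 \<in> K - F2" "infsum ?f (K - F2) \<le> B - A"
    using small_tail[OF summ(2) inf(2), of "B - A"] AB by auto
  define J1 K1 where "J1 = J - insert j F1" and "K1 = K - insert k0 F2"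
  have ins: "insert j J1 = J - F1" "insert k0 K1 = K - F2" using F1 F2 by (auto simp: J1_def K1_def)
  have inf1: "infinite J1" "infinite K1"
    unfolding J1_def K1_def using inf F1 F2 by (auto intro: Diff_infinite_finite)
  define c D where "c = infsum d (J - F1)" and "D = infsum ?f (K - F2)"
  have c0: "0 \<le> c" unfolding c_def by (rule infsum_nonneg) (use range JI in auto)
  have D0: "0 \<le> D" unfolding D_def by (rule infsum_nonneg) (use range KI in auto)
  have cs: "infsum d J = sum d F1 + c"
    using infsum_Diff[OF summ(1) _ F1(2)] F1(1) by (simp add: c_def)
  have Ds: "infsum ?f K = sum ?f F2 + D"
    using infsum_Diff[OF summ(2) _ F2(2)] F2(1) by (simp add: D_def)
  define F where "F = insert j F1 \<union> insert k0 F2"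
  have disj: "insert j F1 \<inter> insert k0 F2 = {}" using F1 F2 JK by auto
  have finF: "finite F" "F \<subseteq> I" using F1 F2 JI KI by (auto simp: F_def)
  have IF: "I - F = J1 \<union> K1" using I F1 F2 JK by (auto simp: F_def J1_def K1_def)
  define d' where "d' i = (if i = j then c else if i = k0 then B - D else if i \<in> F then d i
      else if i \<in> J then 0 else B)" for i
  have jk: "j \<noteq> k0" using F1 F2 JK by auto
  have d'j: "d' j = c" and d'k: "d' k0 = B - D" using jk by (simp_all add: d'_def)
  have d'F1: "d' i = d i" if "i \<in> F1" for i using that F1 F2 JK by (auto simp: d'_def F_def)
  have d'F2: "d' i = d i" if "i \<in> F2" for i using that F1 F2 JK by (auto simp: d'_def F_def)
  have d'J: "d' i = 0" if "i \<in> J1" for i using that F1 F2 JK by (auto simp: d'_def F_def J1_def)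
  have d'K: "d' i = B" if "i \<in> K1" for i using that F1 F2 JK by (auto simp: d'_def F_def K1_def)
  have sumF: "(\<Sum>i\<in>F. \<phi> (d' i)) = (\<phi> c + (\<Sum>i\<in>F1. \<phi> (d i))) + (\<phi> (B - D) + (\<Sum>i\<in>F2. \<phi> (d i)))"
    for \<phi> :: "real \<Rightarrow> real"
  proof -
    have "(\<Sum>i\<in>F. \<phi> (d' i)) = (\<Sum>i\<in>insert j F1. \<phi> (d' i)) + (\<Sum>i\<in>insert k0 F2. \<phi> (d' i))"
      unfolding F_def using disj F1 F2 by (intro sum.union_disjoint) auto
    also have "(\<Sum>i\<in>insert j F1. \<phi> (d' i)) = \<phi> c + (\<Sum>i\<in>F1. \<phi> (d i))"
      using F1 by (simp add: d'j d'F1 cong: sum.cong)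
    also have "(\<Sum>i\<in>insert k0 F2. \<phi> (d' i)) = \<phi> (B - D) + (\<Sum>i\<in>F2. \<phi> (d i))"
      using F2 by (simp add: d'k d'F2 cong: sum.cong)
    finally show ?thesis .
  qed
  \<comment> \<open>Each entry on the large side of \<open>F\<close>, that is \<open>F2\<close> and
    \<open>k0\<close>, is \<open>B\<close> minus its defect, which adds \<open>card F2 + 1\<close>
    copies of \<open>B\<close> to the \<open>k\<close> in \<open>C - D\<close>.\<close>
  define b where "b = k + int (card F2) + 1"
  have sf: "sum ?f F2 = real (card F2) * B - sum d F2" by (simp add: sum_subtractf)
  have tot: "(\<Sum>i\<in>F. d' i) = real N * A + of_int b * B"
    using sumF[of "\<lambda>x. x"] CD cs Ds sf by (simp add: b_def algebra_simps)
  have up: "(\<Sum>i\<in>F. max (d' i - A) 0) \<le> of_int b * (B - A)"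
  proof -
    have "(\<Sum>i\<in>F1. max (d i - A) 0) = (\<Sum>i\<in>F1. 0)"
      using F1(2) by (intro sum.cong) (auto simp: J_def)
    moreover have "(\<Sum>i\<in>F2. max (d i - A) 0) = (\<Sum>i\<in>F2. d i - A)"
      using F2(2) by (intro sum.cong) (auto simp: K_def)
    moreover have "max (c - A) 0 = 0" "max (B - D - A) 0 = B - D - A"
      using F1(4) F2(4) AB by (simp_all add: c_def D_def)
    ultimately have "(\<Sum>i\<in>F. max (d' i - A) 0) = B - D - A + (\<Sum>i\<in>F2. d i - A)"
      using sumF[of "\<lambda>x. max (x - A) 0"] by simp
    then have "(\<Sum>i\<in>F. max (d' i - A) 0) = (real (card F2) + 1) * (B - A) - infsum ?f K"
      using Ds sf by (simp add: sum_subtractf algebra_simps)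
    \<comment> \<open>Here the hypothesis \<open>C \<ge> (N + k) A\<close> enters, rewritten by the
      equation as a bound on the total defect; it is exactly the upper inequality of the finite
      problem.\<close>
    moreover have "- infsum ?f K \<le> of_int k * (B - A)"
      using CD C by (simp add: algebra_simps)
    ultimately show ?thesis by (simp add: b_def algebra_simps)
  qed
  obtain x y where xy: "x \<in> J1" "y \<in> K1" using inf1 by (metis ex_in_conv finite.emptyI)
  obtain E :: "'h \<Rightarrow> 'h" and h where E: "positive_operator E"
    "op_spectrum E = {0, complex_of_real A, complex_of_real B}" "orthonormal_basis I h"
    "\<And>i. i \<in> I - F \<Longrightarrow> E (h i) = complex_of_real (d' i) *\<^sub>C h i"
    "\<And>i. i \<in> I \<Longrightarrow> cinner (E (h i)) (h i) = complex_of_real (d' i)"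
  proof -
    have "\<exists>(E :: 'h \<Rightarrow> 'h) h. positive_operator E \<and> op_spectrum E = {0, complex_of_real A, complex_of_real B} \<and>
     orthonormal_basis I h \<and> (\<forall>i\<in>I - F. E (h i) = complex_of_real (d' i) *\<^sub>C h i) \<and>
     (\<forall>i\<in>I. cinner (E (h i)) (h i) = complex_of_real (d' i))"
    proof (rule three_point_finite_rearrangement[OF AB count e finF _ _ _ _ _ tot N up])
      show "d' i \<in> {0, B}" if "i \<in> I - F" for i
        using that d'J d'K unfolding IF by auto
      show "\<exists>i\<in>I - F. d' i = 0" using xy d'J unfolding IF by blast
      show "\<exists>i\<in>I - F. d' i = B" using xy d'K unfolding IF by blast
      show "infinite I" using inf(1) JI infinite_super by blast
      show "0 \<le> d' i \<and> d' i \<le> B" if "i \<in> F" for i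
      proof -
        have "i \<in> F1 \<or> i \<in> F2 \<or> i = j \<or> i = k0" using that by (auto simp: F_def)
        then show ?thesis
          using d'F1 d'F2 d'j d'k range[of i] that finF c0 D0 F1(4) F2(4) AB
          by (auto simp: c_def D_def)
      qed
    qed
    then show ?thesis using that by blast
  qed
  have sJ1: "d summable_on insert j J1" unfolding ins by (rule summable_on_subset_banach[OF summ(1)]) auto
  have sK1: "?f summable_on insert k0 K1" unfolding ins by (rule summable_on_subset_banach[OF summ(2)]) auto
  have "\<exists>h'. orthonormal_basis I h' \<and> (\<forall>i. i \<notin> insert j J1 \<longrightarrow> h' i = h i) \<and>
     (\<forall>i\<in>insert j J1. cinner (E (h' i)) (h' i) = complex_of_real (0 + 1 * d i))"
  proof (rule orthonormal_basis_tail_spread[OF E(3,1) _ _ inf1(1) _ _ _ _ sJ1])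
    show "J1 \<subseteq> I" "j \<in> I" "j \<notin> J1" using JI F1 by (auto simp: J1_def)
    then show "countable J1" using count countable_subset by blast
    show "E (h i) = complex_of_real 0 *\<^sub>C h i" if "i \<in> J1" for i
      using E(4)[of i] that d'J IF by auto
    show "0 \<le> d i" if "i \<in> insert j J1" for i using that range JI unfolding ins by blast
    show "cinner (E (h j)) (h j) = complex_of_real (0 + 1 * infsum d (insert j J1))"
      using E(5)[of j] F1 JI unfolding ins d'j c_def by auto
  qed
  then obtain h1 where h1: "orthonormal_basis I h1" "\<And>i. i \<notin> insert j J1 \<Longrightarrow> h1 i = h i"
    "\<And>i. i \<in> insert j J1 \<Longrightarrow> cinner (E (h1 i)) (h1 i) = complex_of_real (d i)" by auto
  \<comment> \<open>The first spreading leaves the large side alone, so its vectors are still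
    eigenvectors for \<open>B\<close> when the second one starts.\<close>
  have h1K: "h1 i = h i" if "i \<in> insert k0 K1" for i
    using that JK unfolding ins by (intro h1(2)) (auto simp: ins)
  have "\<exists>h'. orthonormal_basis I h' \<and> (\<forall>i. i \<notin> insert k0 K1 \<longrightarrow> h' i = h1 i) \<and>
     (\<forall>i\<in>insert k0 K1. cinner (E (h' i)) (h' i) = complex_of_real (B + - 1 * ?f i))"
  proof (rule orthonormal_basis_tail_spread[OF h1(1) E(1) _ _ inf1(2) _ _ _ _ sK1])
    show "K1 \<subseteq> I" "k0 \<in> I" "k0 \<notin> K1" using KI F2 by (auto simp: K1_def)
    then show "countable K1" using count countable_subset by blast
    show "E (h1 i) = complex_of_real B *\<^sub>C h1 i" if "i \<in> K1" for i
      using E(4)[of i] that d'K IF h1K by auto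
    show "0 \<le> ?f i" if "i \<in> insert k0 K1" for i using that range[of i] KI unfolding ins by auto
    show "cinner (E (h1 k0)) (h1 k0) = complex_of_real (B + - 1 * infsum ?f (insert k0 K1))"
      using E(5)[of k0] F2 KI h1K[of k0] unfolding ins d'k D_def by auto
  qed
  then obtain h2 where h2: "orthonormal_basis I h2" "\<And>i. i \<notin> insert k0 K1 \<Longrightarrow> h2 i = h1 i"
    "\<And>i. i \<in> insert k0 K1 \<Longrightarrow> cinner (E (h2 i)) (h2 i) = complex_of_real (d i)" by auto
  have "cinner (E (h2 i)) (h2 i) = complex_of_real (d i)" if i: "i \<in> I" for i
  proof -
    have "i \<in> insert k0 K1 \<or> i \<in> insert j J1 \<or> i \<in> F1 \<or> i \<in> F2"
      using i I unfolding ins by auto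
    then consider "i \<in> insert k0 K1" | "i \<in> insert j J1" "i \<notin> insert k0 K1"
      | "i \<in> F1 \<or> i \<in> F2" "i \<notin> insert k0 K1" "i \<notin> insert j J1" by blast
    then show ?thesis
    proof cases
      case 1
      then show ?thesis by (rule h2(3))
    next
      case 2
      then show ?thesis using h1(3) h2(2) by simp
    next
      case 3
      then have "d' i = d i" using d'F1 d'F2 by blast
      with 3 show ?thesis using E(5)[OF i] h1(2) h2(2) by simp
    qed
  qed
  with h2(1) have "has_diagonal E I d" unfolding has_diagonal_def by blast
  with E(1,2) show ?thesis by blast
qed

section \<open>Both implications combined\<close>

theorem theorem1p1:
  fixes A B :: real
    and I :: "'i set"
    and d :: "'i \<Rightarrow> real"
    and C D :: ennreal
  assumes AB: "0 < A" "A < B"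
    and countable: "countable I"
    and range: "\<And>i. i \<in> I \<Longrightarrow> 0 \<le> d i \<and> d i \<le> B"
    and sum_d: "(\<Sum>\<^sub>\<infinity>i\<in>I. ennreal (d i)) = \<infinity>"
    and sum_Bd: "(\<Sum>\<^sub>\<infinity>i\<in>I. ennreal (B - d i)) = \<infinity>"
    and C: "C = (\<Sum>\<^sub>\<infinity>i\<in>{i\<in>I. d i < A}. ennreal (d i))"
    and D: "D = (\<Sum>\<^sub>\<infinity>i\<in>{i\<in>I. d i \<ge> A}. ennreal (B - d i))"
    and H: "\<exists>e :: 'i \<Rightarrow> 'h :: complex_hilbert_space. orthonormal_basis I e"
  shows "(\<exists>E :: 'h \<Rightarrow> 'h. positive_operator E \<and> has_diagonal E I d \<and>
            op_spectrum E = {0, complex_of_real A, complex_of_real B})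
    \<longleftrightarrow> (C = \<infinity> \<or> D = \<infinity> \<or>
         (C < \<infinity> \<and> D < \<infinity> \<and>
          (\<exists>(N :: nat) (k :: int). N \<ge> 1 \<and>
             enn2real C - enn2real D = real N * A + real_of_int k * B \<and>
             enn2real C \<ge> (real N + real_of_int k) * A)))"
proof -
  define J K where "J = {i \<in> I. d i < A}" and "K = {i \<in> I. A \<le> d i}"
  let ?f = "\<lambda>i. B - d i"
  have JI: "J \<subseteq> I" and KI: "K \<subseteq> I" and JK: "J \<inter> K = {}" and I: "I = J \<union> K" by (auto simp: J_def K_def)
  have dJ: "0 \<le> d i" if "i \<in> J" for i using that range JI by blast
  have dK: "0 \<le> ?f i" if "i \<in> K" for i using that range[of i] KI by auto
  have Cinf: "C = \<infinity> \<longleftrightarrow> \<not> d summable_on J"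
    unfolding C J_def[symmetric] by (rule infsum_ennreal_eq_top_iff[OF dJ])
  have Dinf: "D = \<infinity> \<longleftrightarrow> \<not> ?f summable_on K"
    unfolding D K_def[symmetric] by (rule infsum_ennreal_eq_top_iff[OF dK])
  have Cfin: "C = ennreal (infsum d J)" "enn2real C = infsum d J" if "d summable_on J"
    using infsum_ennreal_summable[OF that dJ] infsum_nonneg[of J d] dJ by (simp_all add: C J_def)
  have Dfin: "D = ennreal (infsum ?f K)" "enn2real D = infsum ?f K" if "?f summable_on K"
    using infsum_ennreal_summable[OF that dK] infsum_nonneg[of K ?f] dK by (simp_all add: D K_def)
  obtain e :: "'i \<Rightarrow> 'h" where e: "orthonormal_basis I e" using H by blast
  show ?thesis
  proof (cases "d summable_on J \<and> ?f summable_on K")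
    case True
    then have s: "d summable_on J" "?f summable_on K" by auto
    \<comment> \<open>A finite \<open>K\<close> would add only finitely many terms to the convergent
      sum over \<open>J\<close>, contradicting the divergence of the full sum; symmetrically for
      \<open>J\<close>.\<close>
    have "infinite K"
    proof
      assume "finite K"
      then have "d summable_on I" unfolding I by (intro summable_on_Un_disjoint s JK) simp
      then show False using sum_d infsum_ennreal_eq_top_iff[of I d] range by simp
    qed
    have "infinite J"
    proof
      assume "finite J"
      then have "?f summable_on I" unfolding I by (intro summable_on_Un_disjoint s JK) simp
      then show False using sum_Bd infsum_ennreal_eq_top_iff[of I ?f] range by simp
    qed
    have fin: "C \<noteq> \<infinity>" "D \<noteq> \<infinity>" "C < \<infinity>" "D < \<infinity>" using s by (simp_all add: Cfin Dfin)
    show ?thesis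
    proof
      assume "\<exists>E :: 'h \<Rightarrow> 'h. positive_operator E \<and> has_diagonal E I d \<and>
            op_spectrum E = {0, complex_of_real A, complex_of_real B}"
      then obtain E :: "'h \<Rightarrow> 'h" where E: "positive_operator E" "has_diagonal E I d"
        "op_spectrum E = {0, complex_of_real A, complex_of_real B}" by blast
      show "C = \<infinity> \<or> D = \<infinity> \<or> (C < \<infinity> \<and> D < \<infinity> \<and>
          (\<exists>(N :: nat) (k :: int). N \<ge> 1 \<and>
             enn2real C - enn2real D = real N * A + real_of_int k * B \<and>
             enn2real C \<ge> (real N + real_of_int k) * A))"
        using three_point_diagonal_necessary[OF E(1,3) AB E(2)] s fin
        unfolding Cfin(2)[OF s(1)] Dfin(2)[OF s(2)] J_def K_def by blast
    next
      assume "C = \<infinity> \<or> D = \<infinity> \<or> (C < \<infinity> \<and> D < \<infinity> \<and>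
          (\<exists>(N :: nat) (k :: int). N \<ge> 1 \<and>
             enn2real C - enn2real D = real N * A + real_of_int k * B \<and>
             enn2real C \<ge> (real N + real_of_int k) * A))"
      then obtain N :: nat and k :: int where Nk: "N \<ge> 1"
        "infsum d J - infsum ?f K = real N * A + real_of_int k * B"
        "infsum d J \<ge> (real N + real_of_int k) * A"
        using fin unfolding Cfin(2)[OF s(1)] Dfin(2)[OF s(2)] by blast
      show "\<exists>E :: 'h \<Rightarrow> 'h. positive_operator E \<and> has_diagonal E I d \<and>
            op_spectrum E = {0, complex_of_real A, complex_of_real B}"
        by (rule three_point_operator_exists_convergent[OF AB countable e range _ _ _ _ Nk(1)])
          (use \<open>infinite J\<close> \<open>infinite K\<close> s Nk in \<open>simp_all add: J_def K_def\<close>)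
    qed
  next
    case False
    \<comment> \<open>Up to constants depending on \<open>A\<close> and \<open>B\<close>, the
      minimum dominates \<open>d i\<close> on \<open>J\<close> and \<open>B - d i\<close> on
      \<open>K\<close>, so its summability would make both sums finite.\<close>
    have "\<not> (\<lambda>i. min (d i) (B - d i)) summable_on I"
    proof
      let ?m = "\<lambda>i. min (d i) (B - d i)"
      assume m: "?m summable_on I"
      \<comment> \<open>When the minimum is \<open>B - d i\<close>, it exceeds \<open>B - A\<close>,
        so the factor \<open>A / (B - A)\<close> lifts it above \<open>A > d i\<close>. On
        \<open>K\<close> the factor \<open>B / A\<close> does the same for
        \<open>B - d i\<close>.\<close>
      have leJ: "d i \<le> (1 + A / (B - A)) * ?m i" if i: "i \<in> J" for i
      proof -
        have m0: "0 \<le> ?m i" using range[of i] i JI by auto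
        show ?thesis
        proof (cases "d i \<le> B - d i")
          case True
          have "0 \<le> A / (B - A) * ?m i" using AB m0 by simp
          then show ?thesis using True by (simp add: distrib_right)
        next
          case False
          have "A / (B - A) * (B - A) \<le> A / (B - A) * (B - d i)"
            using AB i by (intro mult_left_mono) (auto simp: J_def)
          then have "A \<le> A / (B - A) * ?m i" using AB False by simp
          moreover have "d i \<le> A" using i by (simp add: J_def)
          ultimately have "d i \<le> A / (B - A) * ?m i + ?m i" using m0 by linarith
          then show ?thesis by (simp add: distrib_right)
        qed
      qed
      have leK: "?f i \<le> (1 + B / A) * ?m i" if i: "i \<in> K" for i
      proof -
        have m0: "0 \<le> ?m i" using range[of i] i KI by auto
        show ?thesis
        proof (cases "d i \<le> B - d i")
          case True
          have "B / A * A \<le> B / A * d i"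
            using AB i by (intro mult_left_mono) (auto simp: K_def)
          then have "B \<le> B / A * ?m i" using AB True by simp
          moreover have "0 \<le> d i" using range[of i] i KI by blast
          ultimately have "B - d i \<le> B / A * ?m i + ?m i" using m0 by linarith
          then show ?thesis by (simp add: distrib_right)
        next
          case False
          have "0 \<le> B / A * ?m i" using AB m0 by simp
          then show ?thesis using False by (simp add: distrib_right)
        qed
      qed
      have "(\<lambda>i. (1 + A / (B - A)) * ?m i) summable_on J" "(\<lambda>i. (1 + B / A) * ?m i) summable_on K"
        by (rule summable_on_cmult_right[OF summable_on_subset_banach[OF m JI]]
            summable_on_cmult_right[OF summable_on_subset_banach[OF m KI]])+
      then have "d summable_on J" "?f summable_on K"
        using summable_on_comparison_test[of "\<lambda>i. (1 + A / (B - A)) * ?m i" J d, OF _ leJ dJ]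
          summable_on_comparison_test[of "\<lambda>i. (1 + B / A) * ?m i" K ?f, OF _ leK dK] by blast+
      then show False using False by simp
    qed
    from three_point_operator_exists_divergent[OF AB countable e range this]
    show ?thesis using False Cinf Dinf by blast
  qed
qed

end
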